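(* Let $\Lambda(\Omega)\subset\mathbb{R}^m$ be a simple generic model set with $\Omega$ symmetric around the origin, let $\mathcal{K}$ be a countable index set, and let $g_k\in W(L^2,\ell^1)$ for every $k\in\mathcal{K}$. Then the family $\{T_\lambda g_k:k\in\mathcal{K},\lambda\in\Lambda(\Omega)\}$ is a normalized tight frame for $L^2(\mathbb{R}^m)$ if and only if it is a Bessel sequence with upper frame bound $B_g=1$ and $$D(\Lambda(\Omega))\sum_{k\in\mathcal{K}}|\widehat{g_k}(t)|^2=1\quad\text{for a.e. } t\in\mathbb{R}^m.$$
   Context: Notation: $T_\lambda f(t)=f(t-\lambda)$; $\widehat f(\omega)=\int_{\mathbb{R}^m} f(t)e^{-2\pi i t\cdot\omega}\,dt$. $W(L^p,\ell^q)$ is the space of measurable functions $f$ on $\mathbb{R}^m$ with $\|f\|_{p,q}=\big(\sum_{k\in\mathbb{Z}^m}\|f\mathbf{1}_{k+[0,1]^m}\|_p^q\big)^{1/q}<\infty$. The family is a Bessel sequence with upper frame bound $B_g$ if $\sum_{k}\sum_{\lambda\in\Lambda(\Omega)}|\langle f,T_\lambda g_k\rangle|^2\le B_g\|f\|_2^2$ for all $f\in L^2(\mathbb{R}^m)$; it is a normalized tight frame if this sum equals $\|f\|_2^2$ for all $f\in L^2(\mathbb{R}^m)$. Model sets: let $\Gamma\subset\mathbb{R}^m\times\mathbb{R}$ be a lattice and $p_1:\mathbb{R}^m\times\mathbb{R}\to\mathbb{R}^m$, $p_2:\mathbb{R}^m\times\mathbb{R}\to\mathbb{R}$ the orthogonal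 projections; assume $p_1|_\Gamma$ and $p_2|_\Gamma$ are injective with dense images. $\Gamma^*$ is the dual lattice and $p_1^*,p_2^*$ are the same projections used on $\Gamma^*$. For a compact interval $\Omega\subset\mathbb{R}$ with non-empty interior, $\Lambda(\Omega)=\{p_1(\gamma):\gamma\in\Gamma,\ p_2(\gamma)\in\Omega\}$ is a simple model set; it is generic if $p_2(\Gamma)\cap\partial\Omega=\emptyset$. Standing assumption: also $p_2^*(\Gamma^* )\cap\partial\Omega=\emptyset$. Its density is $D(\Lambda(\Omega))=\lim_{R\to\infty}\#(\Lambda(\Omega)\cap(x+R[0,1]^m))/R^m=|\Omega|/\mathrm{vol}(\Gamma)$. *)

theory Defs
  imports "HOL-Analysis.Analysis"
begin

subsection \<open>Function spaces\<close>

text \<open>Functions on \<open>\<real>\<^sup>m\<close> have type \<^typ>\<open>real ^ 'm \<Rightarrow> complex\<close> and \<open>m = CARD('m)\<close>.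
  Elements of \<open>L\<^sup>2\<close> are represented by Lebesgue measurable functions.\<close>

definition L2 :: "(real ^ 'm \<Rightarrow> complex) set" where
  "L2 = {f \<in> borel_measurable lebesgue.
           (\<integral>\<^sup>+ t. ennreal ((cmod (f t))\<^sup>2) \<partial>lebesgue) < \<infinity>}"

definition L2_norm_sq :: "(real ^ 'm \<Rightarrow> complex) \<Rightarrow> ennreal" where
  "L2_norm_sq f = (\<integral>\<^sup>+ t. ennreal ((cmod (f t))\<^sup>2) \<partial>lebesgue)"

definition L2_inner :: "(real ^ 'm \<Rightarrow> complex) \<Rightarrow> (real ^ 'm \<Rightarrow> complex) \<Rightarrow> complex" where
  "L2_inner f g = (LINT t|lebesgue. f t * cnj (g t))"

definition translation :: "real ^ 'm \<Rightarrow> (real ^ 'm \<Rightarrow> complex) \<Rightarrow> real ^ 'm \<Rightarrow> complex" where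
  "translation l f = (\<lambda>t. f (t - l))"

definition fourier :: "(real ^ 'm \<Rightarrow> complex) \<Rightarrow> real ^ 'm \<Rightarrow> complex" where
  "fourier f \<omega> = (LINT t|lebesgue. f t * exp (- (2 * pi * \<i> * of_real (t \<bullet> \<omega>))))"

text \<open>Real powers on the extended nonnegative reals, for positive exponents only.\<close>

definition ennreal_powr :: "ennreal \<Rightarrow> real \<Rightarrow> ennreal" where
  "ennreal_powr x p = (if x = \<infinity> then \<infinity> else ennreal (enn2real x powr p))"

definition Lp_norm :: "real \<Rightarrow> (real ^ 'm \<Rightarrow> complex) \<Rightarrow> ennreal" where
  "Lp_norm p f = ennreal_powr (\<integral>\<^sup>+ t. ennreal (cmod (f t) powr p) \<partial>lebesgue) (1 / p)"

definition unit_cube :: "(real ^ 'm) set" where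
  "unit_cube = {t. \<forall>i. 0 \<le> t $ i \<and> t $ i \<le> 1}"

definition integer_vectors :: "(real ^ 'm) set" where
  "integer_vectors = {k. \<forall>i. k $ i \<in> \<int>}"

text \<open>The Wiener amalgam norm and space \<open>W(L\<^sup>p, \<ell>\<^sup>q)\<close> for finite exponents \<open>p, q \<ge> 1\<close>.\<close>

definition amalgam_norm :: "real \<Rightarrow> real \<Rightarrow> (real ^ 'm \<Rightarrow> complex) \<Rightarrow> ennreal" where
  "amalgam_norm p q f =
     ennreal_powr
       (\<Sum>\<^sub>\<infinity>k\<in>integer_vectors.
          ennreal_powr (Lp_norm p (\<lambda>t. f t * indicator ((\<lambda>s. k + s) ` unit_cube) t)) q)
       (1 / q)"

definition wiener_amalgam :: "real \<Rightarrow> real \<Rightarrow> (real ^ 'm \<Rightarrow> complex) set" where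
  "wiener_amalgam p q = {f \<in> borel_measurable lebesgue. amalgam_norm p q f < \<infinity>}"


subsection \<open>Lattices and model sets\<close>

text \<open>Full-rank lattices.\<close>

definition is_lattice :: "'a::euclidean_space set \<Rightarrow> bool" where
  "is_lattice \<Gamma> \<longleftrightarrow>
     (\<exists>B. independent B \<and> span B = UNIV \<and>
          \<Gamma> = {\<Sum>b\<in>B. of_int (c b) *\<^sub>R b | c. True})"

definition dual_lattice :: "'a::euclidean_space set \<Rightarrow> 'a set" where
  "dual_lattice \<Gamma> = {y. \<forall>x\<in>\<Gamma>. x \<bullet> y \<in> \<int>}"

definition cut_and_project_lattice :: "((real ^ 'm) \<times> real) set \<Rightarrow> bool" where
  "cut_and_project_lattice \<Gamma> \<longleftrightarrow>
     is_lattice \<Gamma> \<and>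
     inj_on fst \<Gamma> \<and> closure (fst ` \<Gamma>) = UNIV \<and>
     inj_on snd \<Gamma> \<and> closure (snd ` \<Gamma>) = UNIV"

definition model_window :: "real set \<Rightarrow> bool" where
  "model_window \<Omega> \<longleftrightarrow> compact \<Omega> \<and> is_interval \<Omega> \<and> interior \<Omega> \<noteq> {}"

definition model_set :: "((real ^ 'm) \<times> real) set \<Rightarrow> real set \<Rightarrow> (real ^ 'm) set" where
  "model_set \<Gamma> \<Omega> = {fst \<gamma> | \<gamma>. \<gamma> \<in> \<Gamma> \<and> snd \<gamma> \<in> \<Omega>}"

definition generic_window :: "((real ^ 'm) \<times> real) set \<Rightarrow> real set \<Rightarrow> bool" where
  "generic_window \<Gamma> \<Omega> \<longleftrightarrow> snd ` \<Gamma> \<inter> frontier \<Omega> = {}"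

text \<open>The limit must exist and have the same value for every corner \<open>x\<close> of the cubes.\<close>

definition has_density :: "(real ^ 'm) set \<Rightarrow> real \<Rightarrow> bool" where
  "has_density \<Lambda> d \<longleftrightarrow>
     (\<forall>x. ((\<lambda>R. real (card (\<Lambda> \<inter> (\<lambda>s. x + R *\<^sub>R s) ` unit_cube)) / R ^ CARD('m))
            \<longlongrightarrow> d) at_top)"

definition point_density :: "(real ^ 'm) set \<Rightarrow> real" where
  "point_density \<Lambda> = (THE d. has_density \<Lambda> d)"


subsection \<open>Systems of translates\<close>

text \<open>The sums are taken in \<^typ>\<open>ennreal\<close>, so a divergent sum has the value \<open>\<infinity>\<close>.
  The family is indexed by pairs \<open>(k, l)\<close>; coinciding members count with multiplicity.\<close>

definition frame_sum ::
  "(real ^ 'm) set \<Rightarrow> 'k set \<Rightarrow> ('k \<Rightarrow> real ^ 'm \<Rightarrow> complex) \<Rightarrow> (real ^ 'm \<Rightarrow> complex) \<Rightarrow> ennreal"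
  where
  "frame_sum \<Lambda> K g f =
     (\<Sum>\<^sub>\<infinity>k\<in>K. \<Sum>\<^sub>\<infinity>l\<in>\<Lambda>. ennreal ((cmod (L2_inner f (translation l (g k))))\<^sup>2))"

definition bessel_with_bound ::
  "(real ^ 'm) set \<Rightarrow> 'k set \<Rightarrow> ('k \<Rightarrow> real ^ 'm \<Rightarrow> complex) \<Rightarrow> real \<Rightarrow> bool" where
  "bessel_with_bound \<Lambda> K g B \<longleftrightarrow>
     (\<forall>f\<in>L2. frame_sum \<Lambda> K g f \<le> ennreal B * L2_norm_sq f)"

definition normalized_tight_frame ::
  "(real ^ 'm) set \<Rightarrow> 'k set \<Rightarrow> ('k \<Rightarrow> real ^ 'm \<Rightarrow> complex) \<Rightarrow> bool" where
  "normalized_tight_frame \<Lambda> K g \<longleftrightarrow> (\<forall>f\<in>L2. frame_sum \<Lambda> K g f = L2_norm_sq f)"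

end

theory Submission
  imports Defs "HOL-Probability.Characteristic_Functions" "HOL-Real_Asymp.Real_Asymp"
begin

text \<open>
  Let \<open>\<Lambda>\<close> be the model set, \<open>D\<close> its density and \<open>N = \<parallel>f\<parallel>\<^sup>2\<close>. For a fixed \<open>f\<close> consider the
  frame sum of the translates of \<open>f\<close>,
  \<open>F(x) = (\<Sum>k. \<Sum>l\<in>\<Lambda>. \<bar>\<langle>T\<^sub>-\<^sub>x f, T\<^sub>l g\<^sub>k\<rangle>\<bar>\<^sup>2) = (\<Sum>l\<in>\<Lambda>. \<Phi>(l + x))\<close>, where \<open>\<Phi>(y) = (\<Sum>k. \<bar>\<langle>f, T\<^sub>y g\<^sub>k\<rangle>\<bar>\<^sup>2)\<close>.
  Since \<open>\<Lambda>\<close> has a density and boundedly many points per unit cube, the averages of \<open>F\<close> over large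
  cubes tend to \<open>D\<close> times the integral of \<open>\<Phi>\<close> (\<open>averaging_set.mean_tendsto\<close>), and by Plancherel
  that integral is the integral of \<open>\<bar>f^\<bar>\<^sup>2\<close> against the weight \<open>\<Sum>k. \<bar>g\<^sub>k^\<bar>\<^sup>2\<close>
  (\<open>generators.integral_local_energy\<close>). So the spectral condition says that the mean of \<open>F\<close> is \<open>N\<close>.

  For a normalized tight frame \<open>F\<close> is constant with value \<open>N\<close>, and therefore the weight
  \<open>D * (\<Sum>k. \<bar>g\<^sub>k^\<bar>\<^sup>2)\<close> has the same integral as \<open>1\<close> against every \<open>\<bar>f^\<bar>\<^sup>2\<close>. Modulated Gaussians \<open>f\<close>
  already force the weight to be \<open>1\<close> almost everywhere (\<open>weight_eq_1\<close>).

  Conversely, the Bessel bound gives \<open>F \<le> N\<close> while the mean of \<open>F\<close> is \<open>N\<close>. If \<open>F(0) < N\<close>, the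
  deficit at \<open>0\<close> recurs: when \<open>\<gamma> \<in> \<Gamma>\<close> has a small second component, translation by its first
  component moves the window only slightly, and \<open>F\<close> at that point exceeds \<open>F(0)\<close> by little
  (\<open>generators.energy_almost_period\<close>). These almost periods form a model set with a smaller
  window, which has positive density, and \<open>F\<close> varies continuously; so the mean of \<open>F\<close> would be
  strictly below \<open>N\<close>. Hence \<open>F(0) = N\<close>, which is the tight frame identity for \<open>f\<close>.

  The argument is carried out for continuous, bounded, integrable \<open>f\<close> and extended to \<open>L\<^sup>2\<close> by
  density. Membership of the \<open>g\<^sub>k\<close> in \<open>W(L\<^sup>2, \<ell>\<^sup>1)\<close> enters through its consequence that they are
  integrable and square integrable.
\<close>

section \<open>Lattice points in boxes\<close>

lemma emeasure_lborel_translate: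
  fixes A :: "'a::euclidean_space set"
  assumes "A \<in> sets lborel"
  shows "emeasure lborel ((+) c ` A) = emeasure lborel A" "(+) c ` A \<in> sets lborel"
proof -
  have eq: "(+) c ` A = (+) (- c) -` A" by (force simp: image_iff)
  show "(+) c ` A \<in> sets lborel"
    unfolding eq using assms by (simp add: measurable_sets_borel[of "(+) (-c)" borel])
  have "emeasure lborel A = emeasure (distr lborel borel ((+) (-c))) A"
    by (simp only: lborel_distr_plus)
  also have "\<dots> = emeasure lborel ((+) (-c) -` A)" using assms by (subst emeasure_distr) auto
  finally show "emeasure lborel ((+) c ` A) = emeasure lborel A" unfolding eq by simp
qed

text \<open>The domain is the half-open parallelepiped of a basis: subtracting the integer parts of the
  coordinates of a vector is the unique way to move it there by a lattice vector.\<close>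

lemma lattice_fundamental_domain:
  fixes \<Gamma> :: "'a::euclidean_space set"
  assumes "is_lattice \<Gamma>"
  obtains P v where "bounded P" "P \<in> sets lborel" "0 < v" "emeasure lborel P = ennreal v"
    "disjoint_family_on (\<lambda>\<gamma>. (+) \<gamma> ` P) \<Gamma>" "(\<Union>\<gamma>\<in>\<Gamma>. (+) \<gamma> ` P) = UNIV" "countable \<Gamma>"
proof -
  from assms obtain B :: "'a set" where B: "independent B" "span B = UNIV"
    and \<Gamma>: "\<Gamma> = {\<Sum>b\<in>B. of_int (c b) *\<^sub>R b | c. True}"
    unfolding is_lattice_def by blast
  have fin: "finite B" using B(1) by (rule independent_imp_finite)
  define r where "r = representation B"
  have r_lin: "linear (\<lambda>x. r x b)" for b
    unfolding r_def
    by (rule linearI) (simp_all add: real_vector.representation_add[OF B(1)] real_vector.representation_scale[OF B(1)] B(2))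
  have r_eq: "(\<Sum>b\<in>B. r x b *\<^sub>R b) = x" for x
    unfolding r_def using B fin
    by (intro real_vector.sum_representation_eq) auto
  have r_basis: "r (\<Sum>b\<in>B. c b *\<^sub>R b) b' = c b'" if "b' \<in> B" for c b'
  proof -
    have "r (\<Sum>b\<in>B. c b *\<^sub>R b) b' = (\<Sum>b\<in>B. c b * r b b')"
      by (simp add: linear_sum[OF r_lin] linear_cmul[OF r_lin])
    also have "\<dots> = (\<Sum>b\<in>B. if b = b' then c b else 0)"
      unfolding r_def by (intro sum.cong refl) (auto simp: real_vector.representation_basis[OF B(1)])
    finally show ?thesis using that fin by simp
  qed
  have r_cont: "continuous_on UNIV (\<lambda>x. r x b)" for b
    using r_lin linear_continuous_on linear_conv_bounded_linear by blast
  define P where "P = {x. \<forall>b\<in>B. 0 \<le> r x b \<and> r x b < 1}"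
  have r_meas [measurable]: "(\<lambda>x. r x b) \<in> borel_measurable borel" for b
    using r_cont by (rule borel_measurable_continuous_onI)
  have P_meas: "P \<in> sets lborel"
  proof -
    have "{x \<in> space lborel. \<forall>b\<in>B. 0 \<le> r x b \<and> r x b < 1} \<in> sets lborel"
      using fin by measurable
    then show ?thesis by (simp add: P_def)
  qed
  have P_bdd: "bounded P"
  proof (rule boundedI)
    fix x assume x: "x \<in> P"
    have "norm x = norm (\<Sum>b\<in>B. r x b *\<^sub>R b)" by (simp add: r_eq)
    also have "\<dots> \<le> (\<Sum>b\<in>B. norm (r x b *\<^sub>R b))" by (rule norm_sum)
    also have "\<dots> \<le> (\<Sum>b\<in>B. norm b)"
      using x by (intro sum_mono) (auto simp: P_def mult_left_le_one_le)
    finally show "norm x \<le> (\<Sum>b\<in>B. norm b)" .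
  qed
  have cover: "(\<Union>\<gamma>\<in>\<Gamma>. (+) \<gamma> ` P) = UNIV"
  proof (intro equalityI subset_UNIV subsetI)
    fix x :: 'a
    define \<gamma> where "\<gamma> = (\<Sum>b\<in>B. of_int \<lfloor>r x b\<rfloor> *\<^sub>R b)"
    have "\<gamma> \<in> \<Gamma>" unfolding \<Gamma> \<gamma>_def by (intro CollectI exI[of _ "\<lambda>b. \<lfloor>r x b\<rfloor>"]) simp
    moreover have "x - \<gamma> \<in> P"
      unfolding P_def
    proof (intro CollectI ballI)
      fix b assume "b \<in> B"
      then have "r (x - \<gamma>) b = r x b - of_int \<lfloor>r x b\<rfloor>"
        unfolding linear_diff[OF r_lin] \<gamma>_def by (simp add: r_basis)
      then show "0 \<le> r (x - \<gamma>) b \<and> r (x - \<gamma>) b < 1" by linarith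
    qed
    ultimately show "x \<in> (\<Union>\<gamma>\<in>\<Gamma>. (+) \<gamma> ` P)"
      by (intro UN_I[of \<gamma>]) (auto intro!: image_eqI[of _ _ "x - \<gamma>"])
  qed
  have disj: "disjoint_family_on (\<lambda>\<gamma>. (+) \<gamma> ` P) \<Gamma>"
  proof (unfold disjoint_family_on_def, intro ballI impI, rule ccontr)
    fix g h assume gh: "g \<in> \<Gamma>" "h \<in> \<Gamma>" "g \<noteq> h" "(+) g ` P \<inter> (+) h ` P \<noteq> {}"
    then obtain p q where pq: "p \<in> P" "q \<in> P" "g + p = h + q" by blast
    obtain c where c: "g = (\<Sum>b\<in>B. of_int (c b) *\<^sub>R b)" using gh(1) \<Gamma> by blast
    obtain d where d: "h = (\<Sum>b\<in>B. of_int (d b) *\<^sub>R b)" using gh(2) \<Gamma> by blast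
    have "c b = d b" if "b \<in> B" for b
    proof -
      have "r g b + r p b = r h b + r q b"
        using pq(3) linear_add[OF r_lin[of b]] by metis
      moreover have "r g b = c b" "r h b = d b" unfolding c d using that by (auto simp: r_basis)
      moreover have "0 \<le> r p b" "r p b < 1" "0 \<le> r q b" "r q b < 1"
        using pq that by (auto simp: P_def)
      ultimately have "\<bar>real_of_int (c b) - real_of_int (d b)\<bar> < 1" by linarith
      then show ?thesis by linarith
    qed
    then have "g = h" unfolding c d by (intro sum.cong) auto
    with gh show False by simp
  qed
  have count: "countable \<Gamma>"
  proof -
    have "\<Gamma> \<subseteq> (\<lambda>c. \<Sum>b\<in>B. of_int (c b) *\<^sub>R b) ` (PiE B (\<lambda>_. UNIV :: int set))"
    proof
      fix x assume "x \<in> \<Gamma>"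
      then obtain c where c: "x = (\<Sum>b\<in>B. of_int (c b) *\<^sub>R b)" using \<Gamma> by blast
      then have "x = (\<Sum>b\<in>B. of_int (restrict c B b) *\<^sub>R b)" by simp
      then show "x \<in> (\<lambda>c. \<Sum>b\<in>B. of_int (c b) *\<^sub>R b) ` (PiE B (\<lambda>_. UNIV :: int set))"
        by (intro image_eqI[of _ _ "restrict c B"]) auto
    qed
    moreover have "countable (PiE B (\<lambda>_. UNIV :: int set))"
      using fin by (intro countable_PiE) auto
    ultimately show ?thesis by (meson countable_subset countable_image)
  qed
  have "emeasure lborel P \<noteq> 0"
  proof
    assume "emeasure lborel P = 0"
    then have "(+) \<gamma> ` P \<in> null_sets lborel" for \<gamma> using emeasure_lborel_translate[OF P_meas] by (auto simp: null_sets_def)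
    then have "(\<Union>\<gamma>\<in>\<Gamma>. (+) \<gamma> ` P) \<in> null_sets lborel" using count by (intro null_sets_UN') auto
    then show False unfolding cover by (auto simp: null_sets_def)
  qed
  moreover have "emeasure lborel P < \<infinity>" using P_bdd by (rule emeasure_bounded_finite)
  ultimately have "0 < measure lborel P" "emeasure lborel P = ennreal (measure lborel P)"
    by (auto simp: emeasure_eq_ennreal_measure less_top measure_nonneg zero_less_measure_iff)
  from that[OF P_bdd P_meas this disj cover count] show ?thesis .
qed

abbreviation cube :: "real ^ 'm \<Rightarrow> real \<Rightarrow> (real ^ 'm) set" where
  "cube x R \<equiv> cbox x (x + (\<chi> i. R))"

lemma emeasure_cube: "0 \<le> R \<Longrightarrow> emeasure lborel (cube x R :: (real ^ 'm) set) = ennreal (R ^ CARD('m))"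
  by (subst emeasure_lborel_cbox) (auto simp: Basis_vec_def inner_axis prod.reindex inj_on_def axis_eq_axis
     intro!: arg_cong[where f=ennreal] simp: prod.UNION_disjoint UNION_singleton_eq_range)

lemma emeasure_cube_Icc: "0 \<le> R \<Longrightarrow> \<alpha> \<le> \<beta> \<Longrightarrow>
   emeasure lborel (cube x R \<times> {\<alpha>..\<beta>} :: ((real ^ 'm) \<times> real) set) = ennreal (R ^ CARD('m) * (\<beta> - \<alpha>))"
  by (simp flip: lborel_prod add: lborel.emeasure_pair_measure_Times emeasure_cube ennreal_mult)

text \<open>Volume comparison: the translates of a fundamental domain that belong to the lattice points
  in a box fill the box up to a layer whose thickness \<open>d\<close> does not depend on the box.\<close>

lemma lattice_box_count:
  fixes \<Gamma> :: "((real ^ 'm) \<times> real) set"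
  assumes "is_lattice \<Gamma>"
  obtains v d where "0 < v" "0 < d"
   "\<And>x (R::real) (\<alpha>::real) (\<beta>::real). 0 \<le> R \<Longrightarrow> \<alpha> \<le> \<beta> \<Longrightarrow> finite (\<Gamma> \<inter> (cube x R \<times> {\<alpha>..\<beta>})) \<and>
       real (card (\<Gamma> \<inter> (cube x R \<times> {\<alpha>..\<beta>}))) * v \<le> (R + 2 * d) ^ CARD('m) * (\<beta> - \<alpha> + 2 * d)"
   "\<And>x (R::real) (\<alpha>::real) (\<beta>::real). 2 * d \<le> R \<Longrightarrow> 2 * d \<le> \<beta> - \<alpha> \<Longrightarrow>
       (R - 2 * d) ^ CARD('m) * (\<beta> - \<alpha> - 2 * d) \<le> real (card (\<Gamma> \<inter> (cube x R \<times> {\<alpha>..\<beta>}))) * v"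
proof -
  obtain P v where P: "bounded P" "P \<in> sets lborel" "0 < v" "emeasure lborel P = ennreal v"
    and disj: "disjoint_family_on (\<lambda>\<gamma>. (+) \<gamma> ` P) \<Gamma>"
    and cover: "(\<Union>\<gamma>\<in>\<Gamma>. (+) \<gamma> ` P) = UNIV" "countable \<Gamma>"
    by (rule lattice_fundamental_domain[OF assms]) blast
  obtain d where d: "0 < d" "\<And>p. p \<in> P \<Longrightarrow> norm p \<le> d"
    using P(1) bounded_pos by blast
  have Pd: "\<bar>fst p $ i\<bar> \<le> d" "\<bar>snd p\<bar> \<le> d" if "p \<in> P" for p i
    using d(2)[OF that] component_le_norm_cart[of "fst p" i] norm_fst_le[of "fst p" "snd p"]
      norm_snd_le[of "snd p" "fst p"] by auto
  have em: "emeasure lborel (\<Union>\<gamma>\<in>S. (+) \<gamma> ` P) = ennreal (card S * v)" if "S \<subseteq> \<Gamma>" "finite S" for S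
  proof -
    have "emeasure lborel (\<Union>\<gamma>\<in>S. (+) \<gamma> ` P) = (\<Sum>\<gamma>\<in>S. emeasure lborel ((+) \<gamma> ` P))"
      using that disj emeasure_lborel_translate[OF P(2)]
      by (intro sum_emeasure[symmetric]) (auto intro: disjoint_family_on_mono)
    also have "\<dots> = (\<Sum>\<gamma>\<in>S. ennreal v)" using emeasure_lborel_translate[OF P(2)] P(4) by simp
    also have "\<dots> = ennreal (card S * v)" using P(3) by (simp add: ennreal_mult ennreal_of_nat_eq_real_of_nat)
    finally show ?thesis .
  qed
  have up: "finite (\<Gamma> \<inter> (cube x R \<times> {\<alpha>..\<beta>})) \<and>
       real (card (\<Gamma> \<inter> (cube x R \<times> {\<alpha>..\<beta>}))) * v \<le> (R + 2 * d) ^ CARD('m) * (\<beta> - \<alpha> + 2 * d)"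
    if R: "0 \<le> R" "\<alpha> \<le> \<beta>" for x R \<alpha> \<beta>
  proof -
    define W where "W = cube x R \<times> {\<alpha>..\<beta>}"
    define W' where "W' = cube (x - (\<chi> i. d)) (R + 2 * d) \<times> {\<alpha> - d..\<beta> + d}"
    have emW: "emeasure lborel W' = ennreal ((R + 2 * d) ^ CARD('m) * (\<beta> - \<alpha> + 2 * d))"
      unfolding W'_def using that d by (subst emeasure_cube_Icc) (auto simp: algebra_simps)
    have *: "card S * v \<le> (R + 2 * d) ^ CARD('m) * (\<beta> - \<alpha> + 2 * d)" if S: "S \<subseteq> \<Gamma> \<inter> W" "finite S" for S
    proof -
      \<comment> \<open>A translate of \<open>P\<close> by a point of the box stays in the box enlarged by \<open>d\<close> on every side.\<close>
      have "(\<Union>\<gamma>\<in>S. (+) \<gamma> ` P) \<subseteq> W'"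
      proof
        fix w assume "w \<in> (\<Union>\<gamma>\<in>S. (+) \<gamma> ` P)"
        then obtain a b p q where w: "w = (a, b) + (p, q)" and "(a, b) \<in> S" "(p, q) \<in> P"
          by auto
        then have "(a, b) \<in> W" "\<bar>p $ i\<bar> \<le> d" "\<bar>q\<bar> \<le> d" for i using S Pd[of "(p,q)"] by auto
        then have b: "x $ i \<le> a $ i" "a $ i \<le> x $ i + R" "\<alpha> \<le> b" "b \<le> \<beta>" "\<bar>p $ i\<bar> \<le> d" "\<bar>q\<bar> \<le> d" for i
           by (auto simp: W_def mem_box_cart)
        have "x $ i - d \<le> a $ i + p $ i" "a $ i + p $ i \<le> x $ i - d + (R + 2 * d)"
           "\<alpha> - d \<le> b + q" "b + q \<le> \<beta> + d" for i
          using b(1,2,5)[of i] b(3,4,6) by linarith+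
        then show "w \<in> W'"
          unfolding w by (auto simp: W'_def mem_box_cart)
      qed
      then have "emeasure lborel (\<Union>\<gamma>\<in>S. (+) \<gamma> ` P) \<le> emeasure lborel W'"
        by (intro emeasure_mono) (auto simp: W'_def borel_Times)
      then have "ennreal (card S * v) \<le> ennreal ((R + 2 * d) ^ CARD('m) * (\<beta> - \<alpha> + 2 * d))"
        using em[of S] S emW by simp
      moreover have "0 \<le> (R + 2 * d) ^ CARD('m) * (\<beta> - \<alpha> + 2 * d)"
        using R d by (intro mult_nonneg_nonneg) auto
      ultimately show ?thesis by (simp only: ennreal_le_iff)
    qed
    have "finite (\<Gamma> \<inter> W)"
    proof (rule ccontr)
      assume "infinite (\<Gamma> \<inter> W)"
      then obtain S where "S \<subseteq> \<Gamma> \<inter> W" "finite S"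
         "card S = Suc (nat \<lceil>(R + 2 * d) ^ CARD('m) * (\<beta> - \<alpha> + 2 * d) / v\<rceil>)"
        using infinite_arbitrarily_large by blast
      then have "card S * v \<le> (R + 2 * d) ^ CARD('m) * (\<beta> - \<alpha> + 2 * d)"
        "(R + 2 * d) ^ CARD('m) * (\<beta> - \<alpha> + 2 * d) / v < card S"
        using *[of S] by (blast, linarith)
      then show False using P(3) by (simp add: field_simps)
    qed
    with *[OF subset_refl] show ?thesis unfolding W_def by simp
  qed
  have low: "(R - 2 * d) ^ CARD('m) * (\<beta> - \<alpha> - 2 * d) \<le> real (card (\<Gamma> \<inter> (cube x R \<times> {\<alpha>..\<beta>}))) * v"
    if "2 * d \<le> R" "2 * d \<le> \<beta> - \<alpha>" for x R \<alpha> \<beta>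
  proof -
    define W where "W = cube x R \<times> {\<alpha>..\<beta>}"
    define W' where "W' = cube (x + (\<chi> i. d)) (R - 2 * d) \<times> {\<alpha> + d..\<beta> - d}"
    have emW: "emeasure lborel W' = ennreal ((R - 2 * d) ^ CARD('m) * (\<beta> - \<alpha> - 2 * d))"
      unfolding W'_def using that d by (subst emeasure_cube_Icc) (auto simp: algebra_simps)
    \<comment> \<open>A translate of \<open>P\<close> that meets the shrunk box has its lattice point in the box itself.\<close>
    have "W' \<subseteq> (\<Union>\<gamma>\<in>\<Gamma> \<inter> W. (+) \<gamma> ` P)"
    proof
      fix w assume w: "w \<in> W'"
      obtain \<gamma> where g: "\<gamma> \<in> \<Gamma>" "w \<in> (+) \<gamma> ` P" using cover by blast
      then obtain p where p: "p \<in> P" "w = \<gamma> + p" by blast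
      have 1: "x $ i + d \<le> fst w $ i" "fst w $ i \<le> x $ i + d + (R - 2 * d)"
          "\<alpha> + d \<le> snd w" "snd w \<le> \<beta> - d" for i
        using w by (auto simp: W'_def mem_box_cart)
      have 2: "fst \<gamma> $ i = fst w $ i - fst p $ i" "snd \<gamma> = snd w - snd p" for i using p by auto
      have "x $ i \<le> fst \<gamma> $ i" "fst \<gamma> $ i \<le> x $ i + R" for i
         using 1(1,2)[of i] 2(1)[of i] Pd(1)[OF p(1), of i] by linarith+
      moreover have "\<alpha> \<le> snd \<gamma>" "snd \<gamma> \<le> \<beta>"
         using 1(3,4) 2(2) Pd(2)[OF p(1)] by linarith+
      ultimately have "\<gamma> \<in> W" by (auto simp: W_def mem_box_cart mem_Times_iff)
      with g show "w \<in> (\<Union>\<gamma>\<in>\<Gamma> \<inter> W. (+) \<gamma> ` P)" by blast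
    qed
    moreover have fin: "finite (\<Gamma> \<inter> W)" using up[of R \<alpha> \<beta> x] that d unfolding W_def by auto
    moreover have "(\<Union>\<gamma>\<in>\<Gamma> \<inter> W. (+) \<gamma> ` P) \<in> sets lborel"
      using fin emeasure_lborel_translate(2)[OF P(2)] by (intro sets.finite_UN) auto
    ultimately have "emeasure lborel W' \<le> ennreal (card (\<Gamma> \<inter> W) * v)"
      unfolding em[OF inf_le1 fin, symmetric] by (intro emeasure_mono)
    moreover have "0 \<le> card (\<Gamma> \<inter> W) * v" using P(3) by simp
    ultimately show ?thesis unfolding emW W_def[symmetric] by (simp only: ennreal_le_iff)
  qed
  from that[OF P(3) d(1) up low] show ?thesis by blast
qed

section \<open>Density of model sets\<close>

lemma lattice_add_diff:
  assumes "is_lattice \<Gamma>" "x \<in> \<Gamma>" "y \<in> \<Gamma>"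
  shows "x + y \<in> \<Gamma>" "x - y \<in> \<Gamma>"
proof -
  obtain B where G: "\<Gamma> = {\<Sum>b\<in>B. of_int (c b) *\<^sub>R b | c. True}"
    using assms(1) unfolding is_lattice_def by blast
  obtain c where c: "x = (\<Sum>b\<in>B. of_int (c b) *\<^sub>R b)" using assms(2) G by blast
  obtain d where d: "y = (\<Sum>b\<in>B. of_int (d b) *\<^sub>R b)" using assms(3) G by blast
  have "x + y = (\<Sum>b\<in>B. of_int (c b + d b) *\<^sub>R b)"
    unfolding c d by (simp add: sum.distrib scaleR_add_left)
  then show "x + y \<in> \<Gamma>" unfolding G by (intro CollectI exI conjI TrueI)
  have "x - y = (\<Sum>b\<in>B. of_int (c b - d b) *\<^sub>R b)"
    unfolding c d by (simp add: sum_subtractf scaleR_diff_left)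
  then show "x - y \<in> \<Gamma>" unfolding G by (intro CollectI exI conjI TrueI)
qed

lemma lattice_uminus:
  assumes "is_lattice \<Gamma>" "x \<in> \<Gamma>"
  shows "- x \<in> \<Gamma>"
  using lattice_add_diff(2)[OF assms(1) lattice_add_diff(2)[OF assms(1) assms(2,2)] assms(2)] by simp

lemma lattice_snd_in_interval:
  assumes "cut_and_project_lattice \<Gamma>" "\<alpha> < \<beta>"
  obtains \<gamma> where "\<gamma> \<in> \<Gamma>" "\<alpha> < snd \<gamma>" "snd \<gamma> < \<beta>"
proof -
  have "closure (snd ` \<Gamma>) = UNIV" using assms(1) unfolding cut_and_project_lattice_def by blast
  then have "{\<alpha><..<\<beta>} \<inter> snd ` \<Gamma> \<noteq> {}"
    using assms(2) open_Int_closure_eq_empty[of "{\<alpha><..<\<beta>}" "snd ` \<Gamma>"] by auto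
  then obtain \<gamma> where "\<gamma> \<in> \<Gamma>" "snd \<gamma> \<in> {\<alpha><..<\<beta>}" by blast
  with that[of \<gamma>] show ?thesis by simp
qed

lemma image_unit_cube:
  assumes "0 < R"
  shows "(\<lambda>s. x + R *\<^sub>R s) ` unit_cube = cube x R"
proof (intro equalityI subsetI)
  fix y assume "y \<in> cube x R"
  then have "(1 / R) *\<^sub>R (y - x) \<in> unit_cube"
    using assms by (auto simp: unit_cube_def mem_box_cart field_simps)
  moreover have "y = x + R *\<^sub>R ((1 / R) *\<^sub>R (y - x))" using assms by simp
  ultimately show "y \<in> (\<lambda>s. x + R *\<^sub>R s) ` unit_cube" by blast
qed (use assms in \<open>auto simp: unit_cube_def mem_box_cart intro: mult_left_le\<close>)

lemma model_set_inter_cube: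
  "model_set \<Gamma> \<Omega> \<inter> cube x R = fst ` (\<Gamma> \<inter> (cube x R \<times> \<Omega>))"
  by (force simp: model_set_def)

lemma card_model_set_inter_cube:
  assumes "cut_and_project_lattice \<Gamma>"
  shows "card (model_set \<Gamma> \<Omega> \<inter> cube x R) = card (\<Gamma> \<inter> (cube x R \<times> \<Omega>))"
proof -
  have "inj_on fst \<Gamma>" using assms unfolding cut_and_project_lattice_def by blast
  then show ?thesis unfolding model_set_inter_cube by (intro card_image) (rule inj_on_subset, auto)
qed

text \<open>Shifting the points with second component in \<open>[-a, a]\<close> by \<open>n\<close> lattice vectors, chosen by
  density of the second projection, produces \<open>n\<close> disjoint copies, stacked almost without gaps
  in one long window. Long windows are what volume comparison counts accurately: the relative
  error there is of order \<open>1 / n\<close>.\<close>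

lemma packing_bound:
  fixes \<Gamma> :: "((real ^ 'm) \<times> real) set" and a :: real and n :: nat
  assumes \<Gamma>: "cut_and_project_lattice \<Gamma>" and a: "0 < a" and n: "0 < n"
    and fin: "\<And>x (R::real) (\<alpha>::real) (\<beta>::real). 0 \<le> R \<Longrightarrow> \<alpha> \<le> \<beta> \<Longrightarrow> finite (\<Gamma> \<inter> (cube x R \<times> {\<alpha>..\<beta>}))"
  obtains c where "0 \<le> c"
    "\<And>x R. 0 \<le> R \<Longrightarrow> n * card (\<Gamma> \<inter> (cube x R \<times> {-a..a}))
       \<le> card (\<Gamma> \<inter> (cube (x - (\<chi> i. c)) (R + 2 * c) \<times> {-a..2 * a * n + 1 + a}))"
proof -
  have lat: "is_lattice \<Gamma>" using \<Gamma> by (simp add: cut_and_project_lattice_def)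
  \<comment> \<open>The spacing \<open>2 * a + e\<close> exceeds the length of the window, so the translates are disjoint; the total waste \<open>e * n\<close> is \<open>1\<close>.\<close>
  define e where "e = 1 / real n"
  have e: "0 < e" "e * n = 1" using n by (auto simp: e_def)
  have "\<exists>\<gamma>. \<gamma> \<in> \<Gamma> \<and> (2 * a + e) * j < snd \<gamma> \<and> snd \<gamma> < (2 * a + e) * j + e" for j :: nat
    using lattice_snd_in_interval[OF \<Gamma>, of "(2 * a + e) * j" "(2 * a + e) * j + e"] e(1) by (metis less_add_same_cancel1)
  then obtain g where g: "\<And>j::nat. g j \<in> \<Gamma>" "\<And>j. (2 * a + e) * j < snd (g j)" "\<And>j. snd (g j) < (2 * a + e) * j + e"
    by metis
  define c where "c = (\<Sum>j<n. norm (fst (g j)))"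
  have c: "\<bar>fst (g j) $ i\<bar> \<le> c" if "j < n" for j i
  proof -
    have "\<bar>fst (g j) $ i\<bar> \<le> norm (fst (g j))" by (rule component_le_norm_cart)
    also have "\<dots> \<le> c" unfolding c_def using that by (intro member_le_sum) auto
    finally show ?thesis .
  qed
  have c0: "0 \<le> c" unfolding c_def by (intro sum_nonneg) auto
  have main: "n * card (\<Gamma> \<inter> (cube x R \<times> {-a..a}))
       \<le> card (\<Gamma> \<inter> (cube (x - (\<chi> i. c)) (R + 2 * c) \<times> {-a..2 * a * n + 1 + a}))" if R: "0 \<le> R" for x R
  proof -
    define S where "S = \<Gamma> \<inter> (cube x R \<times> {-a..a})"
    have finS: "finite S" unfolding S_def using fin[OF R, of "-a" a x] a by auto
    have disj: "(+) (g i) ` S \<inter> (+) (g j) ` S = {}" if "i < j" for i j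
    proof (rule ccontr)
      assume "(+) (g i) ` S \<inter> (+) (g j) ` S \<noteq> {}"
      then obtain s t where st: "s \<in> S" "t \<in> S" "g i + s = g j + t" by blast
      have "snd (g i) + snd s = snd (g j) + snd t" using st(3) by (metis snd_add)
      moreover have "snd s \<le> a" "-a \<le> snd t" using st by (auto simp: S_def)
      moreover have "(2 * a + e) * (real i + 1) \<le> (2 * a + e) * j"
        using that a e by (intro mult_left_mono) auto
      ultimately show False using g(3)[of i] g(2)[of j] by (simp add: algebra_simps)
    qed
    have "card (\<Union>j<n. (+) (g j) ` S) = (\<Sum>j<n. card ((+) (g j) ` S))"
    proof (rule card_UN_disjoint)
      show "\<forall>i\<in>{..<n}. \<forall>j\<in>{..<n}. i \<noteq> j \<longrightarrow> (+) (g i) ` S \<inter> (+) (g j) ` S = {}"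
        using disj by (metis Int_commute linorder_neqE_nat)
    qed (use finS in auto)
    also have "\<dots> = n * card S" by (simp add: card_image)
    finally have "n * card S = card (\<Union>j<n. (+) (g j) ` S)" ..
    also have "\<dots> \<le> card (\<Gamma> \<inter> (cube (x - (\<chi> i. c)) (R + 2 * c) \<times> {-a..2 * a * n + 1 + a}))"
    proof (rule card_mono)
      show "finite (\<Gamma> \<inter> (cube (x - (\<chi> i. c)) (R + 2 * c) \<times> {-a..2 * a * n + 1 + a}))"
        using R c0 a by (intro fin) auto
      show "(\<Union>j<n. (+) (g j) ` S) \<subseteq> \<Gamma> \<inter> (cube (x - (\<chi> i. c)) (R + 2 * c) \<times> {-a..2 * a * n + 1 + a})"
      proof
        fix w assume "w \<in> (\<Union>j<n. (+) (g j) ` S)"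
        then obtain j p q where j: "j < n" and w: "w = g j + (p, q)" and "(p, q) \<in> S" by auto
        then have pq: "(p, q) \<in> \<Gamma>" "\<And>i. x $ i \<le> p $ i" "\<And>i. p $ i \<le> x $ i + R" "-a \<le> q" "q \<le> a"
          by (auto simp: S_def mem_box_cart)
        have "(2 * a + e) * j + e \<le> (2 * a + e) * (real n - 1) + e"
          using j a e by (intro add_right_mono mult_left_mono) auto
        also have "\<dots> \<le> 2 * a * n + 1" using e a by (simp add: algebra_simps)
        finally have up: "(2 * a + e) * j + e \<le> 2 * a * n + 1" .
        have "0 \<le> (2 * a + e) * j" using a e by auto
        then have "-a \<le> snd (g j) + q" "snd (g j) + q \<le> 2 * a * n + 1 + a"
          using g(2,3)[of j] up pq(4,5) by linarith+
        moreover have "x $ i - c \<le> fst (g j) $ i + p $ i" "fst (g j) $ i + p $ i \<le> x $ i - c + (R + 2 * c)" for i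
          using c[OF j, of i] pq(2,3)[of i] by linarith+
        moreover have "g j + (p, q) \<in> \<Gamma>" using lattice_add_diff(1)[OF lat g(1) pq(1)] .
        ultimately show "w \<in> \<Gamma> \<inter> (cube (x - (\<chi> i. c)) (R + 2 * c) \<times> {-a..2 * a * n + 1 + a})"
          unfolding w by (auto simp: mem_box_cart mem_Times_iff)
      qed
    qed
    finally show ?thesis unfolding S_def .
  qed
  show ?thesis by (rule that[OF c0 main])
qed

text \<open>The companion of \<open>packing_bound\<close>: slightly overlapping shifts of the window cover a long one.\<close>

lemma covering_bound:
  fixes \<Gamma> :: "((real ^ 'm) \<times> real) set" and a :: real and n :: nat
  assumes \<Gamma>: "cut_and_project_lattice \<Gamma>" and a: "0 < a" and n: "0 < n"
    and fin: "\<And>x (R::real) (\<alpha>::real) (\<beta>::real). 0 \<le> R \<Longrightarrow> \<alpha> \<le> \<beta> \<Longrightarrow> finite (\<Gamma> \<inter> (cube x R \<times> {\<alpha>..\<beta>}))"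
  obtains c \<alpha> where "0 \<le> c"
    "\<And>x R. 2 * c \<le> R \<Longrightarrow> card (\<Gamma> \<inter> (cube (x + (\<chi> i. c)) (R - 2 * c) \<times> {\<alpha>..\<alpha> + (2 * a * n - 2)}))
       \<le> n * card (\<Gamma> \<inter> (cube x R \<times> {-a..a}))"
proof -
  have lat: "is_lattice \<Gamma>" using \<Gamma> by (simp add: cut_and_project_lattice_def)
  \<comment> \<open>The spacing \<open>2 * a - e\<close> is shorter than the window, so consecutive translates overlap; the total loss \<open>e * n\<close> is at most \<open>1\<close>.\<close>
  define e where "e = min 1 a / real n"
  have "min 1 a / real n \<le> min 1 a / 1" using n a by (intro divide_left_mono) auto
  then have e: "0 < e" "e * n \<le> 1" "e \<le> a" using n a by (auto simp: e_def)
  have "\<exists>\<gamma>. \<gamma> \<in> \<Gamma> \<and> (2 * a - e) * j < snd \<gamma> \<and> snd \<gamma> < (2 * a - e) * j + e" for j :: nat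
    using lattice_snd_in_interval[OF \<Gamma>, of "(2 * a - e) * j" "(2 * a - e) * j + e"] e(1) by (metis less_add_same_cancel1)
  then obtain g where g: "\<And>j::nat. g j \<in> \<Gamma>" "\<And>j. (2 * a - e) * j < snd (g j)" "\<And>j. snd (g j) < (2 * a - e) * j + e"
    by metis
  define c where "c = (\<Sum>j<n. norm (fst (g j)))"
  have c: "\<bar>fst (g j) $ i\<bar> \<le> c" if "j < n" for j i
  proof -
    have "\<bar>fst (g j) $ i\<bar> \<le> norm (fst (g j))" by (rule component_le_norm_cart)
    also have "\<dots> \<le> c" unfolding c_def using that by (intro member_le_sum) auto
    finally show ?thesis .
  qed
  have c0: "0 \<le> c" unfolding c_def by (intro sum_nonneg) auto
  define \<alpha> where "\<alpha> = e - a"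
  have main: "card (\<Gamma> \<inter> (cube (x + (\<chi> i. c)) (R - 2 * c) \<times> {\<alpha>..\<alpha> + (2 * a * n - 2)}))
       \<le> n * card (\<Gamma> \<inter> (cube x R \<times> {-a..a}))" if R: "2 * c \<le> R" for x R
  proof -
    define S where "S = \<Gamma> \<inter> (cube x R \<times> {-a..a})"
    have finS: "finite S" unfolding S_def using fin[of R "-a" a x] R c0 a by auto
    have "\<Gamma> \<inter> (cube (x + (\<chi> i. c)) (R - 2 * c) \<times> {\<alpha>..\<alpha> + (2 * a * n - 2)}) \<subseteq> (\<Union>j<n. (+) (g j) ` S)"
    proof
      fix \<gamma> assume "\<gamma> \<in> \<Gamma> \<inter> (cube (x + (\<chi> i. c)) (R - 2 * c) \<times> {\<alpha>..\<alpha> + (2 * a * n - 2)})"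
      then have \<gamma>: "\<gamma> \<in> \<Gamma>" "\<And>i. x $ i + c \<le> fst \<gamma> $ i" "\<And>i. fst \<gamma> $ i \<le> x $ i + c + (R - 2 * c)"
         "\<alpha> \<le> snd \<gamma>" "snd \<gamma> \<le> \<alpha> + (2 * a * n - 2)"
        by (auto simp: mem_box_cart mem_Times_iff)
      define w where "w = (snd \<gamma> + a - e) / (2 * a - e)"
      define q where "q = nat \<lfloor>w\<rfloor>"
      have pos: "0 < 2 * a - e" using e a by linarith
      have w: "w * (2 * a - e) = snd \<gamma> + a - e" using pos by (simp add: w_def)
      have w0: "0 \<le> w" unfolding w_def using \<gamma>(4) pos by (intro divide_nonneg_pos) (auto simp: \<alpha>_def)
      have "w * (2 * a - e) < n * (2 * a - e)"
        unfolding w using \<gamma>(5) e by (simp add: \<alpha>_def algebra_simps)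
      then have wn: "w < n" using pos by simp
      have q: "real q \<le> w" "w < real q + 1" using w0 unfolding q_def by linarith+
      have qn: "q < n" using q wn by linarith
      have "(2 * a - e) * q \<le> w * (2 * a - e)" "w * (2 * a - e) < (2 * a - e) * (q + 1)"
        using q pos by (auto simp: mult.commute)
      then have "-a \<le> snd \<gamma> - snd (g q)" "snd \<gamma> - snd (g q) \<le> a"
        using g(2,3)[of q] unfolding w by (auto simp: algebra_simps)
      moreover have "x $ i \<le> fst \<gamma> $ i - fst (g q) $ i" "fst \<gamma> $ i - fst (g q) $ i \<le> x $ i + R" for i
        using c[OF qn, of i] \<gamma>(2,3)[of i] by linarith+
      moreover have "\<gamma> - g q \<in> \<Gamma>" using lattice_add_diff(2)[OF lat \<gamma>(1) g(1)] .
      ultimately have "\<gamma> - g q \<in> S" by (auto simp: S_def mem_box_cart mem_Times_iff)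
      then show "\<gamma> \<in> (\<Union>j<n. (+) (g j) ` S)"
        using qn by (intro UN_I[of q]) (auto intro!: image_eqI[of _ _ "\<gamma> - g q"])
    qed
    then have "card (\<Gamma> \<inter> (cube (x + (\<chi> i. c)) (R - 2 * c) \<times> {\<alpha>..\<alpha> + (2 * a * n - 2)}))
        \<le> card (\<Union>j<n. (+) (g j) ` S)" using finS by (intro card_mono) auto
    also have "\<dots> \<le> (\<Sum>j<n. card ((+) (g j) ` S))" by (intro card_UN_le) auto
    also have "\<dots> = n * card S" by (simp add: card_image)
    finally show ?thesis unfolding S_def .
  qed
  show ?thesis by (rule that[OF c0 main])
qed

text \<open>The bounds \<open>packing_bound\<close> and \<open>covering_bound\<close> compare \<open>n\<close> times the count of the model set
  with a lattice count in a long box. Letting first the cube and then \<open>n\<close> grow squeezes the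
  quotient to \<open>2 * a / v\<close>, with \<open>v\<close> the covolume.\<close>

lemma model_set_density:
  fixes \<Gamma> :: "((real ^ 'm) \<times> real) set" and a :: real and n :: nat
  assumes \<Gamma>: "cut_and_project_lattice \<Gamma>" and a: "0 < a"
  obtains D C where "0 < D" "has_density (model_set \<Gamma> {-a..a}) D" "0 < C"
    "\<And>x R. 1 \<le> R \<Longrightarrow> finite (model_set \<Gamma> {-a..a} \<inter> cube x R) \<and>
       real (card (model_set \<Gamma> {-a..a} \<inter> cube x R)) \<le> C * R ^ CARD('m)"
proof -
  have "is_lattice \<Gamma>" using \<Gamma> by (simp add: cut_and_project_lattice_def)
  from lattice_box_count[OF this] obtain v d where v: "0 < v" and d: "0 < d"
    and count: "\<And>x (R::real) (\<alpha>::real) (\<beta>::real). 0 \<le> R \<Longrightarrow> \<alpha> \<le> \<beta> \<Longrightarrow> finite (\<Gamma> \<inter> (cube x R \<times> {\<alpha>..\<beta>})) \<and>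
       real (card (\<Gamma> \<inter> (cube x R \<times> {\<alpha>..\<beta>}))) * v \<le> (R + 2 * d) ^ CARD('m) * (\<beta> - \<alpha> + 2 * d)"
    and low: "\<And>x (R::real) (\<alpha>::real) (\<beta>::real). 2 * d \<le> R \<Longrightarrow> 2 * d \<le> \<beta> - \<alpha> \<Longrightarrow>
       (R - 2 * d) ^ CARD('m) * (\<beta> - \<alpha> - 2 * d) \<le> real (card (\<Gamma> \<inter> (cube x R \<times> {\<alpha>..\<beta>}))) * v"
    by metis
  note fin = count[THEN conjunct1] and up = count[THEN conjunct2]
  define N where "N x R = card (\<Gamma> \<inter> (cube x R \<times> {-a..a}))" for x R
  have N: "card (model_set \<Gamma> {-a..a} \<inter> cube x R) = N x R" for x R
    unfolding N_def by (rule card_model_set_inter_cube[OF \<Gamma>])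
  define C where "C = (1 + 2 * d) ^ CARD('m) * (2 * a + 2 * d) / v"
  have bound: "finite (model_set \<Gamma> {-a..a} \<inter> cube x R) \<and>
       real (card (model_set \<Gamma> {-a..a} \<inter> cube x R)) \<le> C * R ^ CARD('m)" if "1 \<le> R" for x R
  proof
    show "finite (model_set \<Gamma> {-a..a} \<inter> cube x R)"
      unfolding model_set_inter_cube using fin[of R "-a" a x] that a by auto
    have "N x R * v \<le> (R + 2 * d) ^ CARD('m) * (2 * a + 2 * d)"
      using up[of R "-a" a x] that a by (simp add: N_def)
    also have "\<dots> \<le> (R * (1 + 2 * d)) ^ CARD('m) * (2 * a + 2 * d)"
      using that d a by (intro mult_right_mono power_mono) (auto simp: algebra_simps)
    also have "\<dots> = C * R ^ CARD('m) * v" unfolding C_def power_mult_distrib using v by simp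
    finally show "card (model_set \<Gamma> {-a..a} \<inter> cube x R) \<le> C * R ^ CARD('m)"
      unfolding N using v by simp
  qed
  define D where "D = 2 * a / v"
  have lim: "((\<lambda>R. N x R / R ^ CARD('m)) \<longlongrightarrow> D) at_top" for x
  proof (rule order_tendstoI)
    fix y assume y: "D < y"
    have "(\<lambda>n. (2 * a + (1 + 2 * a + 2 * d) / real n) / v) \<longlonglongrightarrow> (2 * a + 0) / v"
      by (intro tendsto_intros lim_const_over_n) (use v in auto)
    then have "eventually (\<lambda>n. (2 * a + (1 + 2 * a + 2 * d) / real n) / v < y) sequentially"
      using y by (intro order_tendstoD) (auto simp: D_def)
    from eventually_happens'[OF sequentially_bot eventually_conj[OF eventually_gt_at_top[of 0] this]]
    obtain n where n: "0 < n" "(2 * a + (1 + 2 * a + 2 * d) / real n) / v < y" by blast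
    obtain c where c: "0 \<le> c" "\<And>x R. 0 \<le> R \<Longrightarrow> n * card (\<Gamma> \<inter> (cube x R \<times> {-a..a}))
       \<le> card (\<Gamma> \<inter> (cube (x - (\<chi> i. c)) (R + 2 * c) \<times> {-a..2 * a * n + 1 + a}))"
      using packing_bound[OF \<Gamma> a n(1) fin] by metis
    have le: "N x R / R ^ CARD('m) \<le> ((R + (2 * c + 2 * d)) / R) ^ CARD('m) * ((2 * a + (1 + 2 * a + 2 * d) / real n) / v)"
      if R: "0 < R" for R
    proof -
      have "real (n * N x R) * v \<le> card (\<Gamma> \<inter> (cube (x - (\<chi> i. c)) (R + 2 * c) \<times> {-a..2 * a * n + 1 + a})) * v"
        using c(2)[of R x] R v unfolding N_def by (intro mult_right_mono) (auto simp only: of_nat_le_iff)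
      also have "\<dots> \<le> (R + 2 * c + 2 * d) ^ CARD('m) * (2 * a * n + 1 + a - (-a) + 2 * d)"
        using R c(1) a by (intro up) auto
      finally have "n * N x R * v \<le> (R + (2 * c + 2 * d)) ^ CARD('m) * (2 * a * n + (1 + 2 * a + 2 * d))"
        by (simp add: algebra_simps)
      then have "N x R \<le> (R + (2 * c + 2 * d)) ^ CARD('m) * ((2 * a + (1 + 2 * a + 2 * d) / real n) / v)"
        using v n(1) by (simp add: field_simps)
      from divide_right_mono[OF this, of "R ^ CARD('m)"] R show ?thesis by (simp add: power_divide mult.commute)
    qed
    have "((\<lambda>R. (R + (2 * c + 2 * d)) / R) \<longlongrightarrow> 1) at_top" by real_asymp
    from tendsto_mult_right[OF tendsto_power[OF this, of "CARD('m)"], of "(2 * a + (1 + 2 * a + 2 * d) / real n) / v"]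
    have "eventually (\<lambda>R. ((R + (2 * c + 2 * d)) / R) ^ CARD('m) * ((2 * a + (1 + 2 * a + 2 * d) / real n) / v) < y) at_top"
      using n(2) by (intro order_tendstoD) auto
    then show "eventually (\<lambda>R. N x R / R ^ CARD('m) < y) at_top"
      using eventually_gt_at_top[of 0] by eventually_elim (rule le_less_trans[OF le])
  next
    fix y assume y: "y < D"
    have "(\<lambda>n. (2 * a - (2 + 2 * d) / real n) / v) \<longlonglongrightarrow> (2 * a - 0) / v"
      by (intro tendsto_intros lim_const_over_n) (use v in auto)
    then have "eventually (\<lambda>n. y < (2 * a - (2 + 2 * d) / real n) / v) sequentially"
      using y by (intro order_tendstoD) (auto simp: D_def)
    moreover have "eventually (\<lambda>n. 2 + 2 * d \<le> 2 * a * real n) sequentially"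
      using a by real_asymp
    ultimately have "eventually (\<lambda>n. 0 < n \<and> y < (2 * a - (2 + 2 * d) / real n) / v \<and> 2 + 2 * d \<le> 2 * a * real n) sequentially"
      using eventually_gt_at_top[of 0] by eventually_elim auto
    then obtain n where n: "0 < n" "y < (2 * a - (2 + 2 * d) / real n) / v" "2 + 2 * d \<le> 2 * a * real n"
      using eventually_happens'[OF sequentially_bot] by blast
    obtain c \<alpha> where c: "0 \<le> c"
    "\<And>x R. 2 * c \<le> R \<Longrightarrow> card (\<Gamma> \<inter> (cube (x + (\<chi> i. c)) (R - 2 * c) \<times> {\<alpha>..\<alpha> + (2 * a * n - 2)}))
       \<le> n * card (\<Gamma> \<inter> (cube x R \<times> {-a..a}))"
      using covering_bound[OF \<Gamma> a n(1) fin] by metis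
    have le: "((R - (2 * c + 2 * d)) / R) ^ CARD('m) * ((2 * a - (2 + 2 * d) / real n) / v) \<le> N x R / R ^ CARD('m)"
      if R: "2 * c + 2 * d \<le> R" for R
    proof -
      have "(R - 2 * c - 2 * d) ^ CARD('m) * (\<alpha> + (2 * a * n - 2) - \<alpha> - 2 * d)
         \<le> card (\<Gamma> \<inter> (cube (x + (\<chi> i. c)) (R - 2 * c) \<times> {\<alpha>..\<alpha> + (2 * a * n - 2)})) * v"
        using R n(3) by (intro low) auto
      also have "\<dots> \<le> real (n * N x R) * v"
        using c(2)[of R x] R d v unfolding N_def by (intro mult_right_mono) (auto simp only: of_nat_le_iff)
      finally have "(R - (2 * c + 2 * d)) ^ CARD('m) * (2 * a * n - (2 + 2 * d)) \<le> n * N x R * v"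
        by (simp add: algebra_simps)
      then have "(R - (2 * c + 2 * d)) ^ CARD('m) * ((2 * a - (2 + 2 * d) / real n) / v) \<le> N x R"
        using v n(1) by (simp add: field_simps)
      moreover have "0 < R" using R c d by linarith
      ultimately show ?thesis
        using divide_right_mono[of "(R - (2 * c + 2 * d)) ^ CARD('m) * ((2 * a - (2 + 2 * d) / real n) / v)" "N x R" "R ^ CARD('m)"]
        by (simp add: power_divide mult.commute)
    qed
    have "((\<lambda>R. (R - (2 * c + 2 * d)) / R) \<longlongrightarrow> 1) at_top" by real_asymp
    from tendsto_mult_right[OF tendsto_power[OF this, of "CARD('m)"], of "(2 * a - (2 + 2 * d) / real n) / v"]
    have "eventually (\<lambda>R. y < ((R - (2 * c + 2 * d)) / R) ^ CARD('m) * ((2 * a - (2 + 2 * d) / real n) / v)) at_top"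
      using n(2) by (intro order_tendstoD) auto
    then show "eventually (\<lambda>R. y < N x R / R ^ CARD('m)) at_top"
      using eventually_ge_at_top[of "2 * c + 2 * d"] by eventually_elim (rule less_le_trans[OF _ le])
  qed
  have "has_density (model_set \<Gamma> {-a..a}) D"
    unfolding has_density_def
  proof
    fix x :: "real ^ 'm"
    have "eventually (\<lambda>R. N x R / R ^ CARD('m) =
       real (card (model_set \<Gamma> {-a..a} \<inter> (\<lambda>s. x + R *\<^sub>R s) ` unit_cube)) / R ^ CARD('m)) at_top"
      using eventually_gt_at_top[of 0] by eventually_elim (simp add: image_unit_cube N)
    with lim[of x] show "((\<lambda>R. real (card (model_set \<Gamma> {-a..a} \<inter> (\<lambda>s. x + R *\<^sub>R s) ` unit_cube)) / R ^ CARD('m))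
            \<longlongrightarrow> D) at_top" by (rule Lim_transform_eventually)
  qed
  moreover have "0 < D" "0 < C" using a v d by (auto simp: D_def C_def)
  ultimately show ?thesis using \<open>has_density (model_set \<Gamma> {-a..a}) D\<close> bound by (intro that[of D C])
qed

lemma point_density_eq:
  assumes "has_density \<Lambda> d"
  shows "point_density \<Lambda> = d"
  unfolding point_density_def
proof (rule the_equality)
  show "has_density \<Lambda> d" by fact
next
  fix d' assume "has_density \<Lambda> d'"
  with assms show "d' = d" unfolding has_density_def by (blast intro: tendsto_unique[OF trivial_limit_at_top_linorder])
qed

section \<open>Gaussians and the Plancherel identity\<close>

lemma integral_lborel_prod:
  fixes f :: "'a::euclidean_space \<Rightarrow> real \<Rightarrow> complex"
  assumes "\<And>b. b \<in> Basis \<Longrightarrow> integrable lborel (f b)"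
  shows "(LINT x|lborel. (\<Prod>b\<in>Basis. f b (x \<bullet> b))) = (\<Prod>b\<in>Basis. LINT x|lborel. f b x)"
    and "integrable lborel (\<lambda>x. \<Prod>b\<in>Basis. f b (x \<bullet> b))"
proof -
  interpret product_sigma_finite "\<lambda>_::'a. lborel :: real measure" by standard
  have [measurable]: "f b \<in> borel_measurable borel" if "b \<in> Basis" for b
    using assms[OF that] by simp
  have m: "(\<lambda>x. \<Prod>b\<in>Basis. f b (x \<bullet> b)) \<in> borel_measurable borel" by measurable
  have m2: "(\<lambda>f. \<Sum>b\<in>Basis. f b *\<^sub>R b) \<in> (\<Pi>\<^sub>M b\<in>(Basis::'a set). (lborel :: real measure)) \<rightarrow>\<^sub>M (borel :: 'a measure)"
    by measurable
  have eq: "(\<Prod>b\<in>Basis. f b ((\<Sum>b'\<in>Basis. y b' *\<^sub>R b') \<bullet> b)) = (\<Prod>b\<in>Basis. f b (y b))" for y :: "'a \<Rightarrow> real"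
    by (intro prod.cong refl) simp
  show "integrable lborel (\<lambda>x. \<Prod>b\<in>Basis. f b (x \<bullet> b))"
    by (subst lborel_eq, subst integrable_distr_eq[OF m2 m]) (simp only: eq, intro product_integrable_prod finite_Basis assms)
  show "(LINT x|lborel. (\<Prod>b\<in>Basis. f b (x \<bullet> b))) = (\<Prod>b\<in>Basis. LINT x|lborel. f b x)"
    by (subst lborel_eq, subst integral_distr[OF m2 m]) (simp only: eq, intro product_integral_prod finite_Basis assms)
qed

text \<open>Normalised so that it has integral one and is its own Fourier transform.\<close>

definition gauss :: "'a::euclidean_space \<Rightarrow> real" where
  "gauss x = exp (- pi * (norm x)\<^sup>2)"

lemma gauss_prod: "gauss x = (\<Prod>b\<in>Basis. gauss (x \<bullet> b))"
  unfolding gauss_def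
  by (simp add: norm_eq_sqrt_inner euclidean_inner[of x x] exp_sum[symmetric] power2_eq_square sum_nonneg
       sum_distrib_left sum_negf)

lemma gauss_pos: "0 < gauss x" and gauss_le_1: "gauss x \<le> 1"
  by (auto simp: gauss_def)

lemma abs_gauss [simp]: "\<bar>gauss x\<bar> = gauss x"
  by (simp add: gauss_def)

lemma gauss_measurable [measurable]: "gauss \<in> borel_measurable borel"
  unfolding gauss_def by measurable

lemma gauss_minus: "gauss (- x) = gauss x"
  by (simp add: gauss_def)

text \<open>A rescaling of the characteristic function of the standard normal distribution.\<close>

lemma gauss_real:
  fixes w :: real
  shows "integrable lborel (\<lambda>x. complex_of_real (gauss x) * cis (- (2 * pi * (x * w))))"
   and "(LINT x|lborel. complex_of_real (gauss x) * cis (- (2 * pi * (x * w)))) = complex_of_real (gauss w)"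
proof -
  define c where "c = sqrt (2 * pi)"
  have c: "0 < c" "c * c = 2 * pi" by (auto simp: c_def)
  define h where "h = (\<lambda>y. complex_of_real (std_normal_density y) * cis (- (c * w) * y))"
  have 1: "complex_of_real (gauss x) * cis (- (2 * pi * (x * w))) = c *\<^sub>R h (c * x)" for x
  proof -
    have "gauss x = c * std_normal_density (c * x)"
      using c by (simp add: gauss_def std_normal_density_def c_def power_mult_distrib)
    moreover have "- (2 * pi * (x * w)) = - (c * w) * (c * x)"
      using c(2) by (metis (no_types, opaque_lifting) mult.assoc mult.commute mult_minus_left)
    ultimately show ?thesis by (simp only: h_def scaleR_conv_of_real of_real_mult mult.assoc)
  qed
  have h_int: "integrable lborel h"
  proof (rule Bochner_Integration.integrable_bound)
    show "integrable lborel (\<lambda>y. std_normal_density y)" by (rule integrable_normal_density) simp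
    show "h \<in> borel_measurable lborel" unfolding h_def cis_conv_exp by measurable
    show "AE x in lborel. norm (h x) \<le> norm (std_normal_density x)"
      by (simp add: h_def norm_mult)
  qed
  have "integrable lborel (\<lambda>x. h (0 + c * x))"
    using c by (intro lborel_integrable_real_affine h_int) auto
  then show "integrable lborel (\<lambda>x. complex_of_real (gauss x) * cis (- (2 * pi * (x * w))))"
    unfolding 1 by (intro integrable_scaleR_right) simp
  have "(LINT x|lborel. complex_of_real (gauss x) * cis (- (2 * pi * (x * w)))) = c *\<^sub>R (LINT x|lborel. h (0 + c * x))"
    unfolding 1 by simp
  also have "\<dots> = (LINT y|lborel. h y)"
    using c lborel_integral_real_affine[of c h 0] by simp
  also have "\<dots> = (LINT y|lborel. std_normal_density y *\<^sub>R cis (- (c * w) * y))"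
    by (simp add: h_def scaleR_conv_of_real)
  also have "\<dots> = char std_normal_distribution (- (c * w))"
    unfolding char_def
    by (subst integral_density) (auto simp: cis_conv_exp mult_ac)
  also have "\<dots> = complex_of_real (exp (- ((c * w)\<^sup>2) / 2))"
    unfolding char_std_normal_distribution by simp
  also have "- ((c * w)\<^sup>2) / 2 = - pi * w\<^sup>2" using c by (simp add: power2_eq_square algebra_simps)
  finally show "(LINT x|lborel. complex_of_real (gauss x) * cis (- (2 * pi * (x * w)))) = complex_of_real (gauss w)"
    by (simp add: gauss_def)
qed

lemma cis_sum: "finite A \<Longrightarrow> cis (sum f A) = (\<Prod>a\<in>A. cis (f a))"
  by (induction A rule: finite_induct) (auto simp: cis_mult[symmetric])

text \<open>Both factors of the integrand are products over the coordinates, which reduces the claim to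
  dimension one.\<close>

lemma gauss_fourier:
  fixes w :: "'a::euclidean_space"
  shows "integrable lborel (\<lambda>x. complex_of_real (gauss x) * cis (- (2 * pi * (x \<bullet> w))))" (is ?A)
    and "(LINT x|lborel. complex_of_real (gauss x) * cis (- (2 * pi * (x \<bullet> w)))) = complex_of_real (gauss w)" (is ?B)
proof -
  have eq: "complex_of_real (gauss x) * cis (- (2 * pi * (x \<bullet> w)))
     = (\<Prod>b\<in>Basis. complex_of_real (gauss (x \<bullet> b)) * cis (- (2 * pi * ((x \<bullet> b) * (w \<bullet> b)))))" for x
  proof -
    have "- (2 * pi * (x \<bullet> w)) = (\<Sum>b\<in>Basis. - (2 * pi * ((x \<bullet> b) * (w \<bullet> b))))"
      by (simp add: euclidean_inner[of x w] sum_distrib_left sum_negf)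
    then have "cis (- (2 * pi * (x \<bullet> w))) = (\<Prod>b\<in>Basis. cis (- (2 * pi * ((x \<bullet> b) * (w \<bullet> b)))))"
      by (simp only: cis_sum[OF finite_Basis])
    then show ?thesis unfolding gauss_prod[of x] by (simp add: prod.distrib)
  qed
  show ?A unfolding eq by (intro integral_lborel_prod(2) gauss_real)
  have "(LINT x|lborel. complex_of_real (gauss x) * cis (- (2 * pi * (x \<bullet> w)))) = (\<Prod>b\<in>Basis. complex_of_real (gauss (w \<bullet> b)))"
    unfolding eq by (subst integral_lborel_prod(1)) (simp_all add: gauss_real)
  then show ?B unfolding gauss_prod[of w] by simp
qed

lemma gauss_integrable: "integrable lborel (gauss :: 'a::euclidean_space \<Rightarrow> real)"
  and gauss_integral: "(LINT x|lborel. gauss (x :: 'a)) = 1"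
proof -
  have 1: "integrable lborel (\<lambda>x::'a. complex_of_real (gauss x))"
    using gauss_fourier(1)[of "0::'a"] by simp
  then show "integrable lborel (gauss :: 'a \<Rightarrow> real)" by (simp add: complex_of_real_integrable_eq)
  have "complex_of_real (LINT x|lborel. gauss (x :: 'a)) = complex_of_real 1"
    using gauss_fourier(2)[of "0::'a"] by (simp add: gauss_def)
  then show "(LINT x|lborel. gauss (x :: 'a)) = 1" by (simp only: of_real_eq_iff)
qed

lemma integral_lborel_scale:
  fixes f :: "'a::euclidean_space \<Rightarrow> complex"
  assumes "integrable lborel f" "c \<noteq> 0"
  shows "integrable lborel (\<lambda>x. f (t + c *\<^sub>R x))"
    and "(LINT x|lborel. f x) = \<bar>c\<bar> ^ DIM('a) *\<^sub>R (LINT x|lborel. f (t + c *\<^sub>R x))"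
proof -
  have [measurable]: "f \<in> borel_measurable borel" using assms(1) by simp
  have i: "integrable (density (distr lborel borel (\<lambda>x. t + c *\<^sub>R x)) (\<lambda>_. ennreal (\<bar>c\<bar> ^ DIM('a)))) f"
    using assms(1) lborel_affine[OF assms(2), of t] by simp
  have "integrable (distr lborel borel (\<lambda>x. t + c *\<^sub>R x)) (\<lambda>x. \<bar>c\<bar> ^ DIM('a) *\<^sub>R f x)"
    using i by (subst (asm) integrable_density) auto
  then have "integrable lborel (\<lambda>x. \<bar>c\<bar> ^ DIM('a) *\<^sub>R f (t + c *\<^sub>R x))"
    by (subst (asm) integrable_distr_eq) auto
  then have "integrable lborel (\<lambda>x. inverse (\<bar>c\<bar> ^ DIM('a)) *\<^sub>R (\<bar>c\<bar> ^ DIM('a) *\<^sub>R f (t + c *\<^sub>R x)))"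
    by (rule integrable_scaleR_right)
  then show "integrable lborel (\<lambda>x. f (t + c *\<^sub>R x))"
    using assms(2) by simp
  have "(LINT x|lborel. f x) = (LINT x|density (distr lborel borel (\<lambda>x. t + c *\<^sub>R x)) (\<lambda>_. ennreal (\<bar>c\<bar> ^ DIM('a))). f x)"
    using lborel_affine[OF assms(2), of t] by simp
  also have "\<dots> = \<bar>c\<bar> ^ DIM('a) *\<^sub>R (LINT x|lborel. f (t + c *\<^sub>R x))"
    by (subst integral_density) (auto simp: integral_distr)
  finally show "(LINT x|lborel. f x) = \<bar>c\<bar> ^ DIM('a) *\<^sub>R (LINT x|lborel. f (t + c *\<^sub>R x))" .
qed


lemma nn_integral_lborel_scale:
  fixes f :: "'a::euclidean_space \<Rightarrow> ennreal"
  assumes [measurable]: "f \<in> borel_measurable borel" and c: "c \<noteq> 0"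
  shows "(\<integral>\<^sup>+x. f x \<partial>lborel) = ennreal (\<bar>c\<bar> ^ DIM('a)) * (\<integral>\<^sup>+x. f (t + c *\<^sub>R x) \<partial>lborel)"
  by (subst lborel_affine[OF c, of t])
     (simp add: nn_integral_density nn_integral_distr nn_integral_cmult)

text \<open>The transform is taken over the Borel restriction of Lebesgue measure, which is compatible with
  products and hence with Fubini's theorem; on Borel representatives it agrees with \<open>fourier\<close>.\<close>

definition ft :: "('a::euclidean_space \<Rightarrow> complex) \<Rightarrow> 'a \<Rightarrow> complex" where
  "ft u w = (LINT t|lborel. u t * cis (- (2 * pi * (t \<bullet> w))))"

lemma cis_measurable [measurable (raw)]:
  "f \<in> borel_measurable M \<Longrightarrow> (\<lambda>x. cis (f x)) \<in> borel_measurable M"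
  unfolding cis_conv_exp by measurable

lemma cnj_measurable [measurable (raw)]:
  "f \<in> borel_measurable M \<Longrightarrow> (\<lambda>x. cnj (f x)) \<in> borel_measurable M"
  by (rule borel_measurable_continuous_on[of cnj]) (auto intro: continuous_intros)

lemma integrable_mult_bounded:
  fixes u v :: "'b \<Rightarrow> complex"
  assumes "integrable M u" "v \<in> borel_measurable M" "\<And>x. norm (v x) \<le> C"
  shows "integrable M (\<lambda>x. u x * v x)"
proof (rule Bochner_Integration.integrable_bound)
  show "integrable M (\<lambda>x. C *\<^sub>R u x)" using assms(1) by (rule integrable_scaleR_right)
  show "(\<lambda>x. u x * v x) \<in> borel_measurable M" using assms(1,2) by measurable
  have "0 \<le> C" using assms(3) norm_ge_zero order_trans by blast
  then show "AE x in M. norm (u x * v x) \<le> norm (C *\<^sub>R u x)"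
    using assms(3) by (auto simp: norm_mult mult.commute[of C] intro!: mult_left_mono)
qed

lemma ft_integrand:
  assumes "integrable lborel u"
  shows "integrable lborel (\<lambda>t. u t * cis (- (2 * pi * (t \<bullet> w))))"
  using assms by (rule integrable_mult_bounded[where C=1]) auto

lemma ft_measurable [measurable]:
  assumes [measurable]: "u \<in> borel_measurable borel"
  shows "ft u \<in> borel_measurable borel"
  unfolding ft_def by measurable

lemma norm_ft_le: "norm (ft u w) \<le> (LINT t|lborel. norm (u t))"
  unfolding ft_def using integral_norm_bound[of lborel "\<lambda>t. u t * cis (- (2 * pi * (t \<bullet> w)))"]
  by (simp add: norm_mult)

lemma ft_cnj_reflect:
  assumes "integrable lborel u"
  shows "ft (\<lambda>t. cnj (u (- t))) w = cnj (ft u w)"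
proof -
  have "cnj (ft u w) = (LINT t|lborel. cnj (u t * cis (- (2 * pi * (t \<bullet> w)))))"
    unfolding ft_def by (rule Bochner_Integration.integral_cnj[symmetric])
  also have "\<dots> = (LINT t|lborel. cnj (u (0 + (-1) *\<^sub>R t) * cis (- (2 * pi * ((0 + (-1) *\<^sub>R t) \<bullet> w)))))"
    using integral_lborel_scale(2)[OF integrable_cnj[OF ft_integrand[OF assms, of w]], of "-1" 0] by simp
  finally show ?thesis unfolding ft_def by (simp add: cis_cnj)
qed

lemma pair_integrable_mult:
  fixes a :: "'a::euclidean_space \<Rightarrow> complex" and b :: "'b::euclidean_space \<Rightarrow> complex"
  assumes "integrable lborel a" "integrable lborel b"
    and c: "c \<in> borel_measurable (lborel \<Otimes>\<^sub>M lborel)" "\<And>p. norm (c p) \<le> 1"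
  shows "integrable (lborel \<Otimes>\<^sub>M lborel) (\<lambda>(x, y). a x * b y * c (x, y))"
proof -
  have [measurable]: "a \<in> borel_measurable borel" "b \<in> borel_measurable borel"
    using assms by auto
  have "integrable (lborel \<Otimes>\<^sub>M lborel) (\<lambda>p. a (fst p) * b (snd p))"
  proof (rule lborel_pair.Fubini_integrable)
    show "(\<lambda>p. a (fst p) * b (snd p)) \<in> borel_measurable (lborel \<Otimes>\<^sub>M lborel)" by measurable
    show "integrable lborel (\<lambda>x. LINT y|lborel. norm (a (fst (x, y)) * b (snd (x, y))))"
      using assms by (simp add: norm_mult)
    show "AE x in lborel. integrable lborel (\<lambda>y. a (fst (x, y)) * b (snd (x, y)))"
      using assms by simp
  qed
  from integrable_mult_bounded[OF this c] show ?thesis by (simp add: case_prod_beta')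
qed

text \<open>The multiplication formula, that is, Fubini for \<open>a t * b w * exp (-2 * pi * i * (t \<bullet> w))\<close>.\<close>

lemma ft_multiplication:
  assumes "integrable lborel a" "integrable lborel b"
  shows "(LINT w|lborel. ft a w * b w) = (LINT t|lborel. a t * ft b t)"
proof -
  have [measurable]: "a \<in> borel_measurable borel" "b \<in> borel_measurable borel"
    using assms by auto
  have "integrable (lborel \<Otimes>\<^sub>M lborel) (\<lambda>(w, t). b w * a t * cis (- (2 * pi * (fst (w, t) \<bullet> snd (w, t)))))"
    using pair_integrable_mult[OF assms(2,1), of "\<lambda>p. cis (- (2 * pi * (fst p \<bullet> snd p)))"] by simp
  then have "(LINT t|lborel. LINT w|lborel. b w * a t * cis (- (2 * pi * (w \<bullet> t))))
     = (LINT w|lborel. LINT t|lborel. b w * a t * cis (- (2 * pi * (w \<bullet> t))))"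
    by (intro lborel_pair.Fubini_integral) simp
  then show ?thesis unfolding ft_def
    by (simp flip: integral_mult_right_zero integral_mult_left_zero add: inner_commute mult_ac)
qed


lemma ft_scaled_gauss:
  fixes s :: real and y :: "'a::euclidean_space"
  assumes "0 < s"
  shows "integrable lborel (\<lambda>x::'a. complex_of_real (gauss (s *\<^sub>R x)) * cis (- (2 * pi * (x \<bullet> y))))"
    and "(LINT x|lborel. complex_of_real (gauss (s *\<^sub>R x)) * cis (- (2 * pi * (x \<bullet> y))))
       = complex_of_real (gauss ((1 / s) *\<^sub>R y) / s ^ DIM('a))"
proof -
  let ?f = "\<lambda>x. complex_of_real (gauss x) * cis (- (2 * pi * (x \<bullet> ((1 / s) *\<^sub>R y))))"
  have eq: "?f (0 + s *\<^sub>R x) = complex_of_real (gauss (s *\<^sub>R x)) * cis (- (2 * pi * (x \<bullet> y)))" for x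
    using assms by simp
  note sc = integral_lborel_scale[OF gauss_fourier(1)[of "(1 / s) *\<^sub>R y"], of s 0]
  show "integrable lborel (\<lambda>x. complex_of_real (gauss (s *\<^sub>R x)) * cis (- (2 * pi * (x \<bullet> y))))"
    using sc(1) assms unfolding eq by simp
  show "(LINT x|lborel. complex_of_real (gauss (s *\<^sub>R x)) * cis (- (2 * pi * (x \<bullet> y))))
       = complex_of_real (gauss ((1 / s) *\<^sub>R y) / s ^ DIM('a))"
    using sc(2) assms unfolding eq gauss_fourier(2) by (simp add: scaleR_conv_of_real field_simps)
qed

text \<open>The test functions of the whole argument. Continuity and boundedness let Gaussian summation
  converge by dominated convergence, without approximation arguments in \<open>L\<^sup>2\<close>; and the class is
  stable under correlation with integrable functions, so the Plancherel identity applies to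
  correlations as well.\<close>

definition tame :: "('a::euclidean_space \<Rightarrow> complex) set" where
  "tame = {u. continuous_on UNIV u \<and> bounded (range u) \<and> integrable lborel u}"

lemma tameD:
  assumes "u \<in> tame"
  shows "integrable lborel u" "isCont u x" "u \<in> borel_measurable borel" "continuous_on UNIV u"
    "\<exists>M>0. \<forall>x. norm (u x) \<le> M"
  using assms by (auto simp: tame_def continuous_on_eq_continuous_at bounded_pos)

lemma tame_square_integrable:
  assumes "u \<in> tame"
  shows "integrable lborel (\<lambda>t. u t * cnj (u t))" "integrable lborel (\<lambda>t. (norm (u t))\<^sup>2)"
proof -
  obtain M where M: "\<And>x. norm (u x) \<le> M" using tameD(5)[OF assms] by blast
  have [measurable]: "u \<in> borel_measurable borel" by (rule tameD(3)[OF assms])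
  show 1: "integrable lborel (\<lambda>t. u t * cnj (u t))"
    by (rule integrable_mult_bounded[OF tameD(1)[OF assms], of _ M]) (use M in auto)
  show "integrable lborel (\<lambda>t. (norm (u t))\<^sup>2)"
    using integrable_norm[OF 1] by (simp add: norm_mult power2_eq_square)
qed

text \<open>With a Gaussian convergence factor all integrals in the Parseval computation converge
  absolutely; the factor turns into averaging of \<open>u\<close> over Gaussian displacements of size \<open>s\<close>.\<close>

lemma gauss_mean_square_ft:
  fixes u :: "'a::euclidean_space \<Rightarrow> complex"
  assumes u: "u \<in> tame" and s: "0 < s"
  shows "(LINT w|lborel. ft u w * (cnj (ft u w) * gauss (s *\<^sub>R w)))
      = (LINT t|lborel. u t * (LINT z|lborel. cnj (u (t - s *\<^sub>R z)) * gauss z))"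
    and "integrable lborel (\<lambda>w. ft u w * (cnj (ft u w) * gauss (s *\<^sub>R w)))"
proof -
  have ui: "integrable lborel u" by (rule tameD(1)[OF u])
  have [measurable]: "u \<in> borel_measurable borel" by (rule tameD(3)[OF u])
  obtain M where M: "\<And>x. norm (u x) \<le> M" using tameD(5)[OF u] by blast
  define v where "v = (\<lambda>t. cnj (u (- t)))"
  have vi: "integrable lborel v"
  proof -
    have "integrable lborel (\<lambda>t. u (0 + (-1) *\<^sub>R t))" by (rule integral_lborel_scale(1)[OF ui]) simp
    then show ?thesis by (simp add: v_def)
  qed
  have gi: "integrable lborel (\<lambda>w::'a. complex_of_real (gauss (s *\<^sub>R w)))"
    using ft_scaled_gauss(1)[OF s, of 0] by simp
  define b where "b = (\<lambda>w. cnj (ft u w) * gauss (s *\<^sub>R w))"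
  have bi: "integrable lborel b"
  proof -
    have "integrable lborel (\<lambda>w. complex_of_real (gauss (s *\<^sub>R w)) * cnj (ft u w))"
      by (rule integrable_mult_bounded[OF gi, of _ "LINT t|lborel. norm (u t)"]) (auto simp: norm_ft_le)
    then show ?thesis by (simp add: b_def mult.commute)
  qed
  show "integrable lborel (\<lambda>w. ft u w * (cnj (ft u w) * gauss (s *\<^sub>R w)))"
    using integrable_mult_bounded[OF bi, of "ft u" "LINT t|lborel. norm (u t)"]
    by (simp add: norm_ft_le b_def mult.commute)
  have ftb: "ft b t = (LINT z|lborel. cnj (u (t - s *\<^sub>R z)) * gauss z)" for t
  proof -
    define w where "w = (\<lambda>x. complex_of_real (gauss (s *\<^sub>R x)) * cis (- (2 * pi * (x \<bullet> t))))"
    have wi: "integrable lborel w" unfolding w_def by (rule ft_scaled_gauss(1)[OF s])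
    have ftw: "ft w y = complex_of_real (gauss ((1 / s) *\<^sub>R (t + y)) / s ^ DIM('a))" for y
      unfolding ft_def w_def ft_scaled_gauss(2)[OF s, symmetric]
      by (simp add: mult.assoc cis_mult inner_add_right algebra_simps)
    let ?h = "\<lambda>y. v y * ft w y"
    have "ft b t = (LINT x|lborel. ft v x * w x)"
      unfolding ft_def[of b] unfolding b_def w_def v_def ft_cnj_reflect[OF ui] by (simp add: mult_ac)
    also have "\<dots> = (LINT y|lborel. ?h y)" by (rule ft_multiplication[OF vi wi])
    also have "\<dots> = \<bar>s\<bar> ^ DIM('a) *\<^sub>R (LINT z|lborel. ?h (- t + s *\<^sub>R z))"
    proof (rule integral_lborel_scale(2))
      show "integrable lborel ?h"
        by (rule integrable_mult_bounded[OF vi, of _ "LINT t|lborel. norm (w t)"])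
          (use wi in \<open>auto simp: norm_ft_le\<close>)
    qed (use s in simp)
    also have "\<dots> = (LINT z|lborel. \<bar>s\<bar> ^ DIM('a) *\<^sub>R ?h (- t + s *\<^sub>R z))" by simp
    also have "\<dots> = (LINT z|lborel. cnj (u (t - s *\<^sub>R z)) * gauss z)"
      unfolding ftw v_def using s
      by (intro Bochner_Integration.integral_cong refl) (simp add: scaleR_conv_of_real)
    finally show ?thesis .
  qed
  show "(LINT w|lborel. ft u w * (cnj (ft u w) * gauss (s *\<^sub>R w)))
      = (LINT t|lborel. u t * (LINT z|lborel. cnj (u (t - s *\<^sub>R z)) * gauss z))"
    using ft_multiplication[OF ui bi] unfolding ftb by (simp add: b_def)
qed

text \<open>Let the convergence factor of \<open>gauss_mean_square_ft\<close> tend to one: the left side converges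
  monotonically, the right side dominatedly because \<open>u\<close> is continuous and bounded.\<close>

lemma plancherel:
  fixes u :: "'a::euclidean_space \<Rightarrow> complex"
  assumes u: "u \<in> tame"
  shows "(\<integral>\<^sup>+w. ennreal ((norm (ft u w))\<^sup>2) \<partial>lborel) = (\<integral>\<^sup>+t. ennreal ((norm (u t))\<^sup>2) \<partial>lborel)"
proof -
  have ui: "integrable lborel u" by (rule tameD(1)[OF u])
  have [measurable]: "u \<in> borel_measurable borel" by (rule tameD(3)[OF u])
  obtain M where M: "0 < M" "\<And>x. norm (u x) \<le> M" using tameD(5)[OF u] by blast
  define s where "s = (\<lambda>n. 1 / real (Suc n))"
  have s: "0 < s n" for n by (simp add: s_def)
  have s_lim: "s \<longlonglongrightarrow> 0" unfolding s_def by (rule LIMSEQ_Suc) (rule lim_const_over_n)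
  define J where "J = (\<lambda>n t. (LINT z|lborel. cnj (u (t - s n *\<^sub>R z)) * gauss z))"
  have gi: "integrable lborel (\<lambda>z::'a. complex_of_real (gauss z))"
    by (simp add: gauss_integrable complex_of_real_integrable_eq)
  have J_lim: "(\<lambda>n. J n t) \<longlonglongrightarrow> cnj (u t)" for t
  proof -
    have "(\<lambda>n. J n t) \<longlonglongrightarrow> (LINT z|lborel. cnj (u t) * gauss (z::'a))"
      unfolding J_def
    proof (rule integral_dominated_convergence[where w="\<lambda>z. M * gauss z"])
      show "integrable lborel (\<lambda>z::'a. M * gauss z)" by (simp add: gauss_integrable complex_of_real_integrable_eq)
      show "AE z in lborel. (\<lambda>n. cnj (u (t - s n *\<^sub>R z)) * gauss z) \<longlonglongrightarrow> cnj (u t) * gauss z"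
      proof (rule AE_I2)
        fix z :: 'a
        have "(\<lambda>n. t - s n *\<^sub>R z) \<longlonglongrightarrow> t - 0 *\<^sub>R z" by (intro tendsto_intros s_lim)
        then have "(\<lambda>n. u (t - s n *\<^sub>R z)) \<longlonglongrightarrow> u t"
          using isCont_tendsto_compose[OF tameD(2)[OF u, of t], of "\<lambda>n. t - s n *\<^sub>R z"] by simp
        then show "(\<lambda>n. cnj (u (t - s n *\<^sub>R z)) * gauss z) \<longlonglongrightarrow> cnj (u t) * gauss z"
          by (intro tendsto_intros)
      qed
      show "AE z in lborel. norm (cnj (u (t - s n *\<^sub>R z)) * complex_of_real (gauss z)) \<le> M * gauss z" for n
        by (intro AE_I2) (auto simp: norm_mult intro!: mult_right_mono M less_imp_le[OF gauss_pos])
    qed measurable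
    then show ?thesis using gauss_integral[where 'a='a] by simp
  qed
  have J_le: "norm (J n t) \<le> M" for n t
  proof -
    have "norm (J n t) \<le> (LINT z|lborel. M * gauss (z::'a))"
      unfolding J_def
    proof (rule Bochner_Integration.integral_norm_bound_integral)
      show "integrable lborel (\<lambda>z::'a. M * gauss z)" by (simp add: gauss_integrable complex_of_real_integrable_eq)
      have "integrable lborel (\<lambda>z. complex_of_real (gauss z) * cnj (u (t - s n *\<^sub>R z)))"
        by (rule integrable_mult_bounded[OF gi, of _ M]) (use M in auto)
      then show "integrable lborel (\<lambda>z. cnj (u (t - s n *\<^sub>R z)) * complex_of_real (gauss z))"
        by (simp add: mult.commute)
      show "norm (cnj (u (t - s n *\<^sub>R z)) * complex_of_real (gauss z)) \<le> M * gauss z" for z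
        by (auto simp: norm_mult intro!: mult_right_mono M less_imp_le[OF gauss_pos])
    qed
    then show ?thesis by (simp add: gauss_integral)
  qed
  have J_meas [measurable]: "J n \<in> borel_measurable borel" for n unfolding J_def by measurable
  have rhs: "(\<lambda>n. LINT t|lborel. u t * J n t) \<longlonglongrightarrow> (LINT t|lborel. u t * cnj (u t))"
  proof (rule integral_dominated_convergence[where w="\<lambda>t. norm (u t) * M"])
    show "integrable lborel (\<lambda>t. norm (u t) * M)" using ui by simp
    show "AE t in lborel. norm (u t * J n t) \<le> norm (u t) * M" for n
      using J_le by (auto simp: norm_mult intro!: mult_left_mono)
    show "AE t in lborel. (\<lambda>n. u t * J n t) \<longlonglongrightarrow> u t * cnj (u t)"
      using J_lim by (auto intro!: tendsto_intros)
  qed measurable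
  have conv: "u t * cnj (u t) = complex_of_real ((norm (u t))\<^sup>2)" for t
    by (rule complex_norm_square[symmetric])
  define I where "I = (LINT t|lborel. (norm (u t))\<^sup>2)"
  have "(\<lambda>n. Re (LINT t|lborel. u t * J n t)) \<longlonglongrightarrow> I"
    using tendsto_Re[OF rhs] unfolding conv I_def
    by (simp only: integral_complex_of_real Re_complex_of_real)
  then have lim1: "(\<lambda>n. ennreal (Re (LINT t|lborel. u t * J n t))) \<longlonglongrightarrow> ennreal I"
    by (rule tendsto_ennrealI)
  define L where "L = (\<lambda>n. \<integral>\<^sup>+w. ennreal ((norm (ft u w))\<^sup>2 * gauss (s n *\<^sub>R w)) \<partial>lborel)"
  have L: "L n = ennreal (Re (LINT t|lborel. u t * J n t))" for n
  proof -
    have c: "ft u w * (cnj (ft u w) * complex_of_real (gauss (s n *\<^sub>R w)))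
        = complex_of_real ((norm (ft u w))\<^sup>2 * gauss (s n *\<^sub>R w))" for w
      by (simp add: mult.assoc[symmetric] complex_norm_square[symmetric])
    have i: "integrable lborel (\<lambda>w. (norm (ft u w))\<^sup>2 * gauss (s n *\<^sub>R w))"
      using gauss_mean_square_ft(2)[OF u s[of n]] unfolding c complex_of_real_integrable_eq .
    have "(LINT t|lborel. u t * J n t) = complex_of_real (LINT w|lborel. (norm (ft u w))\<^sup>2 * gauss (s n *\<^sub>R w))"
      using gauss_mean_square_ft(1)[OF u s[of n]] unfolding c J_def by (simp only: integral_complex_of_real)
    then show ?thesis unfolding L_def using i
      by (subst nn_integral_eq_integral) (auto intro!: AE_I2 mult_nonneg_nonneg less_imp_le[OF gauss_pos])
  qed
  have lim2: "L \<longlonglongrightarrow> (\<integral>\<^sup>+w. ennreal ((norm (ft u w))\<^sup>2) \<partial>lborel)"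
    unfolding L_def
  proof (rule nn_integral_LIMSEQ)
    show "incseq (\<lambda>n w. ennreal ((norm (ft u w))\<^sup>2 * gauss (s n *\<^sub>R w)))"
    proof (intro incseq_SucI le_funI ennreal_leI mult_left_mono)
      fix n and w :: 'a
      have "norm (s (Suc n) *\<^sub>R w) \<le> norm (s n *\<^sub>R w)"
        unfolding norm_scaleR s_def by (intro mult_right_mono) (auto simp: field_simps)
      then have "(norm (s (Suc n) *\<^sub>R w))\<^sup>2 \<le> (norm (s n *\<^sub>R w))\<^sup>2" by (intro power_mono) auto
      then show "gauss (s n *\<^sub>R w) \<le> gauss (s (Suc n) *\<^sub>R w)" unfolding gauss_def by simp
    qed simp
    fix w :: 'a
    have "(\<lambda>n. (norm (ft u w))\<^sup>2 * gauss (s n *\<^sub>R w)) \<longlonglongrightarrow> (norm (ft u w))\<^sup>2 * exp (- pi * (norm (0 *\<^sub>R w))\<^sup>2)"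
      unfolding gauss_def by (intro tendsto_intros s_lim)
    then show "(\<lambda>n. ennreal ((norm (ft u w))\<^sup>2 * gauss (s n *\<^sub>R w))) \<longlonglongrightarrow> ennreal ((norm (ft u w))\<^sup>2)"
      by (intro tendsto_ennrealI) simp
  qed measurable
  have "(\<integral>\<^sup>+w. ennreal ((norm (ft u w))\<^sup>2) \<partial>lborel) = ennreal I"
    using LIMSEQ_unique[OF lim2 lim1[folded L]] .
  also have "\<dots> = (\<integral>\<^sup>+t. ennreal ((norm (u t))\<^sup>2) \<partial>lborel)"
    unfolding I_def by (rule nn_integral_eq_integral[symmetric]) (auto simp: tame_square_integrable[OF u])
  finally show ?thesis .
qed

section \<open>Correlations and spectral weights\<close>

text \<open>This is the inner product of \<open>f\<close> with the translate of \<open>g\<close> by \<open>y\<close>, as a function of \<open>y\<close>.\<close>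

definition corr :: "('a::euclidean_space \<Rightarrow> complex) \<Rightarrow> ('a \<Rightarrow> complex) \<Rightarrow> 'a \<Rightarrow> complex" where
  "corr f g y = (LINT t|lborel. f t * cnj (g (t - y)))"

lemma integral_lborel_shift:
  fixes f :: "'a::euclidean_space \<Rightarrow> complex"
  shows "(LINT x|lborel. f (c + x)) = (LINT x|lborel. f x)"
    and "integrable lborel (\<lambda>x. f (c + x)) \<longleftrightarrow> integrable lborel f"
proof -
  have i: "integrable lborel (\<lambda>x. h (d + x))" if "integrable lborel h" for h :: "'a \<Rightarrow> complex" and d
    using integral_lborel_scale(1)[OF that, of 1 d] by simp
  show eq: "integrable lborel (\<lambda>x. f (c + x)) \<longleftrightarrow> integrable lborel f"
    using i[of f c] i[of "\<lambda>x. f (c + x)" "- c"] by (auto simp: add.assoc[symmetric])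
  show "(LINT x|lborel. f (c + x)) = (LINT x|lborel. f x)"
  proof (cases "integrable lborel f")
    case True
    then show ?thesis using integral_lborel_scale(2)[OF True, of 1 c] by simp
  next
    case False
    then show ?thesis using eq by (simp add: not_integrable_integral_eq)
  qed
qed

lemma corr_alt: "corr f g y = (LINT t|lborel. f (y + t) * cnj (g t))"
  unfolding corr_def
  using integral_lborel_shift(1)[of "\<lambda>t. f t * cnj (g (t - y))" y] by simp

text \<open>As a function of \<open>y\<close> the correlation is the convolution of \<open>f\<close> with the reflected conjugate of
  \<open>g\<close>: it inherits continuity and boundedness from \<open>f\<close>, and Fubini gives integrability and the
  product formula.\<close>

lemma corr_tame:
  assumes f: "f \<in> tame" and g: "integrable lborel g"
  shows "corr f g \<in> tame"
    and "ft (corr f g) w = ft f w * cnj (ft g w)"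
proof -
  have fi: "integrable lborel f" by (rule tameD(1)[OF f])
  have [measurable]: "f \<in> borel_measurable borel" by (rule tameD(3)[OF f])
  have [measurable]: "g \<in> borel_measurable borel" using g by simp
  obtain M where M: "0 < M" "\<And>x. norm (f x) \<le> M" using tameD(5)[OF f] by blast
  have gi: "integrable lborel (\<lambda>t. cnj (g t))" using g by simp
  have int: "integrable lborel (\<lambda>t. f (y + t) * cnj (g t))" for y
    using integrable_mult_bounded[OF gi, of "\<lambda>t. f (y + t)" M] M by (simp add: mult.commute)
  have bnd: "norm (f (y + t) * cnj (g t)) \<le> M * norm (g t)" for y t
    using M by (auto simp: norm_mult intro!: mult_right_mono)
  have Mg: "integrable lborel (\<lambda>t. M * norm (g t))" using g by simp
  have "continuous_on UNIV (corr f g)"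
    unfolding continuous_on_sequentially
  proof (intro allI ballI impI, elim conjE)
    fix y :: "nat \<Rightarrow> 'a" and a assume y: "y \<longlonglongrightarrow> a"
    show "(corr f g \<circ> y) \<longlonglongrightarrow> corr f g a"
      unfolding corr_alt comp_def
    proof (rule integral_dominated_convergence[OF _ _ Mg])
      show "AE t in lborel. (\<lambda>n. f (y n + t) * cnj (g t)) \<longlonglongrightarrow> f (a + t) * cnj (g t)"
      proof (rule AE_I2)
        fix t
        have "(\<lambda>n. f (y n + t)) \<longlonglongrightarrow> f (a + t)"
          by (rule isCont_tendsto_compose[OF tameD(2)[OF f]]) (intro tendsto_intros y)
        then show "(\<lambda>n. f (y n + t) * cnj (g t)) \<longlonglongrightarrow> f (a + t) * cnj (g t)" by (intro tendsto_intros)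
      qed
      show "AE t in lborel. norm (f (y n + t) * cnj (g t)) \<le> M * norm (g t)" for n
        using bnd by (intro AE_I2)
    qed measurable
  qed
  moreover have "bounded (range (corr f g))"
  proof (rule boundedI)
    fix c assume "c \<in> range (corr f g)"
    then obtain y where c: "c = corr f g y" by blast
    show "norm c \<le> (LINT t|lborel. M * norm (g t))"
      unfolding c corr_alt by (rule Bochner_Integration.integral_norm_bound_integral[OF int Mg bnd])
  qed
  moreover
  have P: "integrable (lborel \<Otimes>\<^sub>M lborel) (\<lambda>(t, y). f (y + t) * cnj (g t) * cis (- (2 * pi * (y \<bullet> w))))" for w
  proof -
    have "integrable (lborel \<Otimes>\<^sub>M lborel) (\<lambda>p. f (snd p + fst p) * cnj (g (fst p)))"
    proof (rule lborel_pair.Fubini_integrable)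
      have "(LINT y|lborel. norm (f (snd (t, y) + fst (t, y)) * cnj (g (fst (t, y))))) = (LINT y|lborel. norm (f y)) * norm (g t)" for t
      proof -
        have "(LINT y|lborel. complex_of_real (norm (f (t + y)))) = (LINT y|lborel. complex_of_real (norm (f y)))"
          by (rule integral_lborel_shift(1)[of "\<lambda>y. complex_of_real (norm (f y))"])
        then show ?thesis
          by (simp only: integral_complex_of_real of_real_eq_iff) (simp add: norm_mult add.commute)
      qed
      then show "integrable lborel (\<lambda>t. LINT y|lborel. norm (f (snd (t, y) + fst (t, y)) * cnj (g (fst (t, y)))))"
        using g by simp
      show "AE t in lborel. integrable lborel (\<lambda>y. f (snd (t, y) + fst (t, y)) * cnj (g (fst (t, y))))"
        using fi integral_lborel_shift(2)[of f] by (intro AE_I2) (simp add: add.commute)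
    qed measurable
    from integrable_mult_bounded[OF this, of "\<lambda>p. cis (- (2 * pi * (snd p \<bullet> w)))" 1]
    show ?thesis by (simp add: case_prod_beta')
  qed
  have "integrable lborel (corr f g)"
    using lborel_pair.integrable_snd[OF P[of 0]] by (simp add: corr_alt[abs_def])
  ultimately show "corr f g \<in> tame" by (simp add: tame_def)
  have "ft (corr f g) w = (LINT y|lborel. LINT t|lborel. f (y + t) * cnj (g t) * cis (- (2 * pi * (y \<bullet> w))))"
    unfolding ft_def corr_alt by (simp add: Bochner_Integration.integral_mult_left_zero)
  also have "\<dots> = (LINT t|lborel. LINT y|lborel. f (y + t) * cnj (g t) * cis (- (2 * pi * (y \<bullet> w))))"
    using P by (intro lborel_pair.Fubini_integral) simp
  also have "\<dots> = (LINT t|lborel. cnj (g t * cis (- (2 * pi * (t \<bullet> w)))) * ft f w)"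
  proof (intro Bochner_Integration.integral_cong refl)
    fix t
    have "(LINT y|lborel. f (y + t) * cnj (g t) * cis (- (2 * pi * (y \<bullet> w))))
       = (LINT y|lborel. cnj (g t * cis (- (2 * pi * (t \<bullet> w)))) * (f (t + y) * cis (- (2 * pi * ((t + y) \<bullet> w)))))"
    proof (intro Bochner_Integration.integral_cong refl)
      fix y
      have "cis (- (2 * pi * (y \<bullet> w))) = cnj (cis (- (2 * pi * (t \<bullet> w)))) * cis (- (2 * pi * ((t + y) \<bullet> w)))"
        by (simp add: cis_cnj cis_mult inner_add_left algebra_simps)
      then show "f (y + t) * cnj (g t) * cis (- (2 * pi * (y \<bullet> w)))
         = cnj (g t * cis (- (2 * pi * (t \<bullet> w)))) * (f (t + y) * cis (- (2 * pi * ((t + y) \<bullet> w))))"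
        by (simp add: add.commute mult_ac)
    qed
    also have "\<dots> = cnj (g t * cis (- (2 * pi * (t \<bullet> w)))) * (LINT y|lborel. f (t + y) * cis (- (2 * pi * ((t + y) \<bullet> w))))"
      by (rule Bochner_Integration.integral_mult_right_zero)
    also have "(LINT y|lborel. f (t + y) * cis (- (2 * pi * ((t + y) \<bullet> w)))) = ft f w"
      unfolding ft_def by (rule integral_lborel_shift(1))
    finally show "(LINT y|lborel. f (y + t) * cnj (g t) * cis (- (2 * pi * (y \<bullet> w)))) = cnj (g t * cis (- (2 * pi * (t \<bullet> w)))) * ft f w" .
  qed
  also have "\<dots> = ft f w * cnj (ft g w)"
    unfolding ft_def[of g] by (simp add: Bochner_Integration.integral_mult_left_zero flip: Bochner_Integration.integral_cnj)
  finally show "ft (corr f g) w = ft f w * cnj (ft g w)" .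
qed

lemma corr_plancherel:
  assumes f: "f \<in> tame" and g: "integrable lborel g"
  shows "(\<integral>\<^sup>+y. ennreal ((norm (corr f g y))\<^sup>2) \<partial>lborel)
     = (\<integral>\<^sup>+w. ennreal ((norm (ft f w))\<^sup>2) * ennreal ((norm (ft g w))\<^sup>2) \<partial>lborel)"
  unfolding plancherel[OF corr_tame(1)[OF f g], symmetric] corr_tame(2)[OF f g]
  by (simp add: norm_mult power_mult_distrib ennreal_mult)

text \<open>These functions have Gaussians of arbitrary centre and width as Fourier transforms; they are
  the probes of the spectral weight.\<close>

lemma modulated_gauss:
  fixes \<xi> :: "'a::euclidean_space"
  assumes s: "0 < s"
  defines "f \<equiv> \<lambda>t. complex_of_real (s ^ DIM('a) * gauss (s *\<^sub>R t)) * cis (2 * pi * (t \<bullet> \<xi>))"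
  shows "f \<in> tame" and "ft f w = complex_of_real (gauss ((1 / s) *\<^sub>R (w - \<xi>)))"
proof -
  have f: "f t = s ^ DIM('a) *\<^sub>R (complex_of_real (gauss (s *\<^sub>R t)) * cis (- (2 * pi * (t \<bullet> (- \<xi>)))))" for t
    by (simp add: f_def scaleR_conv_of_real)
  have "integrable lborel f"
    using ft_scaled_gauss(1)[OF s, of "- \<xi>"] unfolding f by (rule integrable_scaleR_right)
  moreover have "continuous_on UNIV f"
    unfolding f_def gauss_def cis_conv_exp by (intro continuous_intros)
  moreover have "bounded (range f)"
    using s by (intro boundedI[of _ "s ^ DIM('a)"])
      (auto simp: f_def norm_mult norm_power intro!: mult_left_le gauss_le_1)
  ultimately show "f \<in> tame" by (simp add: tame_def)
  have "ft f w = (LINT t|lborel. s ^ DIM('a) *\<^sub>R (complex_of_real (gauss (s *\<^sub>R t)) * cis (- (2 * pi * (t \<bullet> (w - \<xi>))))))"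
    unfolding ft_def
    by (intro Bochner_Integration.integral_cong refl)
       (simp add: f_def scaleR_conv_of_real mult.assoc cis_mult inner_diff_right algebra_simps)
  also have "\<dots> = s ^ DIM('a) *\<^sub>R complex_of_real (gauss ((1 / s) *\<^sub>R (w - \<xi>)) / s ^ DIM('a))"
    unfolding integral_scaleR_right ft_scaled_gauss(2)[OF s] ..
  finally show "ft f w = complex_of_real (gauss ((1 / s) *\<^sub>R (w - \<xi>)))"
    using s by (simp add: scaleR_conv_of_real)
qed

text \<open>A weight whose Gaussian averages agree with those of \<open>1\<close> is \<open>1\<close>. Fatou's lemma, applied to
  indicators of open sets smoothed by narrowing Gaussians, bounds the integral of \<open>H\<close> over an open
  set by its volume, and outer regularity gives \<open>H \<le> 1\<close>. After that a single Gaussian average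
  leaves no room for \<open>H < 1\<close>.\<close>

lemma weight_eq_1:
  fixes H :: "'a::euclidean_space \<Rightarrow> ennreal"
  assumes [measurable]: "H \<in> borel_measurable borel"
    and eq: "\<And>s \<xi>. 0 < s \<Longrightarrow> (\<integral>\<^sup>+w. ennreal ((gauss (s *\<^sub>R (w - \<xi>)))\<^sup>2) * H w \<partial>lborel)
          = (\<integral>\<^sup>+w. ennreal ((gauss (s *\<^sub>R (w - \<xi>)))\<^sup>2) \<partial>lborel)"
  shows "AE w in lborel. H w = 1"
proof -
  define G :: "'a \<Rightarrow> ennreal" where "G = (\<lambda>z. ennreal ((gauss z)\<^sup>2))"
  have [measurable]: "G \<in> borel_measurable borel" unfolding G_def by measurable
  define c where "c = (\<integral>\<^sup>+z. G z \<partial>lborel)"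
  have G_pos: "0 < G z" for z unfolding G_def using gauss_pos[of z] by simp
  have "c \<le> (\<integral>\<^sup>+z. ennreal (gauss (z::'a)) \<partial>lborel)"
    unfolding c_def G_def
    by (intro nn_integral_mono ennreal_leI)
       (auto simp: power2_eq_square intro!: mult_left_le gauss_le_1 less_imp_le[OF gauss_pos])
  also have "\<dots> < \<infinity>"
    using gauss_integrable[where 'a='a] by (subst nn_integral_eq_integral) (auto intro: less_imp_le[OF gauss_pos])
  finally have c_fin: "c < \<infinity>" .
  have c_pos: "0 < c"
  proof (rule ccontr)
    assume "\<not> 0 < c"
    then have "(\<integral>\<^sup>+z. G z \<partial>lborel) = 0" by (simp add: c_def zero_less_iff_neq_zero)
    then have "AE z::'a in lborel. G z = 0" by (subst (asm) nn_integral_0_iff_AE) auto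
    then have "AE z::'a in lborel. False" using G_pos by (simp add: zero_less_iff_neq_zero)
    then have "emeasure lborel (UNIV :: 'a set) = 0" by (subst (asm) AE_iff_null) (auto simp: null_sets_def)
    then show False by simp
  qed
  have open_le: "(\<integral>\<^sup>+w. indicator A w * H w \<partial>lborel) \<le> emeasure lborel A" if A: "open A" for A
  proof -
    have [measurable]: "A \<in> sets borel" using A by simp
    define s where "s = (\<lambda>n. real (Suc n))"
    have s: "0 < s n" for n by (simp add: s_def)
    \<comment> \<open>\<open>T n F\<close> is the integral of \<open>F\<close> against the indicator of \<open>A\<close> smoothed at scale \<open>1 / s n\<close>. By Tonelli it only sees \<open>F\<close> through its Gaussian averages, so it takes the same value for \<open>H\<close> and for \<open>1\<close>.\<close>
    define T where "T n F = (\<integral>\<^sup>+w. (\<integral>\<^sup>+z. indicator A (w + (1 / s n) *\<^sub>R z) * G z \<partial>lborel) * F w \<partial>lborel)" for n F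
    have T_eq: "T n F = ennreal (s n ^ DIM('a)) * (\<integral>\<^sup>+\<xi>. indicator A \<xi> * (\<integral>\<^sup>+w. G (s n *\<^sub>R (w - \<xi>)) * F w \<partial>lborel) \<partial>lborel)"
      if [measurable]: "F \<in> borel_measurable borel" for n F
    proof -
      have "(\<integral>\<^sup>+z. indicator A (w + (1 / s n) *\<^sub>R z) * G z \<partial>lborel)
          = ennreal (s n ^ DIM('a)) * (\<integral>\<^sup>+\<xi>. indicator A \<xi> * G (s n *\<^sub>R (w - \<xi>)) \<partial>lborel)" for w
      proof -
        have "(\<integral>\<^sup>+z. indicator A (w + (1 / s n) *\<^sub>R z) * G z \<partial>lborel)
          = ennreal (s n ^ DIM('a)) * (\<integral>\<^sup>+\<xi>. indicator A (w + (1 / s n) *\<^sub>R (- (s n *\<^sub>R w) + s n *\<^sub>R \<xi>)) * G (- (s n *\<^sub>R w) + s n *\<^sub>R \<xi>) \<partial>lborel)"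
          using nn_integral_lborel_scale[of "\<lambda>z. indicator A (w + (1 / s n) *\<^sub>R z) * G z" "s n" "- (s n *\<^sub>R w)"] s[of n]
          by simp
        moreover have "w + (1 / s n) *\<^sub>R (- (s n *\<^sub>R w) + s n *\<^sub>R \<xi>) = \<xi>" for \<xi>
          using s[of n] by (simp add: scaleR_diff_right)
        moreover have "G (- (s n *\<^sub>R w) + s n *\<^sub>R \<xi>) = G (s n *\<^sub>R (w - \<xi>))" for \<xi>
          unfolding G_def using gauss_minus[of "s n *\<^sub>R (w - \<xi>)"] by (simp add: algebra_simps)
        ultimately show ?thesis by simp
      qed
      then have "T n F = (\<integral>\<^sup>+w. ennreal (s n ^ DIM('a)) * (\<integral>\<^sup>+\<xi>. indicator A \<xi> * G (s n *\<^sub>R (w - \<xi>)) * F w \<partial>lborel) \<partial>lborel)"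
        unfolding T_def by (simp add: nn_integral_multc) (simp add: mult.assoc)
      also have "\<dots> = ennreal (s n ^ DIM('a)) * (\<integral>\<^sup>+w. (\<integral>\<^sup>+\<xi>. indicator A \<xi> * G (s n *\<^sub>R (w - \<xi>)) * F w \<partial>lborel) \<partial>lborel)"
        by (subst nn_integral_cmult) auto
      also have "(\<integral>\<^sup>+w. (\<integral>\<^sup>+\<xi>. indicator A \<xi> * G (s n *\<^sub>R (w - \<xi>)) * F w \<partial>lborel) \<partial>lborel)
         = (\<integral>\<^sup>+\<xi>. (\<integral>\<^sup>+w. indicator A \<xi> * G (s n *\<^sub>R (w - \<xi>)) * F w \<partial>lborel) \<partial>lborel)"
        by (rule lborel_pair.Fubini') measurable
      also have "\<dots> = (\<integral>\<^sup>+\<xi>. indicator A \<xi> * (\<integral>\<^sup>+w. G (s n *\<^sub>R (w - \<xi>)) * F w \<partial>lborel) \<partial>lborel)"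
        by (simp add: nn_integral_cmult mult.assoc)
      finally show ?thesis .
    qed
    have TH: "T n H = T n (\<lambda>_. 1)" for n
      using eq[OF s] by (simp add: T_eq G_def)
    have T1: "T n (\<lambda>_. 1) = c * emeasure lborel A" for n
    proof -
      have "T n (\<lambda>_. 1) = (\<integral>\<^sup>+w. (\<integral>\<^sup>+z. indicator A (w + (1 / s n) *\<^sub>R z) * G z \<partial>lborel) \<partial>lborel)"
        unfolding T_def by simp
      also have "\<dots> = (\<integral>\<^sup>+z. (\<integral>\<^sup>+w. indicator A (w + (1 / s n) *\<^sub>R z) * G z \<partial>lborel) \<partial>lborel)"
        by (rule lborel_pair.Fubini') measurable
      also have "\<dots> = (\<integral>\<^sup>+z. emeasure lborel A * G z \<partial>lborel)"
      proof (intro nn_integral_cong)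
        fix z :: 'a
        have "(\<integral>\<^sup>+w. indicator A (w + (1 / s n) *\<^sub>R z) \<partial>lborel) = (\<integral>\<^sup>+w. indicator A w \<partial>lborel)"
          using nn_integral_lborel_scale[of "indicator A :: 'a \<Rightarrow> ennreal" 1 "(1 / s n) *\<^sub>R z"]
          by (simp add: add.commute)
        then show "(\<integral>\<^sup>+w. indicator A (w + (1 / s n) *\<^sub>R z) * G z \<partial>lborel) = emeasure lborel A * G z"
          by (simp add: nn_integral_multc)
      qed
      finally show ?thesis unfolding c_def by (simp add: nn_integral_cmult nn_integral_multc mult.commute)
    qed
    \<comment> \<open>Openness of \<open>A\<close> makes the smoothed indicators dominate the indicator of \<open>A\<close> in the limit.\<close>
    have low: "indicator A w * c * h \<le> liminf (\<lambda>n. (\<integral>\<^sup>+z. indicator A (w + (1 / s n) *\<^sub>R z) * G z \<partial>lborel) * h)" for w h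
    proof -
      have "indicator A w * c * h = (\<integral>\<^sup>+z. indicator A w * G z * h \<partial>lborel)"
        unfolding c_def by (simp add: nn_integral_cmult nn_integral_multc)
      also have "\<dots> \<le> (\<integral>\<^sup>+z. liminf (\<lambda>n. indicator A (w + (1 / s n) *\<^sub>R z) * G z * h) \<partial>lborel)"
      proof (intro nn_integral_mono)
        fix z
        show "indicator A w * G z * h \<le> liminf (\<lambda>n. indicator A (w + (1 / s n) *\<^sub>R z) * G z * h)"
        proof (cases "w \<in> A")
          case True
          have "(\<lambda>n. 1 / s n) \<longlonglongrightarrow> 0" unfolding s_def by (rule LIMSEQ_Suc) (rule lim_const_over_n)
          then have "(\<lambda>n. w + (1 / s n) *\<^sub>R z) \<longlonglongrightarrow> w + 0 *\<^sub>R z" by (intro tendsto_intros)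
          then have "eventually (\<lambda>n. w + (1 / s n) *\<^sub>R z \<in> A) sequentially"
            using A True by (intro topological_tendstoD) auto
          then show ?thesis using True
            by (intro Liminf_bounded) (auto elim!: eventually_mono)
        qed simp
      qed
      also have "\<dots> \<le> liminf (\<lambda>n. \<integral>\<^sup>+z. indicator A (w + (1 / s n) *\<^sub>R z) * G z * h \<partial>lborel)"
        by (rule nn_integral_liminf) measurable
      finally show ?thesis by (simp add: nn_integral_multc)
    qed
    have "c * (\<integral>\<^sup>+w. indicator A w * H w \<partial>lborel) = (\<integral>\<^sup>+w. (indicator A w * c) * H w \<partial>lborel)"
      by (subst nn_integral_cmult[symmetric]) (auto simp: mult_ac)
    also have "\<dots> \<le> (\<integral>\<^sup>+w. liminf (\<lambda>n. (\<integral>\<^sup>+z. indicator A (w + (1 / s n) *\<^sub>R z) * G z \<partial>lborel) * H w) \<partial>lborel)"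
      by (intro nn_integral_mono low)
    also have "\<dots> \<le> liminf (\<lambda>n. T n H)"
      unfolding T_def by (rule nn_integral_liminf) measurable
    also have "\<dots> = c * emeasure lborel A" unfolding TH T1 by (rule Liminf_const) simp
    finally have "c * (\<integral>\<^sup>+w. indicator A w * H w \<partial>lborel) \<le> c * emeasure lborel A" .
    then show ?thesis using c_pos c_fin by (simp add: ennreal_mult_le_mult_iff)
  qed
  have set_le: "(\<integral>\<^sup>+w. indicator E w * H w \<partial>lborel) \<le> emeasure lborel E" if E[measurable]: "E \<in> sets borel" for E
  proof (rule ennreal_le_epsilon)
    fix e :: real assume e: "0 < e" "emeasure lborel E < top"
    obtain U where U: "open U" "E \<subseteq> U" "emeasure lborel (U - E) < ennreal e"
      using outer_regular_lborel[OF E e(1)] by blast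
    have [measurable]: "U \<in> sets borel" using U by simp
    have "(\<integral>\<^sup>+w. indicator E w * H w \<partial>lborel) \<le> (\<integral>\<^sup>+w. indicator U w * H w \<partial>lborel)"
      using U(2) by (intro nn_integral_mono mult_right_mono) (auto simp: indicator_def)
    also have "\<dots> \<le> emeasure lborel U" by (rule open_le[OF U(1)])
    also have "\<dots> = emeasure lborel E + emeasure lborel (U - E)"
      using U(2) by (subst plus_emeasure) (auto simp: Un_absorb1)
    also have "\<dots> \<le> emeasure lborel E + ennreal e" using U(3) by (intro add_left_mono) auto
    finally show "(\<integral>\<^sup>+w. indicator E w * H w \<partial>lborel) \<le> emeasure lborel E + ennreal e" .
  qed
  have H_le: "AE w in lborel. H w \<le> 1"
  proof -
    define E where "E k = {w \<in> cball 0 (real k). 1 < H w}" for k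
    have [measurable]: "E k \<in> sets borel" for k
      unfolding E_def by measurable
    have null: "AE w in lborel. w \<notin> E k" for k
    proof -
      have fin: "emeasure lborel (E k) < \<infinity>"
        by (rule emeasure_bounded_finite) (rule bounded_subset[OF bounded_cball[of 0 "real k"]], auto simp: E_def)
      have "emeasure lborel (E k) + (\<integral>\<^sup>+w. indicator (E k) w * (H w - 1) \<partial>lborel)
         = (\<integral>\<^sup>+w. indicator (E k) w + indicator (E k) w * (H w - 1) \<partial>lborel)"
        by (subst nn_integral_add) auto
      also have "\<dots> = (\<integral>\<^sup>+w. indicator (E k) w * H w \<partial>lborel)"
        by (intro nn_integral_cong) (auto simp: E_def indicator_def add_diff_inverse_ennreal less_imp_le)
      also have "\<dots> \<le> emeasure lborel (E k) + 0" using set_le by simp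
      finally have "(\<integral>\<^sup>+w. indicator (E k) w * (H w - 1) \<partial>lborel) \<le> 0"
        using fin by (subst (asm) ennreal_add_left_cancel_le) auto
      then have "AE w in lborel. indicator (E k) w * (H w - 1) = 0"
        by (subst nn_integral_0_iff_AE[symmetric]) auto
      then show ?thesis
      proof eventually_elim
        case (elim w)
        show ?case
        proof
          assume w: "w \<in> E k"
          then have "H w - 1 = 0" using elim by simp
          then have "H w \<le> 1" by (rule ennreal_minus_eq_0)
          moreover have "1 < H w" using w by (simp add: E_def)
          ultimately show False by simp
        qed
      qed
    qed
    have "AE w in lborel. \<forall>k. w \<notin> E k" using null by (simp add: AE_all_countable)
    then show ?thesis
    proof eventually_elim
      case (elim w)
      obtain k where "norm w \<le> real k" using real_arch_simple by blast
      then have "\<not> 1 < H w" using elim by (auto simp: E_def)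
      then show ?case by simp
    qed
  qed
  \<comment> \<open>Now \<open>1 - H\<close> is nonnegative and its integral against a positive Gaussian vanishes.\<close>
  have "(\<integral>\<^sup>+w. G w * (1 - H w) \<partial>lborel) + c = c + 0"
  proof -
    have "(\<integral>\<^sup>+w. G w * (1 - H w) \<partial>lborel) + c = (\<integral>\<^sup>+w. G w * (1 - H w) \<partial>lborel) + (\<integral>\<^sup>+w. G w * H w \<partial>lborel)"
      using eq[of 1 0] by (simp add: c_def G_def)
    also have "\<dots> = (\<integral>\<^sup>+w. G w * (1 - H w) + G w * H w \<partial>lborel)"
      by (rule nn_integral_add[symmetric]) measurable
    also have "\<dots> = (\<integral>\<^sup>+w. G w \<partial>lborel)"
    proof (rule nn_integral_cong_AE)
      show "AE w in lborel. G w * (1 - H w) + G w * H w = G w"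
        using H_le by eventually_elim (simp flip: distrib_left add: diff_add_cancel_ennreal)
    qed
    finally show ?thesis by (simp add: c_def)
  qed
  then have "(\<integral>\<^sup>+w. G w * (1 - H w) \<partial>lborel) = 0"
    using c_fin by (metis add.commute ennreal_add_left_cancel less_irrefl infinity_ennreal_def)
  then have "AE w in lborel. G w * (1 - H w) = 0"
    by (subst nn_integral_0_iff_AE[symmetric]) auto
  with H_le show ?thesis
  proof eventually_elim
    case (elim w)
    then have "1 - H w = 0" using G_pos[of w] by (metis less_irrefl mult_eq_0_iff)
    then have "1 \<le> H w" by (rule ennreal_minus_eq_0)
    with elim(1) show ?case by simp
  qed
qed

section \<open>Averages over large cubes\<close>

lemma infsum_eq_nn_integral_count_space:
  fixes f :: "'b \<Rightarrow> ennreal"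
  assumes "countable A"
  shows "(\<Sum>\<^sub>\<infinity>x\<in>A. f x) = (\<integral>\<^sup>+x. f x \<partial>count_space A)"
proof (cases "finite A")
  case True
  then show ?thesis by (simp add: nn_integral_count_space_finite)
next
  case False
  note b = bij_betw_from_nat_into[OF assms False]
  have "(\<Sum>\<^sub>\<infinity>x\<in>A. f x) = (\<Sum>\<^sub>\<infinity>n. f (from_nat_into A n))"
    using infsum_reindex_bij_betw[OF b, of f] by simp
  also have "\<dots> = (\<Sum>n. f (from_nat_into A n))"
    by (intro sums_unique has_sum_imp_sums has_sum_infsum nonneg_summable_on_complete) simp
  also have "\<dots> = (\<integral>\<^sup>+x. f x \<partial>count_space A)"
    by (simp add: nn_integral_bij_count_space[symmetric, OF b] nn_integral_count_space_nat)
  finally show ?thesis .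
qed

lemma borel_measurable_nn_integral_count_space:
  fixes f :: "'b \<Rightarrow> 'c \<Rightarrow> ennreal"
  assumes "countable A" and [measurable]: "\<And>i. i \<in> A \<Longrightarrow> f i \<in> borel_measurable M"
  shows "(\<lambda>x. \<integral>\<^sup>+i. f i x \<partial>count_space A) \<in> borel_measurable M"
proof (cases "finite A")
  case True
  then show ?thesis by (simp add: nn_integral_count_space_finite)
next
  case False
  then have [simp]: "A \<noteq> {}" by auto
  show ?thesis
    unfolding nn_integral_bij_count_space[symmetric, OF bij_betw_from_nat_into[OF assms(1) False]]
      nn_integral_count_space_nat
    by (intro borel_measurable_suminf_order assms(2)) (simp add: from_nat_into)
qed

lemma nn_integral_indicator_count_space:
  assumes "finite (\<Lambda> \<inter> S)"
  shows "(\<integral>\<^sup>+l. indicator S l \<partial>count_space \<Lambda>) = ennreal (card (\<Lambda> \<inter> S))"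
proof -
  have "(\<integral>\<^sup>+l. indicator S l \<partial>count_space \<Lambda>) = (\<integral>\<^sup>+l. indicator (\<Lambda> \<inter> S) l \<partial>count_space \<Lambda>)"
    by (intro nn_integral_cong) (auto simp: indicator_def)
  also have "\<dots> = emeasure (count_space \<Lambda>) (\<Lambda> \<inter> S)" by (rule nn_integral_indicator) auto
  also have "\<dots> = ennreal (card (\<Lambda> \<inter> S))"
    using assms by (subst emeasure_count_space_finite) (auto simp: ennreal_of_nat_eq_real_of_nat)
  finally show ?thesis .
qed

lemma card_inter_cube_measurable:
  fixes \<Lambda> :: "(real ^ 'm) set"
  assumes "countable \<Lambda>" and fin: "\<And>y. finite (\<Lambda> \<inter> cube y R)"
  shows "(\<lambda>y. ennreal (card (\<Lambda> \<inter> cube y R))) \<in> borel_measurable borel"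
proof -
  have "ennreal (card (\<Lambda> \<inter> cube y R)) = (\<integral>\<^sup>+l. indicator (cube (l - (\<chi> i. R)) R) y \<partial>count_space \<Lambda>)" for y
    unfolding nn_integral_indicator_count_space[OF fin, symmetric]
    by (rule nn_integral_cong) (auto simp: indicator_def mem_box_cart algebra_simps)
  then have e: "(\<lambda>y. ennreal (card (\<Lambda> \<inter> cube y R))) = (\<lambda>y. (\<integral>\<^sup>+l. indicator (cube (l - (\<chi> i. R)) R) y \<partial>count_space \<Lambda>))"
    by (rule ext)
  show ?thesis
    unfolding e using assms(1) by (intro borel_measurable_nn_integral_count_space) auto
qed

text \<open>The average of \<open>F\<close> over \<open>[-R, 0]\<^sup>m\<close>. This position of the cube is chosen because \<open>y - l\<close> lies in
  it exactly when \<open>l\<close> lies in the cube with corner \<open>y\<close>, so that counts with a fixed corner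
  appear.\<close>

definition mean :: "real \<Rightarrow> (real ^ 'm \<Rightarrow> ennreal) \<Rightarrow> ennreal" where
  "mean R F = ennreal (1 / R ^ CARD('m)) *
     (\<integral>\<^sup>+x. indicator (cube (\<chi> i. - R) R) x * F x \<partial>(lborel :: (real ^ 'm) measure))"

lemma mean_le:
  assumes "0 < R" "\<And>x. F x \<le> c"
  shows "mean R F \<le> c"
proof -
  have "mean R F \<le> ennreal (1 / R ^ CARD('a)) * (\<integral>\<^sup>+x. indicator (cube (\<chi> i. - R) R) x * c \<partial>(lborel :: (real ^ 'a) measure))"
    unfolding mean_def by (intro mult_left_mono nn_integral_mono) (auto intro: assms mult_left_mono)
  also have "\<dots> = ennreal (1 / R ^ CARD('a)) * (ennreal (R ^ CARD('a)) * c)"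
    using assms by (subst nn_integral_multc) (auto simp: emeasure_cube)
  also have "\<dots> = c" using assms(1) by (simp add: mult.assoc[symmetric] flip: ennreal_mult)
  finally show ?thesis .
qed

lemma mean_const:
  assumes "0 < R"
  shows "mean R (\<lambda>_ :: real ^ 'm. c) = c"
proof -
  have "mean R (\<lambda>_ :: real ^ 'm. c) = ennreal (1 / R ^ CARD('m)) * (ennreal (R ^ CARD('m)) * c)"
    unfolding mean_def using assms by (subst nn_integral_multc) (auto simp: emeasure_cube)
  also have "\<dots> = c" using assms by (simp add: mult.assoc[symmetric] flip: ennreal_mult)
  finally show ?thesis .
qed

lemma mean_add:
  assumes [measurable]: "F \<in> borel_measurable borel" "G \<in> borel_measurable borel"
  shows "mean R (\<lambda>x. F x + G x) = mean R F + mean R G"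
  unfolding mean_def by (simp add: distrib_left nn_integral_add)

lemma mean_cmult:
  assumes [measurable]: "F \<in> borel_measurable borel"
  shows "mean R (\<lambda>x. c * F x) = c * mean R F"
  unfolding mean_def by (simp add: nn_integral_cmult mult.left_commute)

text \<open>Tonelli: each translate contributes the integral of \<open>\<phi>\<close> over a shifted cube, so a value
  \<open>\<phi> y\<close> is counted once for every \<open>l\<close> in the cube with corner \<open>y\<close>.\<close>

lemma mean_translates:
  fixes \<phi> :: "real ^ 'm \<Rightarrow> ennreal"
  assumes "countable \<Lambda>" and [measurable]: "\<phi> \<in> borel_measurable borel"
    and fin: "\<And>y. finite (\<Lambda> \<inter> cube y R)" and R: "0 < R"
  shows "mean R (\<lambda>x. \<integral>\<^sup>+l. \<phi> (l + x) \<partial>count_space \<Lambda>)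
    = (\<integral>\<^sup>+y. \<phi> y * ennreal (real (card (\<Lambda> \<inter> cube y R)) / R ^ CARD('m)) \<partial>lborel)"
proof -
  let ?c = "ennreal (1 / R ^ CARD('m))"
  have "(\<integral>\<^sup>+x. indicator (cube (\<chi> i. - R) R) x * (\<integral>\<^sup>+l. \<phi> (l + x) \<partial>count_space \<Lambda>) \<partial>lborel)
    = (\<integral>\<^sup>+x. \<integral>\<^sup>+l. indicator (cube (\<chi> i. - R) R) x * \<phi> (l + x) \<partial>count_space \<Lambda> \<partial>lborel)"
    by (simp add: nn_integral_cmult)
  also have "\<dots> = (\<integral>\<^sup>+l. \<integral>\<^sup>+x. indicator (cube (\<chi> i. - R) R) x * \<phi> (l + x) \<partial>lborel \<partial>count_space \<Lambda>)"
    by (rule nn_integral_count_space_nn_integral[OF assms(1)]) measurable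
  also have "\<dots> = (\<integral>\<^sup>+l. \<integral>\<^sup>+y. indicator (cube y R) l * \<phi> y \<partial>lborel \<partial>count_space \<Lambda>)"
  proof (rule nn_integral_cong)
    fix l :: "real ^ 'm"
    have "(\<integral>\<^sup>+x. indicator (cube (\<chi> i. - R) R) x * \<phi> (l + x) \<partial>lborel)
       = (\<integral>\<^sup>+y. indicator (cube (\<chi> i. - R) R) (y - l) * \<phi> y \<partial>lborel)"
      using nn_integral_lborel_scale[of "\<lambda>x. indicator (cube (\<chi> i. - R) R) x * \<phi> (l + x)" 1 "- l"] by simp
    moreover have "indicator (cube (\<chi> i. - R) R) (y - l) = (indicator (cube y R) l :: ennreal)" for y
      by (auto simp: indicator_def mem_box_cart algebra_simps)
    ultimately show "(\<integral>\<^sup>+x. indicator (cube (\<chi> i. - R) R) x * \<phi> (l + x) \<partial>lborel)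
       = (\<integral>\<^sup>+y. indicator (cube y R) l * \<phi> y \<partial>lborel)" by simp
  qed
  also have "\<dots> = (\<integral>\<^sup>+y. \<integral>\<^sup>+l. indicator (cube y R) l * \<phi> y \<partial>count_space \<Lambda> \<partial>lborel)"
  proof (rule nn_integral_count_space_nn_integral[OF assms(1), symmetric])
    fix l :: "real ^ 'm"
    have "indicator (cube y R) l = (indicator (cube (l - (\<chi> i. R)) R) y :: ennreal)" for y
      by (auto simp: indicator_def mem_box_cart algebra_simps)
    then show "(\<lambda>y. indicator (cube y R) l * \<phi> y) \<in> borel_measurable lborel" by simp
  qed
  also have "\<dots> = (\<integral>\<^sup>+y. ennreal (card (\<Lambda> \<inter> cube y R)) * \<phi> y \<partial>lborel)"
    by (simp add: nn_integral_multc nn_integral_indicator_count_space[OF fin])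
  finally have "mean R (\<lambda>x. \<integral>\<^sup>+l. \<phi> (l + x) \<partial>count_space \<Lambda>) = ?c * (\<integral>\<^sup>+y. ennreal (card (\<Lambda> \<inter> cube y R)) * \<phi> y \<partial>lborel)"
    unfolding mean_def by simp
  also have "\<dots> = (\<integral>\<^sup>+y. ?c * (ennreal (card (\<Lambda> \<inter> cube y R)) * \<phi> y) \<partial>lborel)"
  proof (rule nn_integral_cmult[symmetric])
    note card_inter_cube_measurable[OF assms(1) fin, measurable]
    show "(\<lambda>y. ennreal (card (\<Lambda> \<inter> cube y R)) * \<phi> y) \<in> borel_measurable lborel" by measurable
  qed
  also have "\<dots> = (\<integral>\<^sup>+y. \<phi> y * ennreal (real (card (\<Lambda> \<inter> cube y R)) / R ^ CARD('m)) \<partial>lborel)"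
  proof (rule nn_integral_cong)
    fix y
    have h: "?c * ennreal (card (\<Lambda> \<inter> cube y R)) = ennreal (real (card (\<Lambda> \<inter> cube y R)) / R ^ CARD('m))"
      using R by (simp flip: ennreal_mult)
    show "?c * (ennreal (card (\<Lambda> \<inter> cube y R)) * \<phi> y) = \<phi> y * ennreal (real (card (\<Lambda> \<inter> cube y R)) / R ^ CARD('m))"
      unfolding h[symmetric] by (simp add: mult_ac)
  qed
  finally show ?thesis .
qed


text \<open>Translation sets with a density and a uniform bound for the counts in cubes: what Fatou's lemma and
  dominated convergence need in order to average sums over translates.\<close>

locale averaging_set =
  fixes \<Lambda> :: "(real ^ 'm) set" and D C :: real
  assumes countable: "countable \<Lambda>"
    and density: "has_density \<Lambda> D"
    and finite_count: "\<And>x R. 1 \<le> R \<Longrightarrow> finite (\<Lambda> \<inter> cube x R)"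
    and count_le: "\<And>x R. 1 \<le> R \<Longrightarrow> real (card (\<Lambda> \<inter> cube x R)) \<le> C * R ^ CARD('m)"
begin

lemma count_tendsto:
  "(\<lambda>n. ennreal (real (card (\<Lambda> \<inter> cube y (real (Suc n)))) / real (Suc n) ^ CARD('m))) \<longlonglongrightarrow> ennreal D"
proof -
  have "((\<lambda>R. real (card (\<Lambda> \<inter> cube y R)) / R ^ CARD('m)) \<longlongrightarrow> D) at_top"
  proof (rule Lim_transform_eventually)
    show "((\<lambda>R. real (card (\<Lambda> \<inter> (\<lambda>s. y + R *\<^sub>R s) ` unit_cube)) / R ^ CARD('m)) \<longlongrightarrow> D) at_top"
      using density unfolding has_density_def by blast
    show "eventually (\<lambda>R. real (card (\<Lambda> \<inter> (\<lambda>s. y + R *\<^sub>R s) ` unit_cube)) / R ^ CARD('m)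
       = real (card (\<Lambda> \<inter> cube y R)) / R ^ CARD('m)) at_top"
      using eventually_gt_at_top[of 0] by eventually_elim (simp add: image_unit_cube)
  qed
  moreover have "filterlim (\<lambda>n. real (Suc n)) at_top sequentially"
    by (rule filterlim_compose[OF filterlim_real_sequentially filterlim_Suc])
  ultimately show ?thesis by (intro tendsto_ennrealI) (rule filterlim_compose)
qed

lemma count_measurable:
  assumes "1 \<le> R"
  shows "(\<lambda>y. ennreal (real (card (\<Lambda> \<inter> cube y R)) / R ^ CARD('m))) \<in> borel_measurable borel"
proof -
  note card_inter_cube_measurable[OF countable finite_count[OF assms], measurable]
  have "(\<lambda>y. ennreal (1 / R ^ CARD('m)) * ennreal (card (\<Lambda> \<inter> cube y R))) \<in> borel_measurable borel"
    by measurable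
  then show ?thesis using assms by (simp flip: ennreal_mult)
qed

text \<open>Needed besides \<open>mean_tendsto\<close> to establish that \<open>\<phi>\<close> is integrable in the first place.\<close>

lemma mean_liminf:
  assumes [measurable]: "\<phi> \<in> borel_measurable borel"
  shows "ennreal D * (\<integral>\<^sup>+y. \<phi> y \<partial>lborel)
    \<le> liminf (\<lambda>n. mean (real (Suc n)) (\<lambda>x. \<integral>\<^sup>+l. \<phi> (l + x) \<partial>count_space \<Lambda>))"
proof -
  let ?N = "\<lambda>n y. ennreal (real (card (\<Lambda> \<inter> cube y (real (Suc n)))) / real (Suc n) ^ CARD('m))"
  have [measurable]: "?N n \<in> borel_measurable borel" for n by (rule count_measurable) simp
  have "ennreal D * (\<integral>\<^sup>+y. \<phi> y \<partial>lborel) = (\<integral>\<^sup>+y. ennreal D * \<phi> y \<partial>lborel)"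
    by (simp add: nn_integral_cmult)
  also have "\<dots> \<le> (\<integral>\<^sup>+y. liminf (\<lambda>n. \<phi> y * ?N n y) \<partial>lborel)"
  proof (rule nn_integral_mono)
    fix y
    show "ennreal D * \<phi> y \<le> liminf (\<lambda>n. \<phi> y * ?N n y)"
    proof (cases "\<phi> y = \<infinity>")
      case False
      then have "(\<lambda>n. \<phi> y * ?N n y) \<longlonglongrightarrow> \<phi> y * ennreal D"
        by (intro ennreal_tendsto_cmult count_tendsto) (simp add: less_top)
      then show ?thesis by (simp add: lim_imp_Liminf mult.commute)
    next
      case True
      show ?thesis
      proof (cases "D \<le> 0")
        case D: False
        then have "eventually (\<lambda>n. 0 < ?N n y) sequentially"
          using order_tendstoD(1)[OF count_tendsto[of y], of 0] by simp
        then have "eventually (\<lambda>n. \<infinity> \<le> \<phi> y * ?N n y) sequentially"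
        proof eventually_elim
          case (elim n)
          then have "(?N n y = 0) = False" by (simp only: zero_less_iff_neq_zero simp_thms)
          then show ?case by (simp only: True infinity_ennreal_def ennreal_top_mult if_False order_refl simp_thms)
        qed
        then have "\<infinity> \<le> liminf (\<lambda>n. \<phi> y * ?N n y)" by (rule Liminf_bounded)
        then show ?thesis by (simp add: top_unique)
      qed (simp add: ennreal_neg)
    qed
  qed
  also have "\<dots> \<le> liminf (\<lambda>n. \<integral>\<^sup>+y. \<phi> y * ?N n y \<partial>lborel)"
    by (rule nn_integral_liminf) measurable
  also have "\<dots> = liminf (\<lambda>n. mean (real (Suc n)) (\<lambda>x. \<integral>\<^sup>+l. \<phi> (l + x) \<partial>count_space \<Lambda>))"
    by (subst mean_translates) (auto intro: countable finite_count)
  finally show ?thesis .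
qed

lemma mean_tendsto:
  assumes [measurable]: "\<phi> \<in> borel_measurable borel" and fin: "(\<integral>\<^sup>+y. \<phi> y \<partial>lborel) < \<infinity>"
  shows "(\<lambda>n. mean (real (Suc n)) (\<lambda>x. \<integral>\<^sup>+l. \<phi> (l + x) \<partial>count_space \<Lambda>))
    \<longlonglongrightarrow> ennreal D * (\<integral>\<^sup>+y. \<phi> y \<partial>lborel)"
proof -
  let ?N = "\<lambda>n y. ennreal (real (card (\<Lambda> \<inter> cube y (real (Suc n)))) / real (Suc n) ^ CARD('m))"
  have [measurable]: "?N n \<in> borel_measurable borel" for n by (rule count_measurable) simp
  have N_le: "?N n y \<le> ennreal C" for n y
    using count_le[of "real (Suc n)" y] by (intro ennreal_leI) (simp add: field_simps)
  have "(\<lambda>n. \<integral>\<^sup>+y. \<phi> y * ?N n y \<partial>lborel) \<longlonglongrightarrow> (\<integral>\<^sup>+y. \<phi> y * ennreal D \<partial>lborel)"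
  proof (rule nn_integral_dominated_convergence[where w="\<lambda>y. \<phi> y * ennreal C"])
    show "(\<integral>\<^sup>+y. \<phi> y * ennreal C \<partial>lborel) < \<infinity>"
      using fin by (simp add: nn_integral_multc ennreal_mult_less_top)
    show "AE y in lborel. \<phi> y * ?N n y \<le> \<phi> y * ennreal C" for n
      using N_le by (intro AE_I2 mult_left_mono) auto
    have "AE y in lborel. \<phi> y \<noteq> \<infinity>"
      using fin by (intro nn_integral_PInf_AE) auto
    then show "AE y in lborel. (\<lambda>n. \<phi> y * ?N n y) \<longlonglongrightarrow> \<phi> y * ennreal D"
      by eventually_elim (intro ennreal_tendsto_cmult count_tendsto, simp add: less_top)
  qed measurable
  also have "(\<lambda>n. \<integral>\<^sup>+y. \<phi> y * ?N n y \<partial>lborel) = (\<lambda>n. mean (real (Suc n)) (\<lambda>x. \<integral>\<^sup>+l. \<phi> (l + x) \<partial>count_space \<Lambda>))"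
    by (subst mean_translates) (auto intro: countable finite_count)
  also have "(\<integral>\<^sup>+y. \<phi> y * ennreal D \<partial>lborel) = ennreal D * (\<integral>\<^sup>+y. \<phi> y \<partial>lborel)"
    by (subst nn_integral_multc) (auto simp: mult.commute)
  finally show ?thesis .
qed

end


text \<open>Used in place of the triangle inequality: it is quadratic, so it can be summed and
  integrated term by term without square roots, and a small \<open>\<eta>\<close> loses little.\<close>

lemma norm_add_square_le:
  fixes a b :: complex
  assumes "0 < \<eta>"
  shows "(norm (a + b))\<^sup>2 \<le> (1 + \<eta>) * (norm a)\<^sup>2 + (1 + 1 / \<eta>) * (norm b)\<^sup>2"
proof -
  have "(norm (a + b))\<^sup>2 \<le> (norm a + norm b)\<^sup>2"
    by (intro power_mono norm_triangle_ineq) simp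
  also have "\<dots> = (1 + \<eta>) * (norm a)\<^sup>2 + (1 + 1 / \<eta>) * (norm b)\<^sup>2 - (\<eta> * norm a - norm b)\<^sup>2 / \<eta>"
    using assms by (simp add: power2_eq_square field_simps)
  also have "\<dots> \<le> (1 + \<eta>) * (norm a)\<^sup>2 + (1 + 1 / \<eta>) * (norm b)\<^sup>2"
    using assms by simp
  finally show ?thesis .
qed

lemma nn_integral_norm_add_square_le:
  fixes f g :: "'b \<Rightarrow> complex"
  assumes [measurable]: "f \<in> borel_measurable M" "g \<in> borel_measurable M" and \<eta>: "0 < \<eta>"
  shows "(\<integral>\<^sup>+x. ennreal ((norm (f x + g x))\<^sup>2) \<partial>M)
    \<le> ennreal (1 + \<eta>) * (\<integral>\<^sup>+x. ennreal ((norm (f x))\<^sup>2) \<partial>M) + ennreal (1 + 1 / \<eta>) * (\<integral>\<^sup>+x. ennreal ((norm (g x))\<^sup>2) \<partial>M)"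
proof -
  have "(\<integral>\<^sup>+x. ennreal ((norm (f x + g x))\<^sup>2) \<partial>M)
    \<le> (\<integral>\<^sup>+x. ennreal (1 + \<eta>) * ennreal ((norm (f x))\<^sup>2) + ennreal (1 + 1 / \<eta>) * ennreal ((norm (g x))\<^sup>2) \<partial>M)"
    using \<eta> norm_add_square_le[OF \<eta>]
    by (intro nn_integral_mono) (simp flip: ennreal_mult ennreal_plus)
  also have "\<dots> = ennreal (1 + \<eta>) * (\<integral>\<^sup>+x. ennreal ((norm (f x))\<^sup>2) \<partial>M) + ennreal (1 + 1 / \<eta>) * (\<integral>\<^sup>+x. ennreal ((norm (g x))\<^sup>2) \<partial>M)"
    by (simp add: nn_integral_add nn_integral_cmult)
  finally show ?thesis .
qed

text \<open>A measurable function is almost everywhere a pointwise limit of continuous functions; cutting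
  those off in value and in support makes dominated convergence applicable.\<close>

lemma tame_dense_bounded_support:
  fixes F :: "'a::euclidean_space \<Rightarrow> complex"
  assumes F[measurable]: "F \<in> borel_measurable borel" and M: "0 < M" "\<And>t. norm (F t) \<le> M"
    and supp: "\<And>t. r < norm t \<Longrightarrow> F t = 0" and e: "0 < e"
  obtains h where "h \<in> tame" "(\<integral>\<^sup>+t. ennreal ((norm (F t - h t))\<^sup>2) \<partial>lborel) < e"
proof -
  have "F \<in> borel_measurable lebesgue" by (rule measurable_completion) simp
  then have "F measurable_on UNIV" by (intro lebesgue_measurable_imp_measurable_on) auto
  then obtain N g where N: "negligible N" and g: "\<And>n. continuous_on UNIV (g n)"
    and g_lim: "\<And>x. x \<notin> N \<Longrightarrow> (\<lambda>n. g n x) \<longlonglongrightarrow> F x"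
    unfolding measurable_on_def by auto
  \<comment> \<open>The continuous approximants of \<open>F\<close> may be unbounded: \<open>P\<close> retracts their values to the disc of radius \<open>M\<close>, and \<open>cut\<close> restores bounded support.\<close>
  define P where "P z = (M / max M (norm z)) *\<^sub>R z" for z :: complex
  define cut where "cut t = max 0 (min 1 (r + 1 - norm t))" for t :: 'a
  define c where "c n t = cut t *\<^sub>R P (g n t)" for n t
  have P_le: "norm (P z) \<le> M" for z
    using M(1) by (auto simp: P_def max_def field_simps intro: mult_left_mono)
  have P_cont: "continuous_on UNIV P"
    unfolding P_def using M(1) by (intro continuous_intros) auto
  have cut: "0 \<le> cut t" "cut t \<le> 1" for t by (auto simp: cut_def)
  have c_cont: "continuous_on UNIV (c n)" for n
    unfolding c_def cut_def
    by (intro continuous_intros g continuous_on_compose2[OF P_cont g]) auto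
  have [measurable]: "c n \<in> borel_measurable borel" for n
    using c_cont by (rule borel_measurable_continuous_onI)
  have c_le: "norm (c n t) \<le> M * indicator (cball 0 (r + 1)) t" for n t
  proof (cases "t \<in> cball 0 (r + 1)")
    case True
    have "norm (c n t) \<le> 1 * M"
      unfolding c_def norm_scaleR using cut[of t] P_le by (intro mult_mono) auto
    then show ?thesis using True by simp
  qed (auto simp: c_def cut_def)
  have [measurable]: "cball (0::'a) (r + 1) \<in> sets borel" by simp
  have ind: "integrable lborel (\<lambda>t::'a. M * indicator (cball 0 (r + 1)) t :: real)"
    using emeasure_bounded_finite[OF bounded_cball, of "0::'a" "r + 1"]
    by (intro integrable_mult_right integrable_real_indicator) auto
  have c_tame: "c n \<in> tame" for n
  proof -
    have "integrable lborel (c n)"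
      by (rule Bochner_Integration.integrable_bound[OF ind]) (use c_le[of n] M in \<open>auto intro!: AE_I2\<close>)
    moreover have "bounded (range (c n))"
      using c_le[of n] M(1) by (intro boundedI[of _ M]) (fastforce simp: indicator_def split: if_splits intro: order_trans)
    ultimately show ?thesis using c_cont by (simp add: tame_def)
  qed
  have "(\<lambda>n. \<integral>\<^sup>+t. ennreal ((norm (F t - c n t))\<^sup>2) \<partial>lborel) \<longlonglongrightarrow> (\<integral>\<^sup>+t. 0 \<partial>(lborel :: 'a measure))"
  proof (rule nn_integral_dominated_convergence[where w="\<lambda>t. ennreal ((2 * M)\<^sup>2 * indicator (cball 0 (r + 1)) t)"])
    have "integrable lborel (\<lambda>t::'a. (2 * M)\<^sup>2 * indicator (cball 0 (r + 1)) t :: real)"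
      using emeasure_bounded_finite[OF bounded_cball, of "0::'a" "r + 1"]
      by (intro integrable_mult_right integrable_real_indicator) auto
    then show "(\<integral>\<^sup>+t. ennreal ((2 * M)\<^sup>2 * indicator (cball 0 (r + 1)) t) \<partial>(lborel :: 'a measure)) < \<infinity>"
      by (subst nn_integral_eq_integral) auto
    show "AE t in lborel. ennreal ((norm (F t - c n t))\<^sup>2) \<le> ennreal ((2 * M)\<^sup>2 * indicator (cball 0 (r + 1)) t)" for n
    proof (intro AE_I2 ennreal_leI)
      fix t
      show "(norm (F t - c n t))\<^sup>2 \<le> (2 * M)\<^sup>2 * indicator (cball 0 (r + 1)) t"
      proof (cases "t \<in> cball 0 (r + 1)")
        case True
        have "norm (F t - c n t) \<le> norm (F t) + norm (c n t)" by (rule norm_triangle_ineq4)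
        also have "\<dots> \<le> M + M" using M(2)[of t] c_le[of n t] True by (intro add_mono) auto
        finally have "(norm (F t - c n t))\<^sup>2 \<le> (2 * M)\<^sup>2" by (intro power_mono) auto
        then show ?thesis using True by simp
      next
        case False
        then show ?thesis using supp[of t] c_le[of n t] by auto
      qed
    qed
    have "AE t in lebesgue. t \<notin> N"
      using N by (simp add: negligible_iff_null_sets AE_not_in)
    then have "AE t in lborel. t \<notin> N" by (simp add: AE_completion_iff)
    then show "AE t in lborel. (\<lambda>n. ennreal ((norm (F t - c n t))\<^sup>2)) \<longlonglongrightarrow> 0"
    proof eventually_elim
      case (elim t)
      have "(\<lambda>n. P (g n t)) \<longlonglongrightarrow> P (F t)"
        using P_cont g_lim[OF elim] by (auto simp: continuous_on_eq_continuous_at intro: isCont_tendsto_compose)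
      then have "(\<lambda>n. c n t) \<longlonglongrightarrow> cut t *\<^sub>R P (F t)" unfolding c_def by (intro tendsto_intros)
      also have "P (F t) = F t" unfolding P_def using M(1) M(2)[of t] by (simp add: max_def)
      also have "cut t *\<^sub>R F t = F t" using supp[of t] by (cases "r < norm t") (auto simp: cut_def)
      finally have "(\<lambda>n. (norm (F t - c n t))\<^sup>2) \<longlonglongrightarrow> (norm (F t - F t))\<^sup>2" by (intro tendsto_intros)
      then have "(\<lambda>n. ennreal ((norm (F t - c n t))\<^sup>2)) \<longlonglongrightarrow> ennreal 0" by (intro tendsto_ennrealI) simp
      then show ?case by simp
    qed
  qed measurable
  then have "eventually (\<lambda>n. (\<integral>\<^sup>+t. ennreal ((norm (F t - c n t))\<^sup>2) \<partial>lborel) < e) sequentially"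
    using e by (intro order_tendstoD(2)) auto
  then obtain n where "(\<integral>\<^sup>+t. ennreal ((norm (F t - c n t))\<^sup>2) \<partial>lborel) < e"
    using eventually_happens'[OF sequentially_bot] by blast
  then show ?thesis by (rule that[OF c_tame])
qed

lemma tame_dense:
  fixes f :: "'a::euclidean_space \<Rightarrow> complex"
  assumes [measurable]: "f \<in> borel_measurable borel"
    and fin: "(\<integral>\<^sup>+t. ennreal ((norm (f t))\<^sup>2) \<partial>lborel) < \<infinity>" and e: "0 < e"
  obtains h where "h \<in> tame" "(\<integral>\<^sup>+t. ennreal ((norm (f t - h t))\<^sup>2) \<partial>lborel) < ennreal e"
proof -
  define F where "F n t = (if norm t \<le> real (Suc n) \<and> norm (f t) \<le> real (Suc n) then f t else 0)" for n t
  have [measurable]: "F n \<in> borel_measurable borel" for n unfolding F_def by measurable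
  have "(\<lambda>n. \<integral>\<^sup>+t. ennreal ((norm (f t - F n t))\<^sup>2) \<partial>lborel) \<longlonglongrightarrow> (\<integral>\<^sup>+t. 0 \<partial>(lborel :: 'a measure))"
  proof (rule nn_integral_dominated_convergence[OF _ _ _ _ fin])
    show "AE t in lborel. ennreal ((norm (f t - F n t))\<^sup>2) \<le> ennreal ((norm (f t))\<^sup>2)" for n
      by (intro AE_I2 ennreal_leI) (simp add: F_def)
    show "AE t in lborel. (\<lambda>n. ennreal ((norm (f t - F n t))\<^sup>2)) \<longlonglongrightarrow> 0"
    proof (intro AE_I2)
      fix t
      obtain k where k: "norm t + norm (f t) \<le> real k" using real_arch_simple by blast
      have "f t - F n t = 0" if "k \<le> n" for n
      proof -
        have "norm t + norm (f t) \<le> real (Suc n)" using k that by linarith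
        then have "norm t \<le> real (Suc n)" "norm (f t) \<le> real (Suc n)"
          using norm_ge_zero[of t] norm_ge_zero[of "f t"] by linarith+
        then show ?thesis by (simp add: F_def)
      qed
      then have "eventually (\<lambda>n. ennreal ((norm (f t - F n t))\<^sup>2) = 0) sequentially"
        unfolding eventually_sequentially by (intro exI[of _ k]) simp
      then show "(\<lambda>n. ennreal ((norm (f t - F n t))\<^sup>2)) \<longlonglongrightarrow> 0" by (rule tendsto_eventually)
    qed
  qed measurable
  then have "eventually (\<lambda>n. (\<integral>\<^sup>+t. ennreal ((norm (f t - F n t))\<^sup>2) \<partial>lborel) < ennreal (e / 8)) sequentially"
    using e by (intro order_tendstoD(2)) auto
  then obtain n where n: "(\<integral>\<^sup>+t. ennreal ((norm (f t - F n t))\<^sup>2) \<partial>lborel) < ennreal (e / 8)"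
    using eventually_happens'[OF sequentially_bot] by blast
  obtain h where h: "h \<in> tame" "(\<integral>\<^sup>+t. ennreal ((norm (F n t - h t))\<^sup>2) \<partial>lborel) < ennreal (e / 8)"
  proof (rule tame_dense_bounded_support[of "F n" "real (Suc n)" "real (Suc n)" "ennreal (e / 8)"])
    show "norm (F n t) \<le> real (Suc n)" for t by (simp add: F_def)
    show "F n t = 0" if "real (Suc n) < norm t" for t using that by (simp add: F_def)
  qed (use e in simp_all)
  have [measurable]: "h \<in> borel_measurable borel" by (rule tameD(3)[OF h(1)])
  have "(\<integral>\<^sup>+t. ennreal ((norm (f t - h t))\<^sup>2) \<partial>lborel) = (\<integral>\<^sup>+t. ennreal ((norm ((f t - F n t) + (F n t - h t)))\<^sup>2) \<partial>lborel)"
    by simp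
  also have "\<dots> \<le> ennreal (1 + 1) * (\<integral>\<^sup>+t. ennreal ((norm (f t - F n t))\<^sup>2) \<partial>lborel)
      + ennreal (1 + 1 / 1) * (\<integral>\<^sup>+t. ennreal ((norm (F n t - h t))\<^sup>2) \<partial>lborel)"
    by (rule nn_integral_norm_add_square_le) auto
  also have "\<dots> \<le> ennreal (1 + 1) * ennreal (e / 8) + ennreal (1 + 1 / 1) * ennreal (e / 8)"
    using n h(2) by (intro add_mono mult_left_mono) auto
  also have "\<dots> = ennreal ((1 + 1) * (e / 8) + (1 + 1 / 1) * (e / 8))"
  proof -
    have m: "ennreal (1 + 1) * ennreal (e / 8) = ennreal ((1 + 1) * (e / 8))"
      "ennreal (1 + 1 / 1) * ennreal (e / 8) = ennreal ((1 + 1 / 1) * (e / 8))"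
      by (rule ennreal_mult[symmetric]; use e in simp)+
    show ?thesis unfolding m by (rule ennreal_plus[symmetric]) (use e in auto)
  qed
  also have "\<dots> = ennreal (e / 2)" by simp
  also have "\<dots> < ennreal e" using e by (simp add: ennreal_lessI)
  finally show ?thesis by (rule that[OF h(1)])
qed

section \<open>Frame energy of translates\<close>

lemma L2_norm_sq_lborel: "L2_norm_sq f = (\<integral>\<^sup>+t. ennreal ((norm (f t))\<^sup>2) \<partial>lborel)"
  unfolding L2_norm_sq_def by (rule nn_integral_completion)

lemma nn_integral_lborel_shift:
  fixes f :: "'a::euclidean_space \<Rightarrow> ennreal"
  assumes "f \<in> borel_measurable borel"
  shows "(\<integral>\<^sup>+t. f (x + t) \<partial>lborel) = (\<integral>\<^sup>+t. f t \<partial>lborel)"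
  using nn_integral_lborel_scale[OF assms, of 1 x] by simp

lemma L2_norm_sq_shift:
  assumes [measurable]: "f \<in> borel_measurable borel"
  shows "L2_norm_sq (\<lambda>t. f (x + t)) = L2_norm_sq f"
  unfolding L2_norm_sq_lborel by (rule nn_integral_lborel_shift) measurable

lemma L2_norm_sq_add_le:
  assumes "f \<in> borel_measurable borel" "h \<in> borel_measurable borel" "0 < \<eta>"
  shows "L2_norm_sq (\<lambda>t. f t + h t) \<le> ennreal (1 + \<eta>) * L2_norm_sq f + ennreal (1 + 1 / \<eta>) * L2_norm_sq h"
  unfolding L2_norm_sq_lborel using assms by (intro nn_integral_norm_add_square_le) auto

lemma corr_shift: "corr (\<lambda>t. f (x + t)) h y = corr f h (x + y)"
  unfolding corr_def
  using integral_lborel_shift(1)[of "\<lambda>t. f t * cnj (h (t - (x + y)))" x] by simp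

lemma square_integrable_mult:
  fixes f h :: "'a::euclidean_space \<Rightarrow> complex"
  assumes [measurable]: "f \<in> borel_measurable borel" "h \<in> borel_measurable borel"
    and fin: "(\<integral>\<^sup>+t. ennreal ((norm (f t))\<^sup>2) \<partial>lborel) < \<infinity>" "(\<integral>\<^sup>+t. ennreal ((norm (h t))\<^sup>2) \<partial>lborel) < \<infinity>"
  shows "integrable lborel (\<lambda>t. f t * cnj (h (t - y)))"
proof -
  have "(\<integral>\<^sup>+t. ennreal ((norm (h (t - y)))\<^sup>2) \<partial>lborel) = (\<integral>\<^sup>+t. ennreal ((norm (h t))\<^sup>2) \<partial>lborel)"
    using nn_integral_lborel_shift[of "\<lambda>t. ennreal ((norm (h t))\<^sup>2)" "- y"] by simp
  then have "integrable lborel (\<lambda>t. (norm (f t))\<^sup>2)" "integrable lborel (\<lambda>t. (norm (h (t - y)))\<^sup>2)"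
    using fin by (auto simp: integrable_iff_bounded)
  then have "integrable lborel (\<lambda>t. (norm (f t))\<^sup>2 + (norm (h (t - y)))\<^sup>2)" by (rule Bochner_Integration.integrable_add)
  then show ?thesis
  proof (rule Bochner_Integration.integrable_bound)
    show "AE t in lborel. norm (f t * cnj (h (t - y))) \<le> norm ((norm (f t))\<^sup>2 + (norm (h (t - y)))\<^sup>2)"
    proof (intro AE_I2)
      fix t
      have "0 \<le> (norm (f t) - norm (h (t - y)))\<^sup>2" by simp
      then have "2 * (norm (f t) * norm (h (t - y))) \<le> (norm (f t))\<^sup>2 + (norm (h (t - y)))\<^sup>2"
        by (simp add: power2_diff)
      moreover have "0 \<le> norm (f t) * norm (h (t - y))" by simp
      ultimately have "norm (f t) * norm (h (t - y)) \<le> (norm (f t))\<^sup>2 + (norm (h (t - y)))\<^sup>2"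
        by linarith
      then show "norm (f t * cnj (h (t - y))) \<le> norm ((norm (f t))\<^sup>2 + (norm (h (t - y)))\<^sup>2)"
        by (simp add: norm_mult)
    qed
  qed measurable
qed

lemma corr_self: "(LINT t|lborel. (norm (f t))\<^sup>2) = Re (corr f f 0)"
proof -
  have "corr f f 0 = (LINT t|lborel. complex_of_real ((norm (f t))\<^sup>2))"
    unfolding corr_def by (simp only: complex_norm_square diff_zero)
  then show ?thesis by (simp only: integral_complex_of_real Re_complex_of_real)
qed

lemma tame_L2_norm_sq:
  assumes f: "f \<in> tame"
  shows "L2_norm_sq f = ennreal (Re (corr f f 0))" "0 \<le> Re (corr f f 0)"
proof -
  have r: "(LINT t|lborel. (norm (f t))\<^sup>2) = Re (corr f f 0)" by (rule corr_self)
  show "L2_norm_sq f = ennreal (Re (corr f f 0))"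
    unfolding L2_norm_sq_lborel r[symmetric]
    by (rule nn_integral_eq_integral) (auto simp: tame_square_integrable[OF f])
  show "0 \<le> Re (corr f f 0)" unfolding r[symmetric] by simp
qed

text \<open>Expanding the square expresses the \<open>L\<^sup>2\<close> modulus of continuity through the autocorrelation,
  whose continuity is known.\<close>

lemma tame_shift_diff:
  assumes f: "f \<in> tame"
  shows "L2_norm_sq (\<lambda>t. f (x + t) - f t) = ennreal (2 * (Re (corr f f 0) - Re (corr f f x)))"
proof -
  have [measurable]: "f \<in> borel_measurable borel" by (rule tameD(3)[OF f])
  have i1: "integrable lborel (\<lambda>t. (norm (f t))\<^sup>2)" by (rule tame_square_integrable(2)[OF f])
  have i2: "integrable lborel (\<lambda>t. (norm (f (x + t)))\<^sup>2)"
    using integral_lborel_shift(2)[of "\<lambda>t. complex_of_real ((norm (f t))\<^sup>2)" x] i1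
    unfolding complex_of_real_integrable_eq by simp
  have e2: "(LINT t|lborel. (norm (f (x + t)))\<^sup>2) = (LINT t|lborel. (norm (f t))\<^sup>2)"
    using integral_lborel_shift(1)[of "\<lambda>t. complex_of_real ((norm (f t))\<^sup>2)" x]
    unfolding integral_complex_of_real of_real_eq_iff .
  have i3: "integrable lborel (\<lambda>t. f (x + t) * cnj (f t))"
  proof -
    obtain M where M: "\<And>t. norm (f t) \<le> M" using tameD(5)[OF f] by blast
    have "integrable lborel (\<lambda>t. cnj (f t) * f (x + t))"
      by (rule integrable_mult_bounded[of _ _ _ M]) (use tameD(1)[OF f] M in auto)
    then show ?thesis by (simp add: mult.commute)
  qed
  have eq: "(norm (f (x + t) - f t))\<^sup>2 = (norm (f (x + t)))\<^sup>2 + (norm (f t))\<^sup>2 - 2 * Re (f (x + t) * cnj (f t))" for t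
    by (simp add: cmod_power2 power2_diff algebra_simps)
  have i5: "integrable lborel (\<lambda>t. 2 * Re (f (x + t) * cnj (f t)))"
    by (intro integrable_mult_right integrable_Re i3)
  have s: "(LINT t|lborel. 2 * Re (f (x + t) * cnj (f t))) = 2 * Re (LINT t|lborel. f (x + t) * cnj (f t))"
    by (simp only: integral_mult_right_zero integral_Re[OF i3])
  have i4: "integrable lborel (\<lambda>t. (norm (f (x + t) - f t))\<^sup>2)"
    unfolding eq by (intro Bochner_Integration.integrable_diff Bochner_Integration.integrable_add i1 i2 i5)
  have r: "(LINT t|lborel. (norm (f t))\<^sup>2) = Re (corr f f 0)" by (rule corr_self)
  have "(LINT t|lborel. (norm (f (x + t) - f t))\<^sup>2)
     = (LINT t|lborel. (norm (f (x + t)))\<^sup>2) + (LINT t|lborel. (norm (f t))\<^sup>2) - 2 * Re (LINT t|lborel. f (x + t) * cnj (f t))"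
    unfolding eq
    by (simp only: Bochner_Integration.integral_diff[OF Bochner_Integration.integrable_add[OF i2 i1] i5]
        Bochner_Integration.integral_add[OF i2 i1] s)
  also have "\<dots> = 2 * (Re (corr f f 0) - Re (corr f f x))"
    unfolding e2 r corr_alt[of f f x] by simp
  finally show ?thesis
    unfolding L2_norm_sq_lborel using i4 by (subst nn_integral_eq_integral) auto
qed

lemma tame_shift_small:
  assumes f: "f \<in> tame" and e: "0 < e"
  obtains r where "0 < r" "\<And>x. norm x < r \<Longrightarrow> L2_norm_sq (\<lambda>t. f (x + t) - f t) \<le> ennreal e"
proof -
  have "corr f f \<in> tame" by (rule corr_tame(1)[OF f tameD(1)[OF f]])
  then have "isCont (corr f f) 0" by (rule tameD(2))
  then have "isCont (\<lambda>x. Re (corr f f x)) 0" by (rule continuous_Re)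
  then have "\<exists>r>0. \<forall>x. norm (x - 0) < r \<longrightarrow> norm (Re (corr f f x) - Re (corr f f 0)) < e / 2"
    unfolding continuous_at_eps_delta dist_norm using half_gt_zero[OF e] by blast
  then obtain r where r: "0 < r" "\<And>x. norm (x - 0) < r \<Longrightarrow> norm (Re (corr f f x) - Re (corr f f 0)) < e / 2"
    by blast
  show ?thesis
  proof (rule that[OF r(1)])
    fix x :: "real ^ 'a" assume "norm x < r"
    then have "norm (Re (corr f f x) - Re (corr f f 0)) < e / 2" using r(2)[of x] by simp
    moreover have "Re (corr f f 0) - Re (corr f f x) \<le> norm (Re (corr f f x) - Re (corr f f 0))"
      by (simp add: abs_if)
    ultimately have q: "Re (corr f f 0) - Re (corr f f x) < e / 2" by (rule le_less_trans[rotated])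
    have "2 * (Re (corr f f 0) - Re (corr f f x)) \<le> 2 * (e / 2)"
      using q by (intro mult_left_mono) auto
    then have "2 * (Re (corr f f 0) - Re (corr f f x)) \<le> e" by simp
    then show "L2_norm_sq (\<lambda>t. f (x + t) - f t) \<le> ennreal e"
      unfolding tame_shift_diff[OF f] by (rule ennreal_leI)
  qed
qed

locale generators =
  fixes K :: "'k set" and g :: "'k \<Rightarrow> real ^ 'm \<Rightarrow> complex"
  assumes K_countable: "countable K"
    and g_integrable: "\<And>k. k \<in> K \<Longrightarrow> integrable lborel (g k)"
    and g_square_integrable: "\<And>k. k \<in> K \<Longrightarrow> L2_norm_sq (g k) < \<infinity>"
begin

lemma g_measurable: "k \<in> K \<Longrightarrow> g k \<in> borel_measurable borel"
  using g_integrable[of k] by simp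

definition local_energy :: "(real ^ 'm \<Rightarrow> complex) \<Rightarrow> real ^ 'm \<Rightarrow> ennreal" where
  "local_energy f y = (\<integral>\<^sup>+k. ennreal ((norm (corr f (g k) y))\<^sup>2) \<partial>count_space K)"

text \<open>The frame sum, with the sum over the translations outermost so that it becomes a sum of values
  of one function over \<open>\<Lambda>\<close>.\<close>

definition energy :: "(real ^ 'm) set \<Rightarrow> (real ^ 'm \<Rightarrow> complex) \<Rightarrow> ennreal" where
  "energy \<Lambda> f = (\<integral>\<^sup>+l. local_energy f l \<partial>count_space \<Lambda>)"

text \<open>Translating \<open>f\<close> shifts the points at which \<open>local_energy f\<close> is sampled.\<close>

lemma energy_shift: "energy \<Lambda> (\<lambda>t. f (x + t)) = (\<integral>\<^sup>+l. local_energy f (l + x) \<partial>count_space \<Lambda>)"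
  unfolding energy_def local_energy_def corr_shift by (simp only: add.commute[of x])

lemma local_energy_measurable [measurable]:
  assumes "f \<in> tame"
  shows "local_energy f \<in> borel_measurable borel"
proof -
  have "corr f (g k) \<in> borel_measurable borel" if "k \<in> K" for k
    using tameD(3)[OF corr_tame(1)[OF assms g_integrable[OF that]]] .
  then show ?thesis unfolding local_energy_def[abs_def]
    by (intro borel_measurable_nn_integral_count_space K_countable) measurable
qed

lemma energy_add_le:
  assumes f: "f \<in> borel_measurable borel" "L2_norm_sq f < \<infinity>"
    and h: "h \<in> borel_measurable borel" "L2_norm_sq h < \<infinity>" and \<eta>: "0 < \<eta>"
  shows "energy \<Lambda> (\<lambda>t. f t + h t) \<le> ennreal (1 + \<eta>) * energy \<Lambda> f + ennreal (1 + 1 / \<eta>) * energy \<Lambda> h"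
proof -
  have c: "corr (\<lambda>t. f t + h t) (g k) y = corr f (g k) y + corr h (g k) y" if "k \<in> K" for k y
  proof -
    have "integrable lborel (\<lambda>t. f t * cnj (g k (t - y)))" "integrable lborel (\<lambda>t. h t * cnj (g k (t - y)))"
      using f h g_square_integrable[OF that] g_integrable[OF that]
      by (auto intro!: square_integrable_mult simp: L2_norm_sq_lborel)
    then show ?thesis unfolding corr_def by (simp add: distrib_right)
  qed
  have p: "local_energy (\<lambda>t. f t + h t) y \<le> ennreal (1 + \<eta>) * local_energy f y + ennreal (1 + 1 / \<eta>) * local_energy h y" for y
  proof -
    have "local_energy (\<lambda>t. f t + h t) y = (\<integral>\<^sup>+k. ennreal ((norm (corr f (g k) y + corr h (g k) y))\<^sup>2) \<partial>count_space K)"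
      unfolding local_energy_def by (rule nn_integral_cong) (simp add: c)
    also have "\<dots> \<le> ennreal (1 + \<eta>) * local_energy f y + ennreal (1 + 1 / \<eta>) * local_energy h y"
      unfolding local_energy_def by (rule nn_integral_norm_add_square_le[OF _ _ \<eta>]) auto
    finally show ?thesis .
  qed
  have "energy \<Lambda> (\<lambda>t. f t + h t) \<le> (\<integral>\<^sup>+l. ennreal (1 + \<eta>) * local_energy f l + ennreal (1 + 1 / \<eta>) * local_energy h l \<partial>count_space \<Lambda>)"
    unfolding energy_def by (rule nn_integral_mono) (rule p)
  also have "\<dots> = ennreal (1 + \<eta>) * energy \<Lambda> f + ennreal (1 + 1 / \<eta>) * energy \<Lambda> h"
    unfolding energy_def by (simp add: nn_integral_add nn_integral_cmult)
  finally show ?thesis .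
qed

definition weight :: "real ^ 'm \<Rightarrow> ennreal" where
  "weight w = (\<integral>\<^sup>+k. ennreal ((norm (ft (g k) w))\<^sup>2) \<partial>count_space K)"

lemma weight_measurable [measurable]: "weight \<in> borel_measurable borel"
proof -
  have "ft (g k) \<in> borel_measurable borel" if "k \<in> K" for k
    using g_integrable[OF that] by (intro ft_measurable) simp
  moreover note g_measurable [measurable]
  ultimately show ?thesis unfolding weight_def[abs_def]
    by (intro borel_measurable_nn_integral_count_space K_countable) measurable
qed

lemma integral_local_energy:
  assumes f: "f \<in> tame"
  shows "(\<integral>\<^sup>+y. local_energy f y \<partial>lborel) = (\<integral>\<^sup>+w. ennreal ((norm (ft f w))\<^sup>2) * weight w \<partial>lborel)"
proof -
  have [measurable]: "f \<in> borel_measurable borel" by (rule tameD(3)[OF f])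
  note g_measurable [measurable]
  have m: "corr f (g k) \<in> borel_measurable borel" "ft (g k) \<in> borel_measurable borel" if "k \<in> K" for k
    using tameD(3)[OF corr_tame(1)[OF f g_integrable[OF that]]] g_integrable[OF that]
    by (auto intro!: ft_measurable)
  have "(\<integral>\<^sup>+y. local_energy f y \<partial>lborel) = (\<integral>\<^sup>+k. \<integral>\<^sup>+y. ennreal ((norm (corr f (g k) y))\<^sup>2) \<partial>lborel \<partial>count_space K)"
    unfolding local_energy_def using m by (intro nn_integral_count_space_nn_integral K_countable) measurable
  also have "\<dots> = (\<integral>\<^sup>+k. \<integral>\<^sup>+w. ennreal ((norm (ft f w))\<^sup>2) * ennreal ((norm (ft (g k) w))\<^sup>2) \<partial>lborel \<partial>count_space K)"
    by (rule nn_integral_cong) (simp add: corr_plancherel[OF f g_integrable])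
  also have "\<dots> = (\<integral>\<^sup>+w. \<integral>\<^sup>+k. ennreal ((norm (ft f w))\<^sup>2) * ennreal ((norm (ft (g k) w))\<^sup>2) \<partial>count_space K \<partial>lborel)"
    using m by (intro nn_integral_count_space_nn_integral[symmetric] K_countable) measurable
  also have "\<dots> = (\<integral>\<^sup>+w. ennreal ((norm (ft f w))\<^sup>2) * weight w \<partial>lborel)"
    unfolding weight_def by (simp add: nn_integral_cmult)
  finally show ?thesis .
qed

end

lemma model_set_mono: "\<Omega> \<subseteq> \<Omega>' \<Longrightarrow> model_set \<Gamma> \<Omega> \<subseteq> model_set \<Gamma> \<Omega>'"
  unfolding model_set_def by blast

context generators
begin

text \<open>For a tight frame the energy does not change when \<open>f\<close> is translated, so it equals its own mean,
  which the averaging lemmas identify with a spectral integral.\<close>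

lemma tight_imp_weight_eq_1:
  assumes av: "averaging_set \<Lambda> D C" and D: "0 < D"
    and tight: "\<And>f. f \<in> borel_measurable borel \<Longrightarrow> L2_norm_sq f < \<infinity> \<Longrightarrow> energy \<Lambda> f = L2_norm_sq f"
  shows "AE w in lborel. ennreal D * weight w = 1"
proof (rule weight_eq_1)
  interpret averaging_set \<Lambda> D C by (rule av)
  show "(\<lambda>w. ennreal D * weight w) \<in> borel_measurable borel" by measurable
  fix s :: real and \<xi> :: "real ^ 'm" assume s: "0 < s"
  define f where "f = (\<lambda>t. complex_of_real ((1 / s) ^ DIM(real ^ 'm) * gauss ((1 / s) *\<^sub>R t)) * cis (2 * pi * (t \<bullet> \<xi>)))"
  have f: "f \<in> tame" and ftf: "ft f w = complex_of_real (gauss (s *\<^sub>R (w - \<xi>)))" for w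
    using modulated_gauss[of "1 / s" \<xi>] s unfolding f_def by auto
  have [measurable]: "f \<in> borel_measurable borel" by (rule tameD(3)[OF f])
  have fin: "L2_norm_sq f < \<infinity>" unfolding tame_L2_norm_sq(1)[OF f] by simp
  have F: "(\<integral>\<^sup>+l. local_energy f (l + x) \<partial>count_space \<Lambda>) = L2_norm_sq f" for x
    using tight[of "\<lambda>t. f (x + t)"] fin by (simp add: energy_shift L2_norm_sq_shift)
  have p [measurable]: "local_energy f \<in> borel_measurable borel" by (rule local_energy_measurable[OF f])
  have const: "mean (real (Suc n)) (\<lambda>x. \<integral>\<^sup>+l. local_energy f (l + x) \<partial>count_space \<Lambda>) = L2_norm_sq f" for n
    unfolding F by (rule mean_const) simp
  have "ennreal D * (\<integral>\<^sup>+y. local_energy f y \<partial>lborel) \<le> liminf (\<lambda>n. L2_norm_sq f)"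
    using mean_liminf[OF p] unfolding const .
  also have "\<dots> = L2_norm_sq f" by (rule Liminf_const) simp
  finally have "ennreal D * (\<integral>\<^sup>+y. local_energy f y \<partial>lborel) < \<infinity>" using fin by (rule le_less_trans)
  then have "(\<integral>\<^sup>+y. local_energy f y \<partial>lborel) < \<infinity>" using D by (auto simp: ennreal_mult_less_top)
  from mean_tendsto[OF p this] have "(\<lambda>n. L2_norm_sq f) \<longlonglongrightarrow> ennreal D * (\<integral>\<^sup>+y. local_energy f y \<partial>lborel)"
    unfolding const .
  then have "ennreal D * (\<integral>\<^sup>+y. local_energy f y \<partial>lborel) = L2_norm_sq f" by (simp add: LIMSEQ_const_iff)
  also have "\<dots> = (\<integral>\<^sup>+w. ennreal ((norm (ft f w))\<^sup>2) \<partial>lborel)"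
    unfolding L2_norm_sq_lborel by (rule plancherel[OF f, symmetric])
  also have "\<dots> = (\<integral>\<^sup>+w. ennreal ((gauss (s *\<^sub>R (w - \<xi>)))\<^sup>2) \<partial>lborel)"
    unfolding ftf by simp
  also have "ennreal D * (\<integral>\<^sup>+y. local_energy f y \<partial>lborel)
      = (\<integral>\<^sup>+w. ennreal D * (ennreal ((gauss (s *\<^sub>R (w - \<xi>)))\<^sup>2) * weight w) \<partial>lborel)"
    unfolding integral_local_energy[OF f] ftf by (subst nn_integral_cmult) auto
  finally show "(\<integral>\<^sup>+w. ennreal ((gauss (s *\<^sub>R (w - \<xi>)))\<^sup>2) * (ennreal D * weight w) \<partial>lborel)
          = (\<integral>\<^sup>+w. ennreal ((gauss (s *\<^sub>R (w - \<xi>)))\<^sup>2) \<partial>lborel)"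
    by (simp add: mult.left_commute)
qed

text \<open>Translation by a lattice vector carries a model set to the one with a shifted window.\<close>

lemma energy_model_set_shift:
  assumes \<Gamma>: "cut_and_project_lattice \<Gamma>" and \<gamma>: "\<gamma> \<in> \<Gamma>"
  shows "energy (model_set \<Gamma> {\<alpha>..\<beta>}) (\<lambda>t. f (fst \<gamma> + t))
    = energy (model_set \<Gamma> {\<alpha> + snd \<gamma>..\<beta> + snd \<gamma>}) f"
proof -
  have lat: "is_lattice \<Gamma>" using \<Gamma> by (simp add: cut_and_project_lattice_def)
  have "bij_betw (\<lambda>l. l + fst \<gamma>) (model_set \<Gamma> {\<alpha>..\<beta>}) (model_set \<Gamma> {\<alpha> + snd \<gamma>..\<beta> + snd \<gamma>})"
  proof (rule bij_betwI[where g = "\<lambda>l. l - fst \<gamma>"])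
    show "(\<lambda>l. l + fst \<gamma>) \<in> model_set \<Gamma> {\<alpha>..\<beta>} \<rightarrow> model_set \<Gamma> {\<alpha> + snd \<gamma>..\<beta> + snd \<gamma>}"
    proof
      fix l assume "l \<in> model_set \<Gamma> {\<alpha>..\<beta>}"
      then obtain \<gamma>' where "\<gamma>' \<in> \<Gamma>" "snd \<gamma>' \<in> {\<alpha>..\<beta>}" "l = fst \<gamma>'" by (auto simp: model_set_def)
      then show "l + fst \<gamma> \<in> model_set \<Gamma> {\<alpha> + snd \<gamma>..\<beta> + snd \<gamma>}"
        unfolding model_set_def using lattice_add_diff(1)[OF lat _ \<gamma>, of \<gamma>']
        by (intro CollectI exI[of _ "\<gamma>' + \<gamma>"]) auto
    qed
    show "(\<lambda>l. l - fst \<gamma>) \<in> model_set \<Gamma> {\<alpha> + snd \<gamma>..\<beta> + snd \<gamma>} \<rightarrow> model_set \<Gamma> {\<alpha>..\<beta>}"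
    proof
      fix l assume "l \<in> model_set \<Gamma> {\<alpha> + snd \<gamma>..\<beta> + snd \<gamma>}"
      then obtain \<gamma>' where "\<gamma>' \<in> \<Gamma>" "snd \<gamma>' \<in> {\<alpha> + snd \<gamma>..\<beta> + snd \<gamma>}" "l = fst \<gamma>'" by (auto simp: model_set_def)
      then show "l - fst \<gamma> \<in> model_set \<Gamma> {\<alpha>..\<beta>}"
        unfolding model_set_def using lattice_add_diff(2)[OF lat _ \<gamma>, of \<gamma>']
        by (intro CollectI exI[of _ "\<gamma>' - \<gamma>"]) auto
    qed
  qed auto
  from nn_integral_bij_count_space[OF this, of "local_energy f"] show ?thesis
    unfolding energy_shift by (simp add: energy_def)
qed

lemma energy_indicator:
  "energy \<Lambda> f = (\<integral>\<^sup>+l. local_energy f l * indicator \<Lambda> l \<partial>count_space UNIV)"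
  unfolding energy_def by (rule nn_integral_count_space_indicator) (simp add: NO_MATCH_def)

lemma energy_mono: "\<Lambda> \<subseteq> \<Lambda>' \<Longrightarrow> energy \<Lambda> f \<le> energy \<Lambda>' f"
  unfolding energy_indicator by (intro nn_integral_mono) (auto simp: indicator_def)

lemma energy_Un_le: "energy (\<Lambda> \<union> \<Lambda>') f \<le> energy \<Lambda> f + energy \<Lambda>' f"
  unfolding energy_indicator
  by (subst nn_integral_add[symmetric]) (auto intro!: nn_integral_mono simp: indicator_def)

text \<open>Moving a closed window by a small amount can only add points whose second component lies just
  outside the window. The energy of the points in a slightly larger window is finite, and these
  thin collars decrease to the empty set, so the added energy tends to zero.\<close>

lemma energy_almost_period:
  assumes \<Gamma>: "cut_and_project_lattice \<Gamma>" and a: "0 < a" and f: "f \<in> borel_measurable borel" "L2_norm_sq f < \<infinity>"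
    and bessel: "\<And>f. f \<in> borel_measurable borel \<Longrightarrow> L2_norm_sq f < \<infinity> \<Longrightarrow> energy (model_set \<Gamma> {-a..a}) f \<le> L2_norm_sq f"
    and \<delta>: "0 < \<delta>"
  obtains \<epsilon> where "0 < \<epsilon>" "\<And>\<gamma>. \<gamma> \<in> \<Gamma> \<Longrightarrow> \<bar>snd \<gamma>\<bar> \<le> \<epsilon> \<Longrightarrow>
     energy (model_set \<Gamma> {-a..a}) (\<lambda>t. f (fst \<gamma> + t)) \<le> energy (model_set \<Gamma> {-a..a}) f + ennreal \<delta>"
proof -
  have lat: "is_lattice \<Gamma>" and inj: "inj_on fst \<Gamma>" using \<Gamma> by (auto simp: cut_and_project_lattice_def)
  note [measurable] = f(1)
  obtain \<gamma>\<^sub>0 where \<gamma>\<^sub>0: "\<gamma>\<^sub>0 \<in> \<Gamma>" "0 < snd \<gamma>\<^sub>0" "snd \<gamma>\<^sub>0 < a"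
    using lattice_snd_in_interval[OF \<Gamma> a] by blast
  define t where "t = snd \<gamma>\<^sub>0"
  have t: "0 < t" "t < a" using \<gamma>\<^sub>0 by (auto simp: t_def)
  have b: "energy (model_set \<Gamma> {-a + snd \<gamma>..a + snd \<gamma>}) f \<le> L2_norm_sq f" if "\<gamma> \<in> \<Gamma>" for \<gamma>
    unfolding energy_model_set_shift[OF \<Gamma> that, symmetric]
    using bessel[of "\<lambda>t. f (fst \<gamma> + t)"] f by (simp add: L2_norm_sq_shift)
  \<comment> \<open>The enlarged window is covered by two lattice translates of the original one, so the Bessel bound makes the energy over it finite.\<close>
  define W where "W = model_set \<Gamma> {-a - t..a + t}"
  have "W \<subseteq> model_set \<Gamma> {-a + snd \<gamma>\<^sub>0..a + snd \<gamma>\<^sub>0} \<union> model_set \<Gamma> {-a + snd (-\<gamma>\<^sub>0)..a + snd (-\<gamma>\<^sub>0)}"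
  proof
    fix l assume "l \<in> W"
    then obtain \<gamma> where \<gamma>: "\<gamma> \<in> \<Gamma>" "l = fst \<gamma>" "-a - t \<le> snd \<gamma>" "snd \<gamma> \<le> a + t"
      by (auto simp: W_def model_set_def)
    then have "snd \<gamma> \<in> {-a + snd \<gamma>\<^sub>0..a + snd \<gamma>\<^sub>0} \<or> snd \<gamma> \<in> {-a + snd (-\<gamma>\<^sub>0)..a + snd (-\<gamma>\<^sub>0)}"
      using t by (cases "0 \<le> snd \<gamma>") (auto simp: t_def)
    with \<gamma>(1,2) show "l \<in> model_set \<Gamma> {-a + snd \<gamma>\<^sub>0..a + snd \<gamma>\<^sub>0} \<union> model_set \<Gamma> {-a + snd (-\<gamma>\<^sub>0)..a + snd (-\<gamma>\<^sub>0)}"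
      unfolding model_set_def by blast
  qed
  from order_trans[OF energy_mono[OF this] energy_Un_le]
  have "energy W f \<le> L2_norm_sq f + L2_norm_sq f"
    using add_mono[OF b[OF \<gamma>\<^sub>0(1)] b[OF lattice_uminus[OF lat \<gamma>\<^sub>0(1)]]] by (rule order_trans)
  also have "\<dots> < \<infinity>" using f(2) by simp
  finally have fin: "energy W f < \<infinity>" .
  \<comment> \<open>Points that can enter when the window moves by at most \<open>t / (n + 1)\<close>; a fixed lattice point belongs to \<open>A n\<close> for finitely many \<open>n\<close> only.\<close>
  define A where "A n = model_set \<Gamma> ({-a - t / real (Suc n)..a + t / real (Suc n)} - {-a..a})" for n
  have "(\<lambda>n. \<integral>\<^sup>+l. local_energy f l * indicator (A n) l \<partial>count_space W) \<longlonglongrightarrow> (\<integral>\<^sup>+l. 0 \<partial>count_space W)"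
  proof (rule nn_integral_dominated_convergence[where w = "local_energy f"])
    show "(\<integral>\<^sup>+l. local_energy f l \<partial>count_space W) < \<infinity>" using fin by (simp add: energy_def)
    show "AE l in count_space W. local_energy f l * indicator (A n) l \<le> local_energy f l" for n
      by (auto simp: indicator_def)
    show "AE l in count_space W. (\<lambda>n. local_energy f l * indicator (A n) l) \<longlonglongrightarrow> 0"
    proof (rule AE_I2)
      fix l assume "l \<in> space (count_space W)"
      then obtain \<gamma> where \<gamma>: "\<gamma> \<in> \<Gamma>" "l = fst \<gamma>" by (auto simp: W_def model_set_def)
      have mem: "l \<in> A n \<longleftrightarrow> a < \<bar>snd \<gamma>\<bar> \<and> \<bar>snd \<gamma>\<bar> \<le> a + t / real (Suc n)" for n
      proof -
        have "l \<in> A n \<longleftrightarrow> snd \<gamma> \<in> {-a - t / real (Suc n)..a + t / real (Suc n)} - {-a..a}"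
          unfolding A_def model_set_def using \<gamma> inj_onD[OF inj] by blast
        then show ?thesis by auto
      qed
      have "eventually (\<lambda>n. l \<notin> A n) sequentially"
      proof (cases "a < \<bar>snd \<gamma>\<bar>")
        case True
        have "(\<lambda>n. a + t / real (Suc n)) \<longlonglongrightarrow> a + 0"
          by (intro tendsto_intros LIMSEQ_Suc lim_const_over_n)
        then have "eventually (\<lambda>n. a + t / real (Suc n) < \<bar>snd \<gamma>\<bar>) sequentially"
          using True by (intro order_tendstoD) auto
        then show ?thesis by eventually_elim (simp add: mem)
      qed (simp add: mem)
      then have "eventually (\<lambda>n. local_energy f l * indicator (A n) l = 0) sequentially"
        by eventually_elim simp
      then show "(\<lambda>n. local_energy f l * indicator (A n) l) \<longlonglongrightarrow> 0" by (rule tendsto_eventually)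
    qed
  qed auto
  then have "eventually (\<lambda>n. (\<integral>\<^sup>+l. local_energy f l * indicator (A n) l \<partial>count_space W) < ennreal \<delta>) sequentially"
    using \<delta> by (intro order_tendstoD) auto
  then obtain n where n: "(\<integral>\<^sup>+l. local_energy f l * indicator (A n) l \<partial>count_space W) < ennreal \<delta>"
    using eventually_happens'[OF sequentially_bot] by blast
  define \<epsilon> where "\<epsilon> = t / real (Suc n)"
  have \<epsilon>: "0 < \<epsilon>" "\<epsilon> \<le> t" using t by (auto simp: \<epsilon>_def field_simps)
  have "A n \<subseteq> W"
    unfolding A_def W_def \<epsilon>_def[symmetric] using \<epsilon> by (intro model_set_mono) auto
  then have "(\<integral>\<^sup>+l. local_energy f l * indicator (A n) l \<partial>count_space W) = energy (A n) f"
    unfolding energy_indicator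
    by (subst nn_integral_count_space_indicator) (auto intro!: nn_integral_cong simp: indicator_def)
  then have An: "energy (A n) f \<le> ennreal \<delta>" using n by simp
  show ?thesis
  proof (rule that[OF \<epsilon>(1)])
    fix \<gamma> assume \<gamma>: "\<gamma> \<in> \<Gamma>" "\<bar>snd \<gamma>\<bar> \<le> \<epsilon>"
    have "{-a + snd \<gamma>..a + snd \<gamma>} \<subseteq> {-a..a} \<union> ({-a - \<epsilon>..a + \<epsilon>} - {-a..a})"
      using \<gamma>(2) by auto
    then have "model_set \<Gamma> {-a + snd \<gamma>..a + snd \<gamma>} \<subseteq> model_set \<Gamma> {-a..a} \<union> A n"
      unfolding A_def \<epsilon>_def[symmetric] model_set_def by blast
    from order_trans[OF energy_mono[OF this] energy_Un_le]
    have "energy (model_set \<Gamma> {-a + snd \<gamma>..a + snd \<gamma>}) f \<le> energy (model_set \<Gamma> {-a..a}) f + energy (A n) f" .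
    also have "\<dots> \<le> energy (model_set \<Gamma> {-a..a}) f + ennreal \<delta>" using An by (intro add_left_mono)
    finally show "energy (model_set \<Gamma> {-a..a}) (\<lambda>t. f (fst \<gamma> + t)) \<le> energy (model_set \<Gamma> {-a..a}) f + ennreal \<delta>"
      unfolding energy_model_set_shift[OF \<Gamma> \<gamma>(1)] .
  qed
qed

end

lemma averaging_set_model_set:
  fixes \<Gamma> :: "((real ^ 'm) \<times> real) set"
  assumes \<Gamma>: "cut_and_project_lattice \<Gamma>" and a: "0 < a"
  obtains D C where "0 < D" "0 < C" "averaging_set (model_set \<Gamma> {-a..a}) D C"
proof -
  have lat: "is_lattice \<Gamma>" using \<Gamma> by (simp add: cut_and_project_lattice_def)
  have "countable \<Gamma>" by (rule lattice_fundamental_domain[OF lat])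
  moreover have "model_set \<Gamma> {-a..a} \<subseteq> fst ` \<Gamma>" unfolding model_set_def by blast
  ultimately have c: "countable (model_set \<Gamma> {-a..a})" by (meson countable_image countable_subset)
  obtain D C where D: "0 < D" "has_density (model_set \<Gamma> {-a..a}) D" "0 < C"
    and b: "\<And>x R. 1 \<le> R \<Longrightarrow> finite (model_set \<Gamma> {-a..a} \<inter> cube x R) \<and>
       real (card (model_set \<Gamma> {-a..a} \<inter> cube x R)) \<le> C * R ^ CARD('m)"
    by (rule model_set_density[OF assms]) blast
  show ?thesis
    by (rule that[OF D(1,3)]) (unfold_locales; use c D b in blast)
qed

context generators
begin

text \<open>If the energy of \<open>f\<close> fell short of its norm, it would do so by a fixed amount on a neighbourhood
  of every almost period, which lowers the mean of the energy below the norm.\<close>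

lemma bessel_weight_imp_tight_tame:
  assumes \<Gamma>: "cut_and_project_lattice \<Gamma>" and a: "0 < a"
    and av: "averaging_set (model_set \<Gamma> {-a..a}) D C" and D: "0 < D"
    and bessel: "\<And>f. f \<in> borel_measurable borel \<Longrightarrow> L2_norm_sq f < \<infinity> \<Longrightarrow> energy (model_set \<Gamma> {-a..a}) f \<le> L2_norm_sq f"
    and weight: "AE w in lborel. ennreal D * weight w = 1"
    and f: "f \<in> tame"
  shows "energy (model_set \<Gamma> {-a..a}) f = L2_norm_sq f"
proof (rule ccontr)
  interpret averaging_set "model_set \<Gamma> {-a..a}" D C by (rule av)
  let ?E = "energy (model_set \<Gamma> {-a..a})"
  assume neq: "?E f \<noteq> L2_norm_sq f"
  have lat: "is_lattice \<Gamma>" using \<Gamma> by (simp add: cut_and_project_lattice_def)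
  have fb [measurable]: "f \<in> borel_measurable borel" by (rule tameD(3)[OF f])
  define N where "N = Re (corr f f 0)"
  have N: "L2_norm_sq f = ennreal N" "0 \<le> N" using tame_L2_norm_sq[OF f] by (auto simp: N_def)
  have fin: "L2_norm_sq f < \<infinity>" by (simp add: N)
  have le: "?E f \<le> ennreal N" using bessel[OF fb fin] by (simp add: N)
  then obtain E\<^sub>0 where E\<^sub>0: "?E f = ennreal E\<^sub>0" "0 \<le> E\<^sub>0"
    by (cases "?E f") (auto simp: top_unique)
  have lt: "E\<^sub>0 < N" using le neq N E\<^sub>0 by (auto simp: ennreal_le_iff less_le)
  define \<delta> where "\<delta> = (N - E\<^sub>0) / 4"
  have \<delta>: "0 < \<delta>" using lt by (simp add: \<delta>_def)
  obtain \<epsilon> where \<epsilon>: "0 < \<epsilon>" "\<And>\<gamma>. \<gamma> \<in> \<Gamma> \<Longrightarrow> \<bar>snd \<gamma>\<bar> \<le> \<epsilon> \<Longrightarrow> ?E (\<lambda>t. f (fst \<gamma> + t)) \<le> ?E f + ennreal \<delta>"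
    using energy_almost_period[OF \<Gamma> a fb fin bessel \<delta>] by blast
  \<comment> \<open>The choice of \<open>\<eta>\<close> and \<open>\<kappa>\<close> makes the two error terms in \<open>energy_add_le\<close> equal to \<open>\<delta>\<close> each, which leaves a deficit \<open>\<delta>\<close> out of \<open>4 * \<delta>\<close>.\<close>
  define \<eta> where "\<eta> = \<delta> / (E\<^sub>0 + \<delta>)"
  have \<eta>: "0 < \<eta>" "\<eta> * (E\<^sub>0 + \<delta>) = \<delta>" using \<delta> E\<^sub>0 by (auto simp: \<eta>_def)
  define \<kappa> where "\<kappa> = \<delta> / (1 + 1 / \<eta>)"
  have "0 < 1 + 1 / \<eta>" using \<eta>(1) by (simp add: add_pos_pos)
  then have \<kappa>: "0 < \<kappa>" "(1 + 1 / \<eta>) * \<kappa> = \<delta>" using \<delta> by (auto simp: \<kappa>_def)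
  obtain r\<^sub>0 where r\<^sub>0: "0 < r\<^sub>0" "\<And>x. norm x < r\<^sub>0 \<Longrightarrow> L2_norm_sq (\<lambda>t. f (x + t) - f t) \<le> ennreal \<kappa>"
    by (rule tame_shift_small[OF f \<kappa>(1)]) blast
  define r where "r = min r\<^sub>0 (1 / 2)"
  have r: "0 < r" "r \<le> r\<^sub>0" "r \<le> 1 / 2" using r\<^sub>0 by (auto simp: r_def)
  \<comment> \<open>\<open>P\<close> is the set of almost periods; being a model set itself, it has positive density.\<close>
  define P where "P = model_set \<Gamma> {-\<epsilon>..\<epsilon>}"
  obtain D' C' where D': "0 < D'" "0 < C'" and av': "averaging_set P D' C'"
    unfolding P_def by (rule averaging_set_model_set[OF \<Gamma> \<epsilon>(1)])
  interpret P: averaging_set P D' C' by (rule av')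
  define F where "F x = ?E (\<lambda>t. f (x + t))" for x
  have F_le: "F x \<le> ennreal N" for x
    unfolding F_def using bessel[of "\<lambda>t. f (x + t)"] fin by (simp add: L2_norm_sq_shift N)
  \<comment> \<open>Near every almost period the energy stays below \<open>N\<close> by at least \<open>\<delta>\<close>.\<close>
  have deficit: "F (x + p) \<le> ennreal (N - \<delta>)" if p: "- p \<in> P" and x: "norm x < r" for x p
  proof -
    obtain \<gamma> where \<gamma>: "\<gamma> \<in> \<Gamma>" "- p = fst \<gamma>" "\<bar>snd \<gamma>\<bar> \<le> \<epsilon>" using p by (auto simp: P_def model_set_def)
    have p_eq: "p = fst (- \<gamma>)" using \<gamma>(2)[symmetric] by simp
    have Fp: "F p \<le> ennreal (E\<^sub>0 + \<delta>)"
      unfolding F_def p_eq using \<epsilon>(2)[OF lattice_uminus[OF lat \<gamma>(1)]] \<gamma>(3) E\<^sub>0 \<delta>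
      by (simp del: fst_uminus)
    define h where "h = (\<lambda>t. f (x + (p + t)) - f (p + t))"
    have [measurable]: "h \<in> borel_measurable borel" unfolding h_def by measurable
    have h: "L2_norm_sq h \<le> ennreal \<kappa>"
      using r\<^sub>0(2)[of x] x r(2) L2_norm_sq_shift[of "\<lambda>t. f (x + t) - f t" p] by (simp add: h_def)
    have h_fin: "L2_norm_sq h < \<infinity>" using h by (rule le_less_trans) simp
    have fp: "L2_norm_sq (\<lambda>t. f (p + t)) < \<infinity>" using fin by (simp add: L2_norm_sq_shift)
    have "F (x + p) = ?E (\<lambda>t. f (p + t) + h t)" by (simp add: F_def h_def add.assoc)
    also have "\<dots> \<le> ennreal (1 + \<eta>) * F p + ennreal (1 + 1 / \<eta>) * ?E h"
      unfolding F_def by (rule energy_add_le) (use \<eta> fp h_fin in auto)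
    also have "\<dots> \<le> ennreal (1 + \<eta>) * ennreal (E\<^sub>0 + \<delta>) + ennreal (1 + 1 / \<eta>) * ennreal \<kappa>"
      using Fp order_trans[OF bessel[OF _ h_fin] h] by (intro add_mono mult_left_mono) auto
    also have "\<dots> = ennreal ((1 + \<eta>) * (E\<^sub>0 + \<delta>) + (1 + 1 / \<eta>) * \<kappa>)"
      using \<eta> \<kappa> \<delta> E\<^sub>0 by (simp flip: ennreal_mult ennreal_plus)
    also have "(1 + \<eta>) * (E\<^sub>0 + \<delta>) + (1 + 1 / \<eta>) * \<kappa> = N - \<delta>"
    proof -
      have "(1 + \<eta>) * (E\<^sub>0 + \<delta>) = E\<^sub>0 + \<delta> + \<delta>" using \<eta>(2) by (simp only: distrib_right mult_1)
      moreover have "N = E\<^sub>0 + 4 * \<delta>" unfolding \<delta>_def by (simp add: field_simps)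
      ultimately show ?thesis unfolding \<kappa>(2) by linarith
    qed
    finally show ?thesis .
  qed
  define U where "U = ball (0 :: real ^ 'm) r"
  have [measurable]: "U \<in> sets borel" by (simp add: U_def)
  define G where "G x = (\<integral>\<^sup>+l. indicator U (l + x) \<partial>count_space P)" for x
  have G_meas [measurable]: "G \<in> borel_measurable borel"
    unfolding G_def[abs_def] by (intro borel_measurable_nn_integral_count_space P.countable) measurable
  have F_eq: "F x = (\<integral>\<^sup>+l. local_energy f (l + x) \<partial>count_space (model_set \<Gamma> {-a..a}))" for x
    unfolding F_def energy_shift ..
  have p [measurable]: "local_energy f \<in> borel_measurable borel" by (rule local_energy_measurable[OF f])
  have F_meas [measurable]: "F \<in> borel_measurable borel"
    unfolding F_eq[abs_def] by (intro borel_measurable_nn_integral_count_space countable) measurable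
  \<comment> \<open>Only boundedly many almost periods lie near a given point, so dividing by \<open>C'\<close> turns the count \<open>G\<close> into a lower bound for the deficit.\<close>
  have G_le: "G x \<le> ennreal C'" for x
  proof -
    have "indicator U (l + x) \<le> (indicator (cube (- x - (\<chi> i. 1 / 2)) 1) l :: ennreal)" for l
    proof (cases "l + x \<in> U")
      case True
      then have "norm (l + x) < 1 / 2" using r by (simp add: U_def)
      then have lx: "\<bar>l $ i + x $ i\<bar> < 1 / 2" for i
        using component_le_norm_cart[of "l + x" i] by simp
      have "- x $ i - 1 / 2 \<le> l $ i \<and> l $ i \<le> - x $ i - 1 / 2 + 1" for i
        using lx[of i] unfolding abs_less_iff by (intro conjI) linarith+
      then show ?thesis by (simp add: mem_box_cart indicator_def)
    qed simp
    then have "G x \<le> (\<integral>\<^sup>+l. indicator (cube (- x - (\<chi> i. 1 / 2)) 1) l \<partial>count_space P)"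
      unfolding G_def by (intro nn_integral_mono)
    also have "\<dots> = ennreal (card (P \<inter> cube (- x - (\<chi> i. 1 / 2)) 1))"
      by (rule nn_integral_indicator_count_space) (rule P.finite_count, simp)
    also have "\<dots> \<le> ennreal C'" using P.count_le[of 1 "- x - (\<chi> i. 1 / 2)"] by (intro ennreal_leI) simp
    finally show ?thesis .
  qed
  have sum_le: "F x + ennreal (\<delta> / C') * G x \<le> ennreal N" for x
  proof (cases "\<exists>l\<in>P. l + x \<in> U")
    case True
    then obtain l where l: "l \<in> P" "norm (l + x) < r" by (auto simp: U_def)
    have "F x \<le> ennreal (N - \<delta>)" using deficit[of "- l" "l + x"] l by simp
    moreover have "ennreal (\<delta> / C') * G x \<le> ennreal (\<delta> / C') * ennreal C'"
      by (intro mult_left_mono G_le) simp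
    moreover have "ennreal (\<delta> / C') * ennreal C' = ennreal \<delta>"
      using D' \<delta> by (simp flip: ennreal_mult)
    ultimately have "F x + ennreal (\<delta> / C') * G x \<le> ennreal (N - \<delta>) + ennreal \<delta>"
      by (metis add_mono)
    also have "\<dots> = ennreal N" using \<delta> E\<^sub>0 by (subst ennreal_plus[symmetric]) (auto simp: \<delta>_def field_simps)
    finally show ?thesis .
  next
    case False
    then have "G x = (\<integral>\<^sup>+l. 0 \<partial>count_space P)"
      unfolding G_def by (intro nn_integral_cong) (auto simp: indicator_def)
    then show ?thesis using F_le by simp
  qed
  have mean_le_N: "mean (real (Suc n)) F + ennreal (\<delta> / C') * mean (real (Suc n)) G \<le> ennreal N" for n
    using mean_le[of "real (Suc n)" "\<lambda>x. F x + ennreal (\<delta> / C') * G x", OF _ sum_le]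
    by (simp add: mean_add mean_cmult)
  \<comment> \<open>The spectral condition says that the mean of \<open>F\<close> already equals its upper bound \<open>N\<close>.\<close>
  have total: "ennreal D * (\<integral>\<^sup>+y. local_energy f y \<partial>lborel) = ennreal N"
  proof -
    have "ennreal D * (\<integral>\<^sup>+y. local_energy f y \<partial>lborel) = (\<integral>\<^sup>+w. ennreal D * (ennreal ((norm (ft f w))\<^sup>2) * weight w) \<partial>lborel)"
      unfolding integral_local_energy[OF f] by (subst nn_integral_cmult) auto
    also have "\<dots> = (\<integral>\<^sup>+w. ennreal ((norm (ft f w))\<^sup>2) \<partial>lborel)"
    proof (rule nn_integral_cong_AE)
      show "AE w in lborel. ennreal D * (ennreal ((norm (ft f w))\<^sup>2) * weight w) = ennreal ((norm (ft f w))\<^sup>2)"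
        using weight
      proof eventually_elim
        case (elim w)
        have "ennreal D * (ennreal ((norm (ft f w))\<^sup>2) * weight w) = ennreal ((norm (ft f w))\<^sup>2) * (ennreal D * weight w)"
          by (rule mult.left_commute)
        then show ?case by (simp add: elim)
      qed
    qed
    also have "\<dots> = ennreal N" unfolding plancherel[OF f] N(1)[symmetric] L2_norm_sq_lborel ..
    finally show ?thesis .
  qed
  have "(\<integral>\<^sup>+y. local_energy f y \<partial>lborel) < \<infinity>"
  proof (rule ccontr)
    assume "\<not> ?thesis"
    then have "(\<integral>\<^sup>+y. local_energy f y \<partial>lborel) = \<infinity>" by (simp add: less_top[symmetric])
    then show False using total D by (simp add: ennreal_mult_top)
  qed
  from mean_tendsto[OF p this] have lim_F: "(\<lambda>n. mean (real (Suc n)) F) \<longlonglongrightarrow> ennreal N"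
    unfolding total F_eq[abs_def] .
  have U_fin: "(\<integral>\<^sup>+y. indicator U y \<partial>lborel) < \<infinity>"
    using emeasure_bounded_finite[of U] by (simp add: U_def)
  have lim_G: "(\<lambda>n. mean (real (Suc n)) G) \<longlonglongrightarrow> ennreal D' * (\<integral>\<^sup>+y. indicator U y \<partial>lborel)"
    unfolding G_def[abs_def] by (rule P.mean_tendsto[OF _ U_fin]) simp
  have "(\<lambda>n. mean (real (Suc n)) F + ennreal (\<delta> / C') * mean (real (Suc n)) G)
     \<longlonglongrightarrow> ennreal N + ennreal (\<delta> / C') * (ennreal D' * (\<integral>\<^sup>+y. indicator U y \<partial>lborel))"
    by (intro tendsto_add lim_F ennreal_tendsto_cmult lim_G) simp
  then have "ennreal N + ennreal (\<delta> / C') * (ennreal D' * (\<integral>\<^sup>+y. indicator U y \<partial>lborel)) \<le> ennreal N + 0"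
    using mean_le_N by (intro LIMSEQ_le_const2) auto
  then have "ennreal (\<delta> / C') * (ennreal D' * emeasure lborel U) = 0"
    by (simp add: ennreal_add_left_cancel_le)
  moreover have "emeasure lborel U \<noteq> 0"
  proof
    assume "emeasure lborel U = 0"
    then have "U \<in> null_sets lebesgue" by (intro null_sets_completionI) (auto simp: null_sets_def)
    moreover have "\<not> negligible U" unfolding U_def using r(1) by (intro open_not_negligible) auto
    ultimately show False by (simp add: negligible_iff_null_sets)
  qed
  ultimately show False using \<delta> D' by (auto simp: not_le ennreal_eq_0_iff divide_le_0_iff)
qed

text \<open>The Bessel bound makes the energy continuous in \<open>f\<close>, so the identity passes from test functions
  to their \<open>L\<^sup>2\<close> limits.\<close>

lemma bessel_weight_imp_tight:
  assumes \<Gamma>: "cut_and_project_lattice \<Gamma>" and a: "0 < a"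
    and av: "averaging_set (model_set \<Gamma> {-a..a}) D C" and D: "0 < D"
    and bessel: "\<And>f. f \<in> borel_measurable borel \<Longrightarrow> L2_norm_sq f < \<infinity> \<Longrightarrow> energy (model_set \<Gamma> {-a..a}) f \<le> L2_norm_sq f"
    and weight: "AE w in lborel. ennreal D * weight w = 1"
    and f [measurable]: "f \<in> borel_measurable borel" and fin: "L2_norm_sq f < \<infinity>"
  shows "energy (model_set \<Gamma> {-a..a}) f = L2_norm_sq f"
proof (rule antisym)
  let ?E = "energy (model_set \<Gamma> {-a..a})"
  show "?E f \<le> L2_norm_sq f" by (rule bessel[OF f fin])
  obtain N where N: "L2_norm_sq f = ennreal N" "0 \<le> N" using fin by (cases "L2_norm_sq f") auto
  obtain E where E: "?E f = ennreal E" "0 \<le> E"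
    using bessel[OF f fin] fin by (cases "?E f") (auto simp: top_unique)
  have step: "N \<le> (1 + \<eta>)\<^sup>2 * E" if \<eta>: "0 < \<eta>" for \<eta>
  proof (rule field_le_epsilon)
    fix e :: real assume e: "0 < e"
    define c where "c = (1 + \<eta>) * (1 + 1 / \<eta>) + (1 + 1 / \<eta>)"
    have c: "0 < c" unfolding c_def using \<eta> by (intro add_pos_pos mult_pos_pos) auto
    obtain h where h: "h \<in> tame" "(\<integral>\<^sup>+t. ennreal ((norm (f t - h t))\<^sup>2) \<partial>lborel) < ennreal (e / c)"
      by (rule tame_dense[of f "e / c"]) (use fin e c in \<open>auto simp: L2_norm_sq_lborel\<close>)
    have [measurable]: "h \<in> borel_measurable borel" by (rule tameD(3)[OF h(1)])
    define q where "q = (\<lambda>t. f t - h t)"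
    have [measurable]: "q \<in> borel_measurable borel" unfolding q_def by measurable
    have q: "L2_norm_sq q \<le> ennreal (e / c)" using h(2) by (simp add: L2_norm_sq_lborel q_def)
    define q' where "q' = (\<lambda>t. h t - f t)"
    have [measurable]: "q' \<in> borel_measurable borel" unfolding q'_def by measurable
    have q': "L2_norm_sq q' \<le> ennreal (e / c)"
      using q by (simp add: L2_norm_sq_lborel q_def q'_def norm_minus_commute)
    have "L2_norm_sq f = L2_norm_sq (\<lambda>t. h t + q t)" by (simp add: q_def)
    also have "\<dots> \<le> ennreal (1 + \<eta>) * L2_norm_sq h + ennreal (1 + 1 / \<eta>) * L2_norm_sq q"
      by (rule L2_norm_sq_add_le) (use \<eta> in auto)
    finally have 1: "ennreal N \<le> ennreal (1 + \<eta>) * L2_norm_sq h + ennreal (1 + 1 / \<eta>) * L2_norm_sq q"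
      unfolding N(1) .
    have "L2_norm_sq h = ?E h"
      by (rule bessel_weight_imp_tight_tame[OF \<Gamma> a av D bessel weight h(1), symmetric])
    also have "?E h = ?E (\<lambda>t. f t + q' t)" by (simp add: q'_def)
    also have "\<dots> \<le> ennreal (1 + \<eta>) * ?E f + ennreal (1 + 1 / \<eta>) * ?E q'"
      by (rule energy_add_le) (use \<eta> fin le_less_trans[OF q'] in auto)
    also have "\<dots> \<le> ennreal (1 + \<eta>) * ennreal E + ennreal (1 + 1 / \<eta>) * ennreal (e / c)"
      using order_trans[OF bessel[of q'] q'] le_less_trans[OF q'] by (intro add_mono mult_left_mono) (auto simp: E)
    finally have 2: "L2_norm_sq h \<le> ennreal (1 + \<eta>) * ennreal E + ennreal (1 + 1 / \<eta>) * ennreal (e / c)" .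
    have "ennreal N \<le> ennreal (1 + \<eta>) * (ennreal (1 + \<eta>) * ennreal E + ennreal (1 + 1 / \<eta>) * ennreal (e / c))
        + ennreal (1 + 1 / \<eta>) * ennreal (e / c)"
      by (rule order_trans[OF 1]) (intro add_mono mult_left_mono 2 q; simp)
    also have "\<dots> = ennreal ((1 + \<eta>) * ((1 + \<eta>) * E + (1 + 1 / \<eta>) * (e / c)) + (1 + 1 / \<eta>) * (e / c))"
      using \<eta> E e c by (simp flip: ennreal_mult ennreal_plus)
    also have "(1 + \<eta>) * ((1 + \<eta>) * E + (1 + 1 / \<eta>) * (e / c)) + (1 + 1 / \<eta>) * (e / c) = (1 + \<eta>)\<^sup>2 * E + c * (e / c)"
    proof -
      have "p * (p * E + d * u) + d * u = p\<^sup>2 * E + (p * d + d) * u" for p d u :: real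
        by (simp add: power2_eq_square algebra_simps)
      then show ?thesis unfolding c_def .
    qed
    also have "c * (e / c) = e" using c by simp
    finally show "N \<le> (1 + \<eta>)\<^sup>2 * E + e" using e E(2) by (subst (asm) ennreal_le_iff) auto
  qed
  have "(\<lambda>n. (1 + 1 / real (Suc n))\<^sup>2 * E) \<longlonglongrightarrow> (1 + 0)\<^sup>2 * E"
    by (intro tendsto_intros LIMSEQ_Suc lim_const_over_n)
  then have "N \<le> (1 + 0)\<^sup>2 * E"
    by (rule LIMSEQ_le_const) (use step in auto)
  then show "L2_norm_sq f \<le> ?E f" unfolding N E by (simp add: ennreal_leI)
qed

end

section \<open>Lebesgue classes and the amalgam space\<close>

lemma complex_lebesgue_borel_representative:
  fixes f :: "'a::euclidean_space \<Rightarrow> complex"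
  assumes [measurable]: "f \<in> borel_measurable lebesgue"
  obtains f' where "f' \<in> borel_measurable borel" "AE t in lborel. f t = f' t"
proof -
  have "(\<lambda>t. Re (f t)) \<in> borel_measurable lebesgue" "(\<lambda>t. Im (f t)) \<in> borel_measurable lebesgue" by measurable
  then obtain u v where u: "u \<in> borel_measurable lborel" "AE t in lborel. Re (f t) = u t"
    and v: "v \<in> borel_measurable lborel" "AE t in lborel. Im (f t) = v t"
    using completion_ex_borel_measurable_real by metis
  show ?thesis
  proof (rule that[of "\<lambda>t. Complex (u t) (v t)"])
    have "(\<lambda>t. complex_of_real (u t) + \<i> * complex_of_real (v t)) \<in> borel_measurable borel" using u(1) v(1) by simp
    then show "(\<lambda>t. Complex (u t) (v t)) \<in> borel_measurable borel" by (simp add: Complex_eq)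
    show "AE t in lborel. f t = Complex (u t) (v t)"
      using u(2) v(2) by eventually_elim (simp add: complex_eq_iff)
  qed
qed

text \<open>The exceptional set of \<open>P\<close> need not be Borel, so it is enclosed in a Borel null set before
  shifting.\<close>

lemma AE_lborel_shift:
  fixes y :: "'a::euclidean_space"
  assumes "AE t in lborel. P t"
  shows "AE t in lborel. P (t - y)"
proof -
  obtain N where N: "{t. \<not> P t} \<subseteq> N" "emeasure lborel N = 0" "N \<in> sets lborel"
    using AE_E[OF assms] by auto
  show ?thesis
  proof (rule AE_I)
    show "{t \<in> space lborel. \<not> P (t - y)} \<subseteq> (+) y ` N"
    proof
      fix t assume "t \<in> {t \<in> space lborel. \<not> P (t - y)}"
      then have "t - y \<in> N" using N(1) by auto
      then show "t \<in> (+) y ` N" by (intro image_eqI[of _ _ "t - y"]) auto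
    qed
  qed (use emeasure_lborel_translate[OF N(3), of y] N(2) in auto)
qed

lemma lebesgue_integral_eq_lborel:
  fixes f :: "'a::euclidean_space \<Rightarrow> complex"
  assumes [measurable]: "f' \<in> borel_measurable borel" and ae: "AE t in lborel. f t = f' t"
  shows "(LINT t|lebesgue. f t) = (LINT t|lborel. f' t)"
proof -
  have ae': "AE t in lebesgue. f' t = f t" using ae by (simp add: AE_completion_iff eq_commute)
  have f': "f' \<in> borel_measurable lebesgue" by (rule measurable_completion) simp
  then have "f \<in> borel_measurable lebesgue" using ae' by (rule borel_measurable_AE)
  then have "(LINT t|lebesgue. f t) = (LINT t|lebesgue. f' t)"
    using f' ae' by (intro integral_cong_AE) (auto elim: eventually_mono)
  also have "\<dots> = (LINT t|lborel. f' t)" by (rule integral_completion) simp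
  finally show ?thesis .
qed

lemma L2_inner_translation:
  assumes [measurable]: "f' \<in> borel_measurable borel" "h' \<in> borel_measurable borel"
    and f: "AE t in lborel. f t = f' t" and h: "AE t in lborel. h t = h' t"
  shows "L2_inner f (translation y h) = corr f' h' y"
  unfolding L2_inner_def translation_def corr_def
proof (rule lebesgue_integral_eq_lborel)
  show "AE t in lborel. f t * cnj (h (t - y)) = f' t * cnj (h' (t - y))"
    using f AE_lborel_shift[OF h, of y] by eventually_elim simp
qed measurable

lemma fourier_eq_ft:
  assumes [measurable]: "h' \<in> borel_measurable borel" and h: "AE t in lborel. h t = h' t"
  shows "fourier h w = ft h' w"
  unfolding fourier_def ft_def
proof (rule lebesgue_integral_eq_lborel)
  have "exp (- (2 * pi * \<i> * of_real (t \<bullet> w))) = cis (- (2 * pi * (t \<bullet> w)))" for t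
    by (simp add: cis_conv_exp mult_ac)
  then show "AE t in lborel. h t * exp (- (2 * pi * \<i> * of_real (t \<bullet> w))) = h' t * cis (- (2 * pi * (t \<bullet> w)))"
    using h by simp
qed measurable

lemma L2_norm_sq_cong_AE: "AE t in lborel. f t = f' t \<Longrightarrow> L2_norm_sq f = L2_norm_sq f'"
  unfolding L2_norm_sq_lborel by (intro nn_integral_cong_AE) (auto elim: eventually_mono)

lemma ennreal_powr_1: "ennreal_powr x 1 = x"
  by (cases x) (auto simp: ennreal_powr_def)

lemma ennreal_powr_half_square: "ennreal_powr x (1 / 2) ^ 2 = x"
proof (cases x)
  case (real r)
  have "(r powr (1 / 2))\<^sup>2 = r" using real by (simp add: powr_half_sqrt)
  then show ?thesis using real by (simp add: ennreal_powr_def ennreal_power)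
qed (simp add: ennreal_powr_def)

lemma power_mono_ennreal_cancel:
  fixes x y :: ennreal
  assumes "x\<^sup>2 \<le> y\<^sup>2"
  shows "x \<le> y"
proof (cases x; cases y)
  fix r s assume "x = ennreal r" "0 \<le> r" "y = ennreal s" "0 \<le> s"
  with assms show ?thesis
    by (auto simp: ennreal_power ennreal_le_iff power2_le_iff_abs_le)
next
  fix s assume "x = top" "y = ennreal s" "0 \<le> s"
  with assms show ?thesis by (simp add: ennreal_power top_unique)
qed auto

lemma countable_integer_vectors: "countable (integer_vectors :: (real ^ 'm) set)"
proof -
  have "integer_vectors \<subseteq> (\<lambda>c. \<chi> i. real_of_int (c i)) ` (UNIV :: ('m \<Rightarrow> int) set)"
  proof
    fix k :: "real ^ 'm" assume "k \<in> integer_vectors"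
    then have "k = (\<chi> i. real_of_int \<lfloor>k $ i\<rfloor>)"
      by (auto simp: integer_vectors_def vec_eq_iff)
    then show "k \<in> (\<lambda>c. \<chi> i. real_of_int (c i)) ` UNIV"
      by (intro image_eqI[of _ _ "\<lambda>i. \<lfloor>k $ i\<rfloor>"]) simp_all
  qed
  moreover have "countable (UNIV :: ('m \<Rightarrow> int) set)" by (rule countableI_type)
  ultimately show ?thesis by (meson countable_image countable_subset)
qed

text \<open>Local \<open>L\<^sup>2\<close> norms that are summable over unit cubes control the integral by Cauchy-Schwarz on each
  cube, and the global \<open>L\<^sup>2\<close> norm because a summable sequence is square summable.\<close>

lemma wiener_amalgam_2_1:
  fixes h :: "real ^ 'm \<Rightarrow> complex"
  assumes h: "h \<in> wiener_amalgam 2 1"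
  obtains h' where "h' \<in> borel_measurable borel" "AE t in lborel. h t = h' t"
    "integrable lborel h'" "L2_norm_sq h' < \<infinity>"
proof -
  have "h \<in> borel_measurable lebesgue" using h by (simp add: wiener_amalgam_def)
  then obtain h' where h'[measurable]: "h' \<in> borel_measurable borel" and ae: "AE t in lborel. h t = h' t"
    by (rule complex_lebesgue_borel_representative)
  let ?Z = "integer_vectors :: (real ^ 'm) set"
  define I where "I k = (\<integral>\<^sup>+t. ennreal ((norm (h' t))\<^sup>2) * indicator (cube k 1) t \<partial>lborel)" for k
  define a where "a k = ennreal_powr (I k) (1 / 2)" for k
  have a2: "(a k)\<^sup>2 = I k" for k unfolding a_def by (rule ennreal_powr_half_square)
  have Lp: "Lp_norm 2 (\<lambda>t. h t * indicator ((\<lambda>s. k + s) ` unit_cube) t) = a k" for k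
  proof -
    have "(\<lambda>s. k + s) ` unit_cube = cube k 1" using image_unit_cube[of 1 k] by simp
    then have "(\<integral>\<^sup>+t. ennreal (norm (h t * indicator ((\<lambda>s. k + s) ` unit_cube) t) powr 2) \<partial>lborel) = I k"
      unfolding I_def using ae
      by (intro nn_integral_cong_AE) (auto elim!: eventually_mono simp: indicator_def)
    then show ?thesis unfolding Lp_norm_def a_def by (simp add: nn_integral_completion)
  qed
  have "amalgam_norm 2 1 h < \<infinity>" using h by (simp add: wiener_amalgam_def)
  then have "(\<Sum>\<^sub>\<infinity>k\<in>?Z. a k) < \<infinity>"
    unfolding amalgam_norm_def Lp by (simp add: ennreal_powr_1)
  then have fin: "(\<integral>\<^sup>+k. a k \<partial>count_space ?Z) < \<infinity>"
    by (simp add: infsum_eq_nn_integral_count_space[OF countable_integer_vectors])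
  define S where "S = (\<integral>\<^sup>+k. a k \<partial>count_space ?Z)"
  have a_le: "a k \<le> S" if "k \<in> ?Z" for k unfolding S_def using that by (rule nn_integral_ge_point)
  have cover: "(1 :: ennreal) \<le> (\<integral>\<^sup>+k. indicator (cube k 1) t \<partial>count_space ?Z)" for t :: "real ^ 'm"
  proof -
    let ?k = "(\<chi> i. of_int \<lfloor>t $ i\<rfloor>) :: real ^ 'm"
    have "?k \<in> ?Z" by (simp add: integer_vectors_def)
    moreover have "t \<in> cube ?k 1" by (auto simp: mem_box_cart)
    ultimately show ?thesis
      using nn_integral_ge_point[of ?k ?Z "\<lambda>k. indicator (cube k 1) t"] by simp
  qed
  have split: "(\<integral>\<^sup>+t. F t \<partial>lborel) \<le> (\<integral>\<^sup>+k. (\<integral>\<^sup>+t. F t * indicator (cube k 1) t \<partial>lborel) \<partial>count_space ?Z)"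
    if [measurable]: "F \<in> borel_measurable borel" for F :: "real ^ 'm \<Rightarrow> ennreal"
  proof -
    have "(\<integral>\<^sup>+t. F t \<partial>lborel) \<le> (\<integral>\<^sup>+t. F t * (\<integral>\<^sup>+k. indicator (cube k 1) t \<partial>count_space ?Z) \<partial>lborel)"
    proof (rule nn_integral_mono)
      fix t
      show "F t \<le> F t * (\<integral>\<^sup>+k. indicator (cube k 1) t \<partial>count_space ?Z)"
        using mult_left_mono[OF cover[of t], of "F t"] by simp
    qed
    also have "\<dots> = (\<integral>\<^sup>+t. (\<integral>\<^sup>+k. F t * indicator (cube k 1) t \<partial>count_space ?Z) \<partial>lborel)"
      by (simp add: nn_integral_cmult)
    also have "\<dots> = (\<integral>\<^sup>+k. (\<integral>\<^sup>+t. F t * indicator (cube k 1) t \<partial>lborel) \<partial>count_space ?Z)"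
      by (rule nn_integral_count_space_nn_integral[OF countable_integer_vectors]) measurable
    finally show ?thesis .
  qed
  have "L2_norm_sq h' \<le> (\<integral>\<^sup>+k. a k * a k \<partial>count_space ?Z)"
    unfolding L2_norm_sq_lborel power2_eq_square[of "a _", symmetric] a2 I_def by (rule split) measurable
  also have "\<dots> \<le> (\<integral>\<^sup>+k. S * a k \<partial>count_space ?Z)"
    by (rule nn_integral_mono) (auto intro: mult_right_mono a_le)
  also have "\<dots> = S * S" unfolding S_def by (simp add: nn_integral_cmult)
  also have "\<dots> < \<infinity>" using fin by (simp add: S_def ennreal_mult_less_top)
  finally have L2: "L2_norm_sq h' < \<infinity>" .
  have "(\<integral>\<^sup>+t. ennreal (norm (h' t)) \<partial>lborel) \<le> (\<integral>\<^sup>+k. (\<integral>\<^sup>+t. ennreal (norm (h' t)) * indicator (cube k 1) t \<partial>lborel) \<partial>count_space ?Z)"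
    by (rule split) measurable
  also have "\<dots> \<le> (\<integral>\<^sup>+k. a k \<partial>count_space ?Z)"
  proof (rule nn_integral_mono)
    fix k :: "real ^ 'm"
    define J where "J = (\<integral>\<^sup>+t. ennreal (norm (h' t)) * indicator (cube k 1) t \<partial>lborel)"
    \<comment> \<open>Cauchy-Schwarz on a cube of volume one bounds the \<open>L\<^sup>1\<close> norm by the \<open>L\<^sup>2\<close> norm.\<close>
    have "J = (\<integral>\<^sup>+t. (ennreal (norm (h' t)) * indicator (cube k 1) t) * indicator (cube k 1) t \<partial>lborel)"
      unfolding J_def by (intro nn_integral_cong) (auto simp: indicator_def)
    then have "J\<^sup>2 \<le> (\<integral>\<^sup>+t. (ennreal (norm (h' t)) * indicator (cube k 1) t)\<^sup>2 \<partial>lborel) * (\<integral>\<^sup>+t. (indicator (cube k 1) t)\<^sup>2 \<partial>lborel)"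
      using Cauchy_Schwarz_nn_integral[of "\<lambda>t. ennreal (norm (h' t)) * indicator (cube k 1) t" lborel "indicator (cube k 1)"] by simp
    also have "(\<integral>\<^sup>+t. (ennreal (norm (h' t)) * indicator (cube k 1) t)\<^sup>2 \<partial>lborel) = I k"
      unfolding I_def by (intro nn_integral_cong) (auto simp: indicator_def ennreal_power)
    also have "(\<integral>\<^sup>+t. (indicator (cube k 1) t)\<^sup>2 \<partial>lborel) = (\<integral>\<^sup>+t. indicator (cube k 1) t \<partial>lborel)"
      by (intro nn_integral_cong) (auto simp: indicator_def)
    also have "\<dots> = 1" by (simp add: emeasure_cube)
    finally have "J\<^sup>2 \<le> (a k)\<^sup>2" by (simp add: a2)
    then show "(\<integral>\<^sup>+t. ennreal (norm (h' t)) * indicator (cube k 1) t \<partial>lborel) \<le> a k"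
      unfolding J_def[symmetric] using power_mono_ennreal_cancel by blast
  qed
  also have "\<dots> < \<infinity>" by (rule fin)
  finally have "integrable lborel h'" by (simp add: integrable_iff_bounded)
  with L2 show ?thesis by (intro that[OF h' ae])
qed

lemma symmetric_window:
  assumes "model_window \<Omega>" "uminus ` \<Omega> = \<Omega>"
  obtains a where "0 < a" "\<Omega> = {-a..a}"
proof -
  obtain c d where cd: "\<Omega> = {c..d}"
    using assms(1) is_interval_compact[of \<Omega>] by (auto simp: model_window_def)
  have ne: "interior {c..d} \<noteq> {}" using assms(1) cd by (simp add: model_window_def)
  then have lt: "c < d" by (auto simp: interior_atLeastAtMost_real)
  have "{-d..-c} = {c..d}" using assms(2) unfolding cd by simp
  then have "c = -d" using lt by (simp add: Icc_eq_Icc)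
  then show ?thesis using lt cd by (intro that[of d]) auto
qed

theorem theorem4p8:
  fixes \<Gamma> :: "((real ^ 'm) \<times> real) set"
    and \<Omega> :: "real set"
    and K :: "'k set"
    and g :: "'k \<Rightarrow> real ^ 'm \<Rightarrow> complex"
  assumes "cut_and_project_lattice \<Gamma>"
    and "model_window \<Omega>"
    and "generic_window \<Gamma> \<Omega>"
    and "snd ` dual_lattice \<Gamma> \<inter> frontier \<Omega> = {}"
    and "uminus ` \<Omega> = \<Omega>"
    and "countable K"
    and "\<And>k. k \<in> K \<Longrightarrow> g k \<in> wiener_amalgam 2 1"
  shows "normalized_tight_frame (model_set \<Gamma> \<Omega>) K g \<longleftrightarrow>
           bessel_with_bound (model_set \<Gamma> \<Omega>) K g 1 \<and>
           (AE t in lebesgue.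
              ennreal (point_density (model_set \<Gamma> \<Omega>)) *
                (\<Sum>\<^sub>\<infinity>k\<in>K. ennreal ((cmod (fourier (g k) t))\<^sup>2)) = 1)"
proof -
  obtain a where a: "0 < a" and \<Omega>: "\<Omega> = {-a..a}"
    by (rule symmetric_window[OF assms(2,5)])
  define \<Lambda> where "\<Lambda> = model_set \<Gamma> {-a..a}"
  obtain D C where D: "0 < D" and av: "averaging_set \<Lambda> D C"
    unfolding \<Lambda>_def by (rule averaging_set_model_set[OF assms(1) a])
  interpret averaging_set \<Lambda> D C by (rule av)
  have density_eq: "point_density \<Lambda> = D" by (rule point_density_eq[OF density])
  have "\<exists>h. h \<in> borel_measurable borel \<and> (AE t in lborel. g k t = h t) \<and> integrable lborel h \<and> L2_norm_sq h < \<infinity>"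
    if "k \<in> K" for k
    using wiener_amalgam_2_1[OF assms(7)[OF that]] by metis
  then obtain g' where g': "\<And>k. k \<in> K \<Longrightarrow> g' k \<in> borel_measurable borel"
      "\<And>k. k \<in> K \<Longrightarrow> AE t in lborel. g k t = g' k t"
      "\<And>k. k \<in> K \<Longrightarrow> integrable lborel (g' k)" "\<And>k. k \<in> K \<Longrightarrow> L2_norm_sq (g' k) < \<infinity>"
    by metis
  interpret generators K g' by unfold_locales (use assms(6) g' in auto)
  have frame_sum: "frame_sum \<Lambda> K g f = energy \<Lambda> f'"
    if "f' \<in> borel_measurable borel" "AE t in lborel. f t = f' t" for f f'
  proof -
    have "frame_sum \<Lambda> K g f = (\<integral>\<^sup>+k. \<integral>\<^sup>+l. ennreal ((norm (L2_inner f (translation l (g k))))\<^sup>2) \<partial>count_space \<Lambda> \<partial>count_space K)"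
      unfolding frame_sum_def by (simp add: infsum_eq_nn_integral_count_space countable assms(6))
    also have "\<dots> = (\<integral>\<^sup>+k. \<integral>\<^sup>+l. ennreal ((norm (corr f' (g' k) l))\<^sup>2) \<partial>count_space \<Lambda> \<partial>count_space K)"
      by (rule nn_integral_cong) (simp add: L2_inner_translation[OF that(1) g'(1) that(2) g'(2)])
    also have "\<dots> = energy \<Lambda> f'"
      unfolding energy_def local_energy_def
      by (rule nn_integral_count_space_nn_integral[symmetric, OF assms(6)]) simp
    finally show ?thesis .
  qed
  \<comment> \<open>Both frame conditions quantify over Lebesgue measurable functions, which may be replaced by Borel representatives.\<close>
  have quantify: "(\<forall>f\<in>L2. Q (frame_sum \<Lambda> K g f) (L2_norm_sq f)) \<longleftrightarrow>
      (\<forall>f. f \<in> borel_measurable borel \<longrightarrow> L2_norm_sq f < \<infinity> \<longrightarrow> Q (energy \<Lambda> f) (L2_norm_sq f))"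
    for Q :: "ennreal \<Rightarrow> ennreal \<Rightarrow> bool"
  proof (intro iffI ballI allI impI)
    fix f :: "real ^ 'm \<Rightarrow> complex"
    assume Q: "\<forall>f\<in>L2. Q (frame_sum \<Lambda> K g f) (L2_norm_sq f)"
      and f: "f \<in> borel_measurable borel" "L2_norm_sq f < \<infinity>"
    have "f \<in> borel_measurable lebesgue" by (rule measurable_completion) (simp add: f)
    then have "f \<in> L2" using f(2) by (simp add: L2_def L2_norm_sq_def)
    then have "Q (frame_sum \<Lambda> K g f) (L2_norm_sq f)" using Q by blast
    then show "Q (energy \<Lambda> f) (L2_norm_sq f)" using frame_sum[OF f(1), of f] by simp
  next
    fix f :: "real ^ 'm \<Rightarrow> complex"
    assume Q: "\<forall>f. f \<in> borel_measurable borel \<longrightarrow> L2_norm_sq f < \<infinity> \<longrightarrow> Q (energy \<Lambda> f) (L2_norm_sq f)"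
      and f: "f \<in> L2"
    have "f \<in> borel_measurable lebesgue" using f by (simp add: L2_def)
    then obtain f' where f': "f' \<in> borel_measurable borel" "AE t in lborel. f t = f' t"
      by (rule complex_lebesgue_borel_representative)
    have "L2_norm_sq f < \<infinity>" using f by (simp add: L2_def L2_norm_sq_def)
    then show "Q (frame_sum \<Lambda> K g f) (L2_norm_sq f)"
      using Q f'(1) unfolding frame_sum[OF f'] L2_norm_sq_cong_AE[OF f'(2)] by blast
  qed
  have tight: "normalized_tight_frame \<Lambda> K g \<longleftrightarrow>
      (\<forall>f. f \<in> borel_measurable borel \<longrightarrow> L2_norm_sq f < \<infinity> \<longrightarrow> energy \<Lambda> f = L2_norm_sq f)"
    unfolding normalized_tight_frame_def by (rule quantify)
  have bessel: "bessel_with_bound \<Lambda> K g 1 \<longleftrightarrow>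
      (\<forall>f. f \<in> borel_measurable borel \<longrightarrow> L2_norm_sq f < \<infinity> \<longrightarrow> energy \<Lambda> f \<le> L2_norm_sq f)"
    unfolding bessel_with_bound_def using quantify[of "(\<le>)"] by simp
  have weight: "(\<Sum>\<^sub>\<infinity>k\<in>K. ennreal ((norm (fourier (g k) t))\<^sup>2)) = weight t" for t
    unfolding infsum_eq_nn_integral_count_space[OF assms(6)] weight_def
    by (rule nn_integral_cong) (simp add: fourier_eq_ft[OF g'(1,2)])
  have ae: "(AE t in lebesgue. ennreal (point_density \<Lambda>) * (\<Sum>\<^sub>\<infinity>k\<in>K. ennreal ((norm (fourier (g k) t))\<^sup>2)) = 1)
      \<longleftrightarrow> (AE t in lborel. ennreal D * weight t = 1)"
    unfolding density_eq weight AE_completion_iff ..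
  have "(\<forall>f. f \<in> borel_measurable borel \<longrightarrow> L2_norm_sq f < \<infinity> \<longrightarrow> energy \<Lambda> f = L2_norm_sq f) \<longleftrightarrow>
      (\<forall>f. f \<in> borel_measurable borel \<longrightarrow> L2_norm_sq f < \<infinity> \<longrightarrow> energy \<Lambda> f \<le> L2_norm_sq f) \<and>
      (AE t in lborel. ennreal D * weight t = 1)"
    (is "?tight \<longleftrightarrow> ?bessel \<and> ?weight")
  proof (intro iffI conjI)
    assume ?tight
    then show ?bessel by simp
    show ?weight by (rule tight_imp_weight_eq_1[OF av D]) (use \<open>?tight\<close> in blast)
  next
    assume bw: "?bessel \<and> ?weight"
    show ?tight
    proof (intro allI impI)
      fix f :: "real ^ 'm \<Rightarrow> complex"
      assume f: "f \<in> borel_measurable borel" "L2_norm_sq f < \<infinity>"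
      show "energy \<Lambda> f = L2_norm_sq f"
        unfolding \<Lambda>_def
        by (rule bessel_weight_imp_tight[OF assms(1) a av[unfolded \<Lambda>_def] D _ _ f])
          (use bw in \<open>auto simp: \<Lambda>_def\<close>)
    qed
  qed
  then show ?thesis unfolding \<Omega> \<Lambda>_def[symmetric] tight bessel ae .
qed

end
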